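(* For every prime $p>2$ and every integer $g\ge 1$, let $P_2(p,g)$ be the probability that, for $f(x)$ chosen uniformly at random from $\mathcal{H}_{2g+2}$, the Jacobian of the nonsingular complete model of the genus $g$ curve $y^2=f(x)$ over $\mathbb{F}_p$ has a prime number of $\mathbb{F}_p$-rational points. Then $\lim_{p, g \rightarrow \infty} P_2(p,g) = 0$.
   Context: $\mathcal{H}_{2g+2}$ denotes the set of square-free polynomials $f(x)\in\mathbb{F}_p[x]$ of degree exactly $2g+2$. The limit is taken as both the prime $p$ and the genus $g$ tend to infinity. *)

theory Defs
  imports
    "HOL-Number_Theory.Residues"
    "HOL-Algebra.Algebraic_Closure"
    "HOL-Algebra.Free_Abelian_Groups"
    "HOL-Probability.Probability_Mass_Function"
begin

section \<open>Fraction field of a domain\<close>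

definition frac_rel :: "('a, 'm) ring_scheme \<Rightarrow> (('a \<times> 'a) \<times> ('a \<times> 'a)) set" where
  "frac_rel R = {((a, b), (c, d)).
     a \<in> carrier R \<and> b \<in> carrier R - {\<zero>\<^bsub>R\<^esub>} \<and>
     c \<in> carrier R \<and> d \<in> carrier R - {\<zero>\<^bsub>R\<^esub>} \<and>
     a \<otimes>\<^bsub>R\<^esub> d = c \<otimes>\<^bsub>R\<^esub> b}"

definition fraction :: "('a, 'm) ring_scheme \<Rightarrow> 'a \<Rightarrow> 'a \<Rightarrow> ('a \<times> 'a) set" where
  "fraction R a b = frac_rel R `` {(a, b)}"

definition frac_field :: "('a, 'm) ring_scheme \<Rightarrow> ('a \<times> 'a) set ring" where
  "frac_field R =
     \<lparr> carrier = (carrier R \<times> (carrier R - {\<zero>\<^bsub>R\<^esub>})) // frac_rel R,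
       monoid.mult = (\<lambda>U V. \<Union>(a, b)\<in>U. \<Union>(c, d)\<in>V. fraction R (a \<otimes>\<^bsub>R\<^esub> c) (b \<otimes>\<^bsub>R\<^esub> d)),
       monoid.one = fraction R \<one>\<^bsub>R\<^esub> \<one>\<^bsub>R\<^esub>,
       ring.zero = fraction R \<zero>\<^bsub>R\<^esub> \<one>\<^bsub>R\<^esub>,
       ring.add = (\<lambda>U V. \<Union>(a, b)\<in>U. \<Union>(c, d)\<in>V.
                fraction R (a \<otimes>\<^bsub>R\<^esub> d \<oplus>\<^bsub>R\<^esub> c \<otimes>\<^bsub>R\<^esub> b) (b \<otimes>\<^bsub>R\<^esub> d)) \<rparr>"


section \<open>Complete nonsingular curves and their divisor class groups\<close>

text \<open>
  Let \<open>K\<close> be a function field in one variable over an algebraically closed subfield \<open>k\<close>.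
  The points of the complete nonsingular curve with function field \<open>K\<close> are the discrete
  valuation rings of \<open>K\<close> over \<open>k\<close> (Hartshorne, Section I.6).  A point is represented here by
  the normalized valuation of its ring, that is, by the order of vanishing at the point, as a
  function on the nonzero elements of \<open>K\<close> (with value \<open>undefined\<close> elsewhere).
\<close>

definition curve_points :: "('a, 'm) ring_scheme \<Rightarrow> 'a set \<Rightarrow> ('a \<Rightarrow> int) set" where
  "curve_points K k = {v \<in> extensional (carrier K - {\<zero>\<^bsub>K\<^esub>}).
     v ` (carrier K - {\<zero>\<^bsub>K\<^esub>}) = UNIV \<and>
     (\<forall>a\<in>carrier K - {\<zero>\<^bsub>K\<^esub>}. \<forall>b\<in>carrier K - {\<zero>\<^bsub>K\<^esub>}.
        v (a \<otimes>\<^bsub>K\<^esub> b) = v a + v b \<and>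
        (a \<oplus>\<^bsub>K\<^esub> b \<noteq> \<zero>\<^bsub>K\<^esub> \<longrightarrow> min (v a) (v b) \<le> v (a \<oplus>\<^bsub>K\<^esub> b))) \<and>
     (\<forall>c\<in>k - {\<zero>\<^bsub>K\<^esub>}. v c = 0)}"

definition divisor_group :: "('a, 'm) ring_scheme \<Rightarrow> 'a set \<Rightarrow> (('a \<Rightarrow> int) \<Rightarrow>\<^sub>0 int) monoid" where
  "divisor_group K k = free_Abelian_group (curve_points K k)"

text \<open>All points have degree one, since \<open>k\<close> is algebraically closed.\<close>

definition divisor_degree :: "(('a \<Rightarrow> int) \<Rightarrow>\<^sub>0 int) \<Rightarrow> int" where
  "divisor_degree D = (\<Sum>v\<in>Poly_Mapping.keys D. Poly_Mapping.lookup D v)"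

definition principal_divisors ::
  "('a, 'm) ring_scheme \<Rightarrow> 'a set \<Rightarrow> (('a \<Rightarrow> int) \<Rightarrow>\<^sub>0 int) set" where
  "principal_divisors K k = {D \<in> carrier (divisor_group K k).
     \<exists>h\<in>carrier K - {\<zero>\<^bsub>K\<^esub>}. \<forall>v\<in>curve_points K k. Poly_Mapping.lookup D v = v h}"

definition Pic :: "('a, 'm) ring_scheme \<Rightarrow> 'a set \<Rightarrow> (('a \<Rightarrow> int) \<Rightarrow>\<^sub>0 int) set monoid" where
  "Pic K k = divisor_group K k Mod principal_divisors K k"

definition Pic0 :: "('a, 'm) ring_scheme \<Rightarrow> 'a set \<Rightarrow> (('a \<Rightarrow> int) \<Rightarrow>\<^sub>0 int) set set" where
  "Pic0 K k = {c \<in> carrier (Pic K k). \<exists>D\<in>c. divisor_degree D = 0}"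

text \<open>An automorphism \<open>\<sigma>\<close> of \<open>K\<close> mapping \<open>k\<close> onto itself acts on points by
  \<open>v \<mapsto> v \<circ> \<sigma>\<close>.  This is a right action; only the classes fixed by a whole group matter below.\<close>

definition divisor_action ::
  "('a, 'm) ring_scheme \<Rightarrow> ('a \<Rightarrow> 'a) \<Rightarrow> (('a \<Rightarrow> int) \<Rightarrow>\<^sub>0 int) \<Rightarrow> (('a \<Rightarrow> int) \<Rightarrow>\<^sub>0 int)" where
  "divisor_action K \<sigma> = frag_extend (\<lambda>v. frag_of (compose (carrier K - {\<zero>\<^bsub>K\<^esub>}) v \<sigma>))"


section \<open>The hyperelliptic curve \<open>y\<^sup>2 = f(x)\<close> over \<open>F\<^sub>p\<close> and its Jacobian\<close>

abbreviation Fp :: "nat \<Rightarrow> int ring" where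
  "Fp p \<equiv> residue_ring (int p)"

type_synonym fpbar = "(int list \<times> nat) multiset \<Rightarrow> int"

abbreviation Fpbar :: "nat \<Rightarrow> fpbar ring" where
  "Fpbar p \<equiv> field.alg_closure (Fp p)"

abbreviation Fp_emb :: "nat \<Rightarrow> int \<Rightarrow> fpbar" where
  "Fp_emb p \<equiv> ring.indexed_const (Fp p)"

text \<open>
  Polynomials are coefficient lists with the leading coefficient first and the zero polynomial
  being the empty list.
\<close>

definition Fpbar_x :: "nat \<Rightarrow> (fpbar list \<times> fpbar list) set ring" where
  "Fpbar_x p = frac_field (poly_ring (Fpbar p))"

definition Fpbar_x_of_poly :: "nat \<Rightarrow> fpbar list \<Rightarrow> (fpbar list \<times> fpbar list) set" where
  "Fpbar_x_of_poly p q = fraction (poly_ring (Fpbar p)) q \<one>\<^bsub>poly_ring (Fpbar p)\<^esub>"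

text \<open>The polynomial \<open>Y\<^sup>2 - f(x)\<close> over the rational function field.\<close>

definition curve_poly :: "nat \<Rightarrow> int list \<Rightarrow> (fpbar list \<times> fpbar list) set list" where
  "curve_poly p f = [\<one>\<^bsub>Fpbar_x p\<^esub>, \<zero>\<^bsub>Fpbar_x p\<^esub>,
     \<ominus>\<^bsub>Fpbar_x p\<^esub> Fpbar_x_of_poly p (map (Fp_emb p) f)]"

type_synonym ff_elem = "(fpbar list \<times> fpbar list) set list set"

definition function_field :: "nat \<Rightarrow> int list \<Rightarrow> ff_elem ring" where
  "function_field p f = Rupt\<^bsub>Fpbar_x p\<^esub> (carrier (Fpbar_x p)) (curve_poly p f)"

text \<open>The residue class of a polynomial in \<open>Y\<close> modulo \<open>Y\<^sup>2 - f(x)\<close>.\<close>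

definition ff_class :: "nat \<Rightarrow> int list \<Rightarrow> (fpbar list \<times> fpbar list) set list \<Rightarrow> ff_elem" where
  "ff_class p f q =
     PIdl\<^bsub>poly_ring (Fpbar_x p)\<^esub> (curve_poly p f) +>\<^bsub>poly_ring (Fpbar_x p)\<^esub> q"

definition ff_of_poly :: "nat \<Rightarrow> int list \<Rightarrow> fpbar list \<Rightarrow> ff_elem" where
  "ff_of_poly p f q = ff_class p f (ring.poly_of_const (Fpbar_x p) (Fpbar_x_of_poly p q))"

definition ff_const :: "nat \<Rightarrow> int list \<Rightarrow> fpbar \<Rightarrow> ff_elem" where
  "ff_const p f c = ff_of_poly p f (ring.poly_of_const (Fpbar p) c)"

definition ff_x :: "nat \<Rightarrow> int list \<Rightarrow> ff_elem" where
  "ff_x p f = ff_of_poly p f X\<^bsub>Fpbar p\<^esub>"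

definition ff_y :: "nat \<Rightarrow> int list \<Rightarrow> ff_elem" where
  "ff_y p f = ff_class p f X\<^bsub>Fpbar_x p\<^esub>"

abbreviation ff_consts :: "nat \<Rightarrow> int list \<Rightarrow> ff_elem set" where
  "ff_consts p f \<equiv> ff_const p f ` carrier (Fpbar p)"

text \<open>
  The absolute Galois group of \<open>F\<^sub>p\<close>, acting on the function field of the curve over the
  algebraic closure through the coefficients, i.e. fixing \<open>x\<close> and \<open>y\<close>.
\<close>

definition galois_group :: "nat \<Rightarrow> int list \<Rightarrow> (ff_elem \<Rightarrow> ff_elem) set" where
  "galois_group p f = {\<sigma> \<in> ring_iso (function_field p f) (function_field p f).
     \<sigma> ` ff_consts p f = ff_consts p f \<and>
     (\<forall>c\<in>carrier (Fp p). \<sigma> (ff_const p f (Fp_emb p c)) = ff_const p f (Fp_emb p c)) \<and>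
     \<sigma> (ff_x p f) = ff_x p f \<and> \<sigma> (ff_y p f) = ff_y p f}"

text \<open>
  The points of the Jacobian over the algebraic closure are the divisor classes of degree zero,
  and its \<open>F\<^sub>p\<close>-rational points are the Galois-invariant ones among them.
\<close>

definition jacobian_rational_points ::
  "nat \<Rightarrow> int list \<Rightarrow> ((ff_elem \<Rightarrow> int) \<Rightarrow>\<^sub>0 int) set set" where
  "jacobian_rational_points p f =
     {c \<in> Pic0 (function_field p f) (ff_consts p f).
        \<forall>\<sigma>\<in>galois_group p f. divisor_action (function_field p f) \<sigma> ` c = c}"


section \<open>The probability\<close>

definition squarefree_poly :: "('a, 'm) ring_scheme \<Rightarrow> 'a list \<Rightarrow> bool" where
  "squarefree_poly R f \<longleftrightarrow>
     (\<forall>q\<in>carrier (poly_ring R).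
        (q \<otimes>\<^bsub>poly_ring R\<^esub> q) divides\<^bsub>poly_ring R\<^esub> f \<longrightarrow> q \<in> Units (poly_ring R))"

definition squarefree_polys :: "nat \<Rightarrow> nat \<Rightarrow> int list set" where
  "squarefree_polys p n =
     {f \<in> carrier (poly_ring (Fp p)). Polynomials.degree f = n \<and> squarefree_poly (Fp p) f}"

definition P2 :: "nat \<Rightarrow> nat \<Rightarrow> real" where
  "P2 p g = measure_pmf.prob (pmf_of_set (squarefree_polys p (2 * g + 2)))
     {f. Factorial_Ring.prime (card (jacobian_rational_points p f))}"

end

theory Submission
  imports Defs
begin

text \<open>
  If \<open>f = f\<^sub>1 f\<^sub>2 f\<^sub>3 f\<^sub>4 f\<^sub>5\<close> with all \<open>f\<^sub>i\<close> nonconstant, let \<open>E\<^sub>i\<close> be the sum of the ramification points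
  over the roots of \<open>f\<^sub>i\<close>, so that \<open>2 E\<^sub>i\<close> is the divisor of zeros of \<open>f\<^sub>i(x)\<close>.  With
  \<open>m\<^sub>1 : m\<^sub>2 = deg f\<^sub>2 : deg f\<^sub>1\<close> in lowest terms, \<open>m\<^sub>1 E\<^sub>1 - m\<^sub>2 E\<^sub>2\<close> is a rational divisor of degree
  \<open>0\<close> and twice it is principal; likewise for \<open>f\<^sub>3, f\<^sub>4\<close>.  If half the divisor of a function of \<open>x\<close>
  is principal, then its coefficients at all ramification points have the same parity, since
  only \<open>h \<in> k(x)\<close> and \<open>h \<in> k(x) y\<close> have their square in \<open>k(x)\<close>; as \<open>f\<^sub>5\<close> is not involved, the two
  classes and \<open>0\<close> are therefore distinct.  Translation by the first class is an involution without
  fixed points, so the number of rational points, if finite, is even and at least \<open>3\<close>.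

  It remains to see that few squarefree \<open>f\<close> have fewer than five irreducible factors.  There are at
  most \<open>p\<^sup>d/d\<close> monic irreducible polynomials of degree \<open>d\<close>, and a polynomial of degree \<open>n\<close> with \<open>k\<close>
  irreducible factors has one of degree at least \<open>n/k\<close>.  Hence the proportion \<open>a\<^sub>k(n)\<close> of these
  polynomials satisfies \<open>a\<^sub>k(n) \<le> (k/n) (a\<^sub>k\<^sub>-\<^sub>1(0) + \<dots> + a\<^sub>k\<^sub>-\<^sub>1(n-1))\<close>, and tends to \<open>0\<close> uniformly in \<open>p\<close> by
  induction on \<open>k\<close>.
\<close>

text \<open>Points are by definition valuations of the function field, so every point that the
  argument needs has to be produced by extending a valuation of k(x). The ramification points alone
  would not do: the parity statement rests on the fact that a rational function of x without poles
  is constant, and this needs a point over every element of k and one at infinity. Over a root of f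
  the extension is the valuation of the norm. Elsewhere y^2 has a square root in the completion of
  k(x); no completion is formed, and approximate square roots in k(x) itself take its place. At
  infinity such approximations exist because f has even degree and its leading coefficient has a
  square root in k.

  The finiteness of the Jacobian never has to be proved, since an infinite set has cardinality 0,
  which is not prime. In the count, p > 2 guarantees that the square-free polynomials make up at
  least half of all polynomials of a given degree, so that a bound for all polynomials with few
  factors passes to them at the cost of a factor 2.\<close>

hide_const (open) Polynomial.degree Polynomial.lead_coeff Polynomial.coeff Polynomial.monom

section \<open>Valuations and quadratic extensions\<close>

locale field_pair = field K + subfield F K for K (structure) and F
begin

lemma F_carr: "a \<in> F \<Longrightarrow> a \<in> carrier K"
  using subset by auto

lemma F_closed [simp]: "\<zero> \<in> F" "\<one> \<in> F" "\<lbrakk>a \<in> F; b \<in> F\<rbrakk> \<Longrightarrow> a \<oplus> b \<in> F"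
  "\<lbrakk>a \<in> F; b \<in> F\<rbrakk> \<Longrightarrow> a \<otimes> b \<in> F" "a \<in> F \<Longrightarrow> \<ominus> a \<in> F" "\<lbrakk>a \<in> F; b \<in> F\<rbrakk> \<Longrightarrow> a \<ominus> b \<in> F"
  using subring_props[OF subfield_axioms] by (auto simp: a_minus_def)

lemma F_inv [simp]: "\<lbrakk>a \<in> F; a \<noteq> \<zero>\<rbrakk> \<Longrightarrow> inv a \<in> F"
  using subfield_m_inv[OF subfield_axioms] by auto

lemma inv_nz: "\<lbrakk>a \<in> F; a \<noteq> \<zero>\<rbrakk> \<Longrightarrow> inv a \<noteq> \<zero>"
  using subfield_m_inv[OF subfield_axioms] by auto

lemma mult_inv: assumes "a \<in> carrier K" "a \<noteq> \<zero>" shows "a \<otimes> inv a = \<one>" "inv a \<in> carrier K"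
  using assms field_Units by auto

end

text \<open>Taking F to be k(x) gives the valuations that are to be extended, taking F to be all of
  K gives the points of the curve. The value at \<open>\<zero>\<close> is unconstrained, and
  surjectivity is not asked for, so that values may be rescaled on extension.\<close>

locale subfield_valuation = field_pair K F for K (structure) and F +
  fixes w :: "'a \<Rightarrow> int"
  assumes w_mult: "\<lbrakk>a \<in> F; a \<noteq> \<zero>; b \<in> F; b \<noteq> \<zero>\<rbrakk> \<Longrightarrow> w (a \<otimes> b) = w a + w b"
    and w_add: "\<lbrakk>a \<in> F; a \<noteq> \<zero>; b \<in> F; b \<noteq> \<zero>; a \<oplus> b \<noteq> \<zero>\<rbrakk> \<Longrightarrow> min (w a) (w b) \<le> w (a \<oplus> b)"
begin

context notes F_carr [simp] begin

lemma w_one: "w \<one> = 0"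
  using w_mult[of \<one> \<one>] by simp

lemma w_minus_one: "w (\<ominus> \<one>) = 0"
proof -
  have "(\<ominus> \<one>) \<otimes> (\<ominus> \<one>) = \<one>" by algebra
  then show ?thesis using w_mult[of "\<ominus> \<one>" "\<ominus> \<one>"] w_one by simp
qed

lemma w_uminus: assumes "a \<in> F" "a \<noteq> \<zero>" shows "w (\<ominus> a) = w a"
proof -
  have "\<ominus> a = (\<ominus> \<one>) \<otimes> a" using assms by (simp add: l_minus)
  then show ?thesis using w_mult[of "\<ominus> \<one>" a] w_minus_one assms by simp
qed

lemma w_inv: assumes "a \<in> F" "a \<noteq> \<zero>" shows "w (inv a) = - w a"
proof -
  have "a \<otimes> inv a = \<one>" using assms field_Units by (intro Units_r_inv) auto
  then show ?thesis using w_mult[of a "inv a"] w_one assms inv_nz by simp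
qed

lemma w_pow: assumes "a \<in> F" "a \<noteq> \<zero>" shows "w (a [^] (n::nat)) = int n * w a \<and> a [^] n \<noteq> \<zero> \<and> a [^] n \<in> F"
proof (induction n)
  case 0 then show ?case using w_one by simp
next
  case (Suc n)
  then show ?case using assms w_mult[of "a [^] n" a] by (simp add: integral_iff algebra_simps)
qed

text \<open>Encodes the convention that \<open>\<zero>\<close> has infinite value, which spares the
  ultrametric estimates most case distinctions.\<close>

definition ge where "ge n a \<longleftrightarrow> a = \<zero> \<or> n \<le> w a"

lemma ge_zero [simp]: "ge n \<zero>" by (simp add: ge_def)

lemma ge_self [simp]: "ge (w a) a" by (simp add: ge_def)

lemma ge_mono: "ge n a \<Longrightarrow> m \<le> n \<Longrightarrow> ge m a" by (auto simp: ge_def)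

lemma ge_add: "\<lbrakk>ge n a; ge n b; a \<in> F; b \<in> F\<rbrakk> \<Longrightarrow> ge n (a \<oplus> b)"
  using w_add[of a b] by (cases "a = \<zero>"; cases "b = \<zero>") (fastforce simp: ge_def)+

lemma ge_uminus: "\<lbrakk>ge n a; a \<in> F\<rbrakk> \<Longrightarrow> ge n (\<ominus> a)"
  using w_uminus[of a] by (cases "a = \<zero>") (auto simp: ge_def)

lemma ge_minus: "\<lbrakk>ge n a; ge n b; a \<in> F; b \<in> F\<rbrakk> \<Longrightarrow> ge n (a \<ominus> b)"
  unfolding a_minus_def by (intro ge_add ge_uminus) auto

lemma ge_mult: "\<lbrakk>ge n a; ge m b; a \<in> F; b \<in> F\<rbrakk> \<Longrightarrow> ge (n + m) (a \<otimes> b)"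
  using w_mult[of a b] by (cases "a = \<zero>"; cases "b = \<zero>") (auto simp: ge_def)

text \<open>Since a = (a + b) - b, a value of a + b above w(a) would force a itself to have a value
  above w(a).\<close>

lemma w_dominated:
  assumes "a \<in> F" "b \<in> F" "a \<noteq> \<zero>" "ge n b" "w a < n"
  shows "a \<oplus> b \<noteq> \<zero>" "w (a \<oplus> b) = w a"
proof -
  have aeq: "a = (a \<oplus> b) \<ominus> b" using F_carr[OF assms(1)] F_carr[OF assms(2)] by algebra
  show nz: "a \<oplus> b \<noteq> \<zero>"
  proof
    assume "a \<oplus> b = \<zero>"
    then have "a = \<ominus> b" using aeq assms by (simp add: minus_eq)
    then have "ge n a" using ge_uminus[OF assms(4)] assms(2) by simp
    then show False using assms by (auto simp: ge_def)
  qed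
  have "ge (w a) (a \<oplus> b)" using assms by (intro ge_add) (auto intro: ge_mono)
  moreover have "\<not> w a < w (a \<oplus> b)"
  proof
    assume "w a < w (a \<oplus> b)"
    then have "ge (w a + 1) ((a \<oplus> b) \<ominus> b)" using assms
      by (intro ge_minus) (auto simp: ge_def)
    then show False using aeq assms by (auto simp: ge_def)
  qed
  ultimately show "w (a \<oplus> b) = w a" using nz by (auto simp: ge_def)
qed

lemma w_add_neq:
  assumes "a \<in> F" "b \<in> F" "a \<noteq> \<zero>" "b \<noteq> \<zero>" "w a \<noteq> w b"
  shows "a \<oplus> b \<noteq> \<zero>" "w (a \<oplus> b) = min (w a) (w b)"
proof -
  have "a \<oplus> b \<noteq> \<zero> \<and> w (a \<oplus> b) = min (w a) (w b)"
  proof (cases "w a < w b")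
    case True then show ?thesis using w_dominated[of a b "w b"] assms by auto
  next
    case False then show ?thesis using w_dominated[of b a "w a"] assms by (auto simp: a_comm)
  qed
  then show "a \<oplus> b \<noteq> \<zero>" "w (a \<oplus> b) = min (w a) (w b)" by auto
qed

end

end

section \<open>Quadratic extensions: coordinates, conjugation and norm\<close>

locale quadratic_extension = field_pair K F for K (structure) and F +
  fixes y
  assumes y_closed [simp]: "y \<in> carrier K"
    and y_sq [simp]: "y \<otimes> y \<in> F"
    and y_notin: "y \<notin> F"
    and spanned: "u \<in> carrier K \<Longrightarrow> \<exists>a\<in>F. \<exists>b\<in>F. u = a \<oplus> b \<otimes> y"
begin

declare F_carr [simp]

lemma y_nz: "y \<noteq> \<zero>" using y_notin by auto

lemma independent:
  assumes "a \<in> F" "b \<in> F" "a \<oplus> b \<otimes> y = \<zero>" shows "a = \<zero>" "b = \<zero>"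
proof -
  show b: "b = \<zero>"
  proof (rule ccontr)
    assume b: "b \<noteq> \<zero>"
    have "b \<otimes> y = \<ominus> a" using assms by (simp add: minus_equality sum_zero_eq_neg add.m_comm)
    then have "inv b \<otimes> (b \<otimes> y) = inv b \<otimes> (\<ominus> a)" by simp
    then have "y = inv b \<otimes> (\<ominus> a)" using assms b mult_inv[of b]
      by (metis F_carr l_one m_assoc m_comm y_closed)
    then show False using y_notin assms b by simp
  qed
  show "a = \<zero>" using assms b by simp
qed

lemma unique:
  assumes "a \<in> F" "b \<in> F" "c \<in> F" "d \<in> F" "a \<oplus> b \<otimes> y = c \<oplus> d \<otimes> y" shows "a = c" "b = d"
proof -
  have "(a \<ominus> c) \<oplus> (b \<ominus> d) \<otimes> y = (a \<oplus> b \<otimes> y) \<ominus> (c \<oplus> d \<otimes> y)"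
    using assms(1-4) F_carr y_closed by algebra
  also have "\<dots> = \<zero>" using assms by (simp add: minus_eq r_neg)
  finally have "a \<ominus> c = \<zero>" "b \<ominus> d = \<zero>" using independent[of "a \<ominus> c" "b \<ominus> d"] assms by auto
  then show "a = c" "b = d" using assms by (simp_all)
qed

definition re where "re u = (THE a. a \<in> F \<and> (\<exists>b\<in>F. u = a \<oplus> b \<otimes> y))"
definition im where "im u = (THE b. b \<in> F \<and> (\<exists>a\<in>F. u = a \<oplus> b \<otimes> y))"

lemma re_im_eq: assumes "a \<in> F" "b \<in> F" shows "re (a \<oplus> b \<otimes> y) = a" "im (a \<oplus> b \<otimes> y) = b"
  unfolding re_def im_def by (rule the_equality; use assms unique in metis)+

lemma re_im: assumes "u \<in> carrier K"
  shows re_F [simp]: "re u \<in> F" and im_F [simp]: "im u \<in> F" and decomp: "re u \<oplus> im u \<otimes> y = u"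
proof -
  obtain a b where "a \<in> F" "b \<in> F" "u = a \<oplus> b \<otimes> y" using spanned[OF assms] by blast
  then show "re u \<in> F" "im u \<in> F" "re u \<oplus> im u \<otimes> y = u" using re_im_eq by auto
qed

lemma re_im_F: assumes "a \<in> F" shows "re a = a" "im a = \<zero>"
  using re_im_eq[of a \<zero>] assms by auto

lemma re_im_add: assumes "u \<in> carrier K" "v \<in> carrier K"
  shows "re (u \<oplus> v) = re u \<oplus> re v" "im (u \<oplus> v) = im u \<oplus> im v"
proof -
  note F_carr[OF re_F[OF assms(1)]] F_carr[OF re_F[OF assms(2)]]
    F_carr[OF im_F[OF assms(1)]] F_carr[OF im_F[OF assms(2)]]
  then have "(re u \<oplus> im u \<otimes> y) \<oplus> (re v \<oplus> im v \<otimes> y) = (re u \<oplus> re v) \<oplus> (im u \<oplus> im v) \<otimes> y"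
    using y_closed by algebra
  then have "u \<oplus> v = (re u \<oplus> re v) \<oplus> (im u \<oplus> im v) \<otimes> y" using assms decomp by simp
  then show "re (u \<oplus> v) = re u \<oplus> re v" "im (u \<oplus> v) = im u \<oplus> im v"
    using re_im_eq[of "re u \<oplus> re v" "im u \<oplus> im v"] assms by auto
qed

lemma re_im_mult: assumes "u \<in> carrier K" "v \<in> carrier K"
  shows "re (u \<otimes> v) = re u \<otimes> re v \<oplus> (im u \<otimes> im v) \<otimes> (y \<otimes> y)" "im (u \<otimes> v) = re u \<otimes> im v \<oplus> im u \<otimes> re v"
proof -
  note F_carr[OF re_F[OF assms(1)]] F_carr[OF re_F[OF assms(2)]]
    F_carr[OF im_F[OF assms(1)]] F_carr[OF im_F[OF assms(2)]]
  then have "(re u \<oplus> im u \<otimes> y) \<otimes> (re v \<oplus> im v \<otimes> y) = (re u \<otimes> re v \<oplus> (im u \<otimes> im v) \<otimes> (y \<otimes> y))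
     \<oplus> (re u \<otimes> im v \<oplus> im u \<otimes> re v) \<otimes> y"
    using y_closed by algebra
  then have "u \<otimes> v = (re u \<otimes> re v \<oplus> (im u \<otimes> im v) \<otimes> (y \<otimes> y))
     \<oplus> (re u \<otimes> im v \<oplus> im u \<otimes> re v) \<otimes> y" using assms decomp by simp
  then show "re (u \<otimes> v) = re u \<otimes> re v \<oplus> (im u \<otimes> im v) \<otimes> (y \<otimes> y)" "im (u \<otimes> v) = re u \<otimes> im v \<oplus> im u \<otimes> re v"
    using re_im_eq[of "re u \<otimes> re v \<oplus> (im u \<otimes> im v) \<otimes> (y \<otimes> y)" "re u \<otimes> im v \<oplus> im u \<otimes> re v"] assms by auto
qed

text \<open>On the function field of the curve this is the hyperelliptic involution, which sends y
  to -y.\<close>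

definition conj where "conj u = re u \<ominus> im u \<otimes> y"

lemma conj_closed [simp]: "u \<in> carrier K \<Longrightarrow> conj u \<in> carrier K"
  by (simp add: conj_def)

lemma re_im_conj: assumes "u \<in> carrier K" shows "re (conj u) = re u" "im (conj u) = \<ominus> im u"
proof -
  have "conj u = re u \<oplus> (\<ominus> im u) \<otimes> y" using assms by (simp add: conj_def a_minus_def l_minus)
  then show "re (conj u) = re u" "im (conj u) = \<ominus> im u"
    using re_im_eq[of "re u" "\<ominus> im u"] assms by auto
qed

lemma conj_conj: assumes "u \<in> carrier K" shows "conj (conj u) = u"
proof -
  have "re u \<ominus> (\<ominus> im u) \<otimes> y = re u \<oplus> im u \<otimes> y"
    using F_carr[OF re_F[OF assms]] F_carr[OF im_F[OF assms]] y_closed by algebra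
  then show ?thesis using re_im_conj[OF assms] decomp[OF assms] by (simp add: conj_def)
qed

lemma conj_F: "a \<in> F \<Longrightarrow> conj a = a"
  by (simp add: conj_def re_im_F a_minus_def)

lemma conj_add: assumes "u \<in> carrier K" "v \<in> carrier K" shows "conj (u \<oplus> v) = conj u \<oplus> conj v"
proof -
  note F_carr[OF re_F[OF assms(1)]] F_carr[OF re_F[OF assms(2)]]
    F_carr[OF im_F[OF assms(1)]] F_carr[OF im_F[OF assms(2)]] y_closed
  then show ?thesis unfolding conj_def re_im_add[OF assms] by algebra
qed

lemma conj_mult: assumes "u \<in> carrier K" "v \<in> carrier K" shows "conj (u \<otimes> v) = conj u \<otimes> conj v"
proof -
  note F_carr[OF re_F[OF assms(1)]] F_carr[OF re_F[OF assms(2)]]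
    F_carr[OF im_F[OF assms(1)]] F_carr[OF im_F[OF assms(2)]] y_closed
  then show ?thesis unfolding conj_def re_im_mult[OF assms] by algebra
qed

lemma conj_nz: assumes "u \<in> carrier K" "u \<noteq> \<zero>" shows "conj u \<noteq> \<zero>"
  using conj_conj[OF assms(1)] conj_F[of \<zero>] assms by auto

lemma u_minus_conj: assumes "u \<in> carrier K" shows "u \<ominus> conj u = (im u \<oplus> im u) \<otimes> y"
proof -
  have "(re u \<oplus> im u \<otimes> y) \<ominus> (re u \<ominus> im u \<otimes> y) = (im u \<oplus> im u) \<otimes> y"
    using F_carr[OF re_F[OF assms]] F_carr[OF im_F[OF assms]] y_closed by algebra
  then show ?thesis using decomp[OF assms] by (simp add: conj_def)
qed

definition norm where "norm u = re u \<otimes> re u \<ominus> (im u \<otimes> im u) \<otimes> (y \<otimes> y)"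

lemma norm_F [simp]: "u \<in> carrier K \<Longrightarrow> norm u \<in> F"
  by (simp add: norm_def)

lemma norm_conj: assumes "u \<in> carrier K" shows "norm u = u \<otimes> conj u"
proof -
  have "(re u \<oplus> im u \<otimes> y) \<otimes> (re u \<ominus> im u \<otimes> y) = re u \<otimes> re u \<ominus> (im u \<otimes> im u) \<otimes> (y \<otimes> y)"
    using F_carr[OF re_F[OF assms]] F_carr[OF im_F[OF assms]] y_closed by algebra
  then show ?thesis using decomp[OF assms] by (simp add: conj_def norm_def)
qed

lemma norm_nz: assumes "u \<in> carrier K" "u \<noteq> \<zero>" shows "norm u \<noteq> \<zero>"
  using assms conj_nz integral_iff by (simp add: norm_conj)

lemma norm_mult: assumes "u \<in> carrier K" "v \<in> carrier K" shows "norm (u \<otimes> v) = norm u \<otimes> norm v"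
  using assms conj_closed[OF assms(1)] conj_closed[OF assms(2)]
  by (simp add: norm_conj conj_mult m_ac)

end

section \<open>Extending a valuation to a quadratic extension\<close>

locale valued_quadratic_extension = quadratic_extension K F y + subfield_valuation K F w
  for K (structure) and F and y and w
begin

lemma valuation_on_carrier:
  assumes "\<And>a b. \<lbrakk>a \<in> carrier K; a \<noteq> \<zero>; b \<in> carrier K; b \<noteq> \<zero>\<rbrakk> \<Longrightarrow> v (a \<otimes> b) = v a + v b"
    and "\<And>a b. \<lbrakk>a \<in> carrier K; a \<noteq> \<zero>; b \<in> carrier K; b \<noteq> \<zero>; a \<oplus> b \<noteq> \<zero>\<rbrakk> \<Longrightarrow> min (v a) (v b) \<le> v (a \<oplus> b)"
  shows "subfield_valuation K (carrier K) v"
  by (intro subfield_valuation.intro field_pair.intro subfield_valuation_axioms.intro field_axioms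
      carrier_is_subfield assms)

text \<open>The norm is a^2 - b^2 y^2, and its two terms have values of opposite parity, so they
  cannot cancel. The condition therefore falls apart into one on each coordinate, and these are
  stable under addition.\<close>

lemma norm_valuation_le_iff:
  assumes odd: "odd (w (y \<otimes> y))" and u: "u \<in> carrier K" "u \<noteq> \<zero>"
  shows "n \<le> w (norm u) \<longleftrightarrow> (re u = \<zero> \<or> n \<le> 2 * w (re u)) \<and> (im u = \<zero> \<or> n \<le> 2 * w (im u) + w (y \<otimes> y))"
proof -
  let ?a = "re u" and ?b = "im u" and ?f = "y \<otimes> y"
  have F: "?a \<in> F" "?b \<in> F" "?f \<in> F" using u by auto
  have fnz: "?f \<noteq> \<zero>" using y_nz integral_iff by simp
  have waa: "?a \<noteq> \<zero> \<Longrightarrow> ?a \<otimes> ?a \<noteq> \<zero> \<and> w (?a \<otimes> ?a) = 2 * w ?a"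
    using w_mult[of ?a ?a] F integral_iff by simp
  have wbb: "w (\<ominus> ((?b \<otimes> ?b) \<otimes> ?f)) = 2 * w ?b + w ?f \<and> \<ominus> ((?b \<otimes> ?b) \<otimes> ?f) \<noteq> \<zero>" if "?b \<noteq> \<zero>"
  proof -
    have "(?b \<otimes> ?b) \<noteq> \<zero>" "(?b \<otimes> ?b) \<otimes> ?f \<noteq> \<zero>" using F integral_iff that fnz by auto
    then show ?thesis
    using w_mult[of ?b ?b] w_mult[of "?b \<otimes> ?b" ?f] F that fnz w_uminus[of "(?b \<otimes> ?b) \<otimes> ?f"] by auto
  qed
  consider "?a = \<zero>" "?b \<noteq> \<zero>" | "?b = \<zero>" "?a \<noteq> \<zero>" | "?a \<noteq> \<zero>" "?b \<noteq> \<zero>"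
    using decomp[OF u(1)] u(2) by fastforce
  then show ?thesis
  proof cases
    case 1
    then show ?thesis using wbb F by (simp add: norm_def a_minus_def)
  next
    case 2
    then show ?thesis using waa F by (simp add: norm_def a_minus_def)
  next
    case 3
    have "w (?a \<otimes> ?a) \<noteq> w (\<ominus> ((?b \<otimes> ?b) \<otimes> ?f))"
      using waa wbb 3 odd by presburger
    then have "w (norm u) = min (2 * w ?a) (2 * w ?b + w ?f)"
      using w_add_neq(2)[of "?a \<otimes> ?a" "\<ominus> ((?b \<otimes> ?b) \<otimes> ?f)"] waa wbb 3 F
      by (simp add: norm_def a_minus_def)
    then show ?thesis using 3 by auto
  qed
qed

text \<open>The extension is the valuation of the norm. The ultrametric inequality is checked on the
  coordinates by the preceding criterion. The factor 2 comes from N(a) = a^2 for a in F, and the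
  value of y from N(y) = -y^2.\<close>

lemma ramified_extension:
  assumes odd: "odd (w (y \<otimes> y))"
  shows "\<exists>v. subfield_valuation K (carrier K) v \<and> (\<forall>a\<in>F - {\<zero>}. v a = 2 * w a) \<and> v y = w (y \<otimes> y)"
proof (intro exI conjI ballI)
  show "subfield_valuation K (carrier K) (\<lambda>u. w (norm u))"
  proof (rule valuation_on_carrier)
    fix a b assume ab: "a \<in> carrier K" "a \<noteq> \<zero>" "b \<in> carrier K" "b \<noteq> \<zero>"
    then show "w (norm (a \<otimes> b)) = w (norm a) + w (norm b)"
      by (simp add: norm_mult w_mult norm_nz)
    assume nz: "a \<oplus> b \<noteq> \<zero>"
    let ?n = "min (w (norm a)) (w (norm b))"
    have "?n \<le> w (norm a)" "?n \<le> w (norm b)" by auto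
    then have a: "re a = \<zero> \<or> ?n \<le> 2 * w (re a)" "im a = \<zero> \<or> ?n \<le> 2 * w (im a) + w (y \<otimes> y)"
      and b: "re b = \<zero> \<or> ?n \<le> 2 * w (re b)" "im b = \<zero> \<or> ?n \<le> 2 * w (im b) + w (y \<otimes> y)"
      using norm_valuation_le_iff[OF odd ab(1,2)] norm_valuation_le_iff[OF odd ab(3,4)] by metis+
    have "re (a \<oplus> b) = \<zero> \<or> ?n \<le> 2 * w (re (a \<oplus> b))"
      using a(1) b(1) w_add[of "re a" "re b"] ab re_im_add
      by (cases "re a = \<zero>"; cases "re b = \<zero>"; cases "re a \<oplus> re b = \<zero>") auto
    moreover have "im (a \<oplus> b) = \<zero> \<or> ?n \<le> 2 * w (im (a \<oplus> b)) + w (y \<otimes> y)"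
      using a(2) b(2) w_add[of "im a" "im b"] ab re_im_add
      by (cases "im a = \<zero>"; cases "im b = \<zero>"; cases "im a \<oplus> im b = \<zero>") auto
    ultimately show "?n \<le> w (norm (a \<oplus> b))"
      using norm_valuation_le_iff[OF odd _ nz] ab by simp
  qed
next
  fix a assume "a \<in> F - {\<zero>}"
  then show "w (norm a) = 2 * w a" by (simp add: norm_def re_im_F w_mult a_minus_def)
next
  have "re y = \<zero>" "im y = \<one>" using re_im_eq[of \<zero> \<one>] by auto
  then have "norm y = \<ominus> (y \<otimes> y)" by (simp add: norm_def a_minus_def)
  then show "w (norm y) = w (y \<otimes> y)" using w_uminus[of "y \<otimes> y"] y_nz integral_iff by simp
qed

text \<open>The split case: \<open>y\<^sup>2\<close> is a square in the completion of \<open>F\<close>, and the valuation of \<open>a + b y\<close>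
  is that of \<open>a + b s\<close> for every \<open>s \<in> F\<close> close enough to the root; closeness to \<open>s\<^sub>0\<close> singles out
  one of the two roots.\<close>

context
  fixes s0
  assumes s0: "s0 \<in> F" "s0 \<noteq> \<zero>" "ge (2 * w s0 + 1) (s0 \<otimes> s0 \<ominus> y \<otimes> y)"
    and two: "\<one> \<oplus> \<one> \<noteq> \<zero>" "w (\<one> \<oplus> \<one>) = 0"
begin

text \<open>Closeness to \<open>s0\<close> selects one of the two square roots: the other one lies
  near -\<open>s0\<close>, and the two differ by about 2 \<open>s0\<close>, whose value is only
  w(s0) because 2 has value 0. The number N measures how nearly s squares to y^2.\<close>

definition approx where
  "approx N s \<longleftrightarrow> s \<in> F \<and> ge (w s0 + 1) (s \<ominus> s0) \<and> ge N (s \<otimes> s \<ominus> y \<otimes> y)"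

lemma approx_mono: "approx N s \<Longrightarrow> M \<le> N \<Longrightarrow> approx M s"
  unfolding approx_def by (auto intro: ge_mono)

lemma approxD: assumes "approx N s" shows "s \<in> F" "s \<noteq> \<zero>" "w s = w s0"
proof -
  show s: "s \<in> F" using assms by (simp add: approx_def)
  have "s = s0 \<oplus> (s \<ominus> s0)" using F_carr[OF s] F_carr[OF s0(1)] by algebra
  then show "s \<noteq> \<zero>" "w s = w s0"
    using w_dominated[of s0 "s \<ominus> s0" "w s0 + 1"] s s0 assms by (auto simp: approx_def)
qed

text \<open>The product (s - t)(s + t) is a difference of two errors, while s + t is close to 2
  \<open>s0\<close> and so has exactly the value of \<open>s0\<close>.\<close>

lemma approx_close: assumes "approx N s" "approx N t" shows "ge (N - w s0) (s \<ominus> t)"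
proof (cases "s \<ominus> t = \<zero>")
  case False
  note sF = approxD(1)[OF assms(1)] and tF = approxD(1)[OF assms(2)]
  note c = F_carr[OF sF] F_carr[OF tF] F_carr[OF s0(1)] F_carr[OF y_sq] y_closed
  have 1: "s \<oplus> t = (\<one> \<oplus> \<one>) \<otimes> s0 \<oplus> ((s \<ominus> s0) \<oplus> (t \<ominus> s0))" using c by algebra
  have nz: "(\<one> \<oplus> \<one>) \<otimes> s0 \<noteq> \<zero>" and w2: "w ((\<one> \<oplus> \<one>) \<otimes> s0) = w s0"
    using two s0 integral_iff w_mult[of "\<one> \<oplus> \<one>" s0] by auto
  have "ge (w s0 + 1) ((s \<ominus> s0) \<oplus> (t \<ominus> s0))"
    using assms sF tF s0 by (intro ge_add) (auto simp: approx_def)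
  then have st: "s \<oplus> t \<noteq> \<zero>" "w (s \<oplus> t) = w s0"
    using w_dominated[of "(\<one> \<oplus> \<one>) \<otimes> s0" "(s \<ominus> s0) \<oplus> (t \<ominus> s0)" "w s0 + 1"] 1 nz w2 sF tF s0 by auto
  have "(s \<ominus> t) \<otimes> (s \<oplus> t) = (s \<otimes> s \<ominus> y \<otimes> y) \<ominus> (t \<otimes> t \<ominus> y \<otimes> y)" using c by algebra
  moreover have "ge N \<dots>"
    using assms sF tF by (intro ge_minus[of N "s \<otimes> s \<ominus> y \<otimes> y"]) (simp_all add: approx_def)
  ultimately have "ge N ((s \<ominus> t) \<otimes> (s \<oplus> t))" by simp
  moreover have "(s \<ominus> t) \<otimes> (s \<oplus> t) \<noteq> \<zero>" using False st c by (simp add: integral_iff)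
  ultimately show ?thesis using w_mult[of "s \<ominus> t" "s \<oplus> t"] False st sF tF by (auto simp: ge_def)
qed simp

text \<open>A Newton step for the equation s^2 = y^2. The correction h cancels the error up to h^2,
  whose value exceeds the old precision by at least one, and h is small enough for the new
  approximation to stay near \<open>s0\<close>.\<close>

lemma approx_step:
  assumes "approx (2 * w s0 + 1 + int k) s"
  shows "\<exists>t. approx (2 * w s0 + 1 + int (Suc k)) t"
proof -
  note sF = approxD(1)[OF assms]
  let ?d = "(\<one> \<oplus> \<one>) \<otimes> s"
  have d: "?d \<in> F" "?d \<noteq> \<zero>" "w ?d = w s0"
    using two approxD[OF assms] integral_iff w_mult[of "\<one> \<oplus> \<one>" s] by auto
  define h where "h = (y \<otimes> y \<ominus> s \<otimes> s) \<otimes> inv ?d"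
  have hF: "h \<in> F" using d sF by (simp add: h_def)
  note c = F_carr[OF sF] F_carr[OF hF] F_carr[OF s0(1)] F_carr[OF y_sq] y_closed
  have ge: "ge (2 * w s0 + 1 + int k) (y \<otimes> y \<ominus> s \<otimes> s)"
  proof -
    have "y \<otimes> y \<ominus> s \<otimes> s = \<ominus> (s \<otimes> s \<ominus> y \<otimes> y)" using c by algebra
    then show ?thesis using ge_uminus[of _ "s \<otimes> s \<ominus> y \<otimes> y"] assms sF by (simp add: approx_def)
  qed
  have "ge (2 * w s0 + 1 + int k + (- w s0)) h"
    unfolding h_def using ge d w_inv[of ?d] sF by (intro ge_mult) (auto simp: ge_def)
  then have geh: "ge (w s0 + 1 + int k) h" by (rule ge_mono) simp
  have "h \<otimes> ?d = (y \<otimes> y \<ominus> s \<otimes> s) \<otimes> (?d \<otimes> inv ?d)"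
    unfolding h_def using d sF inv_nz[of ?d] by (simp add: m_ac)
  then have hd: "h \<otimes> ?d = y \<otimes> y \<ominus> s \<otimes> s" using mult_inv[of ?d] d sF by simp
  let ?t = "s \<oplus> h"
  have "?t \<otimes> ?t \<ominus> y \<otimes> y = (s \<otimes> s \<ominus> y \<otimes> y) \<oplus> (h \<otimes> ?d \<oplus> h \<otimes> h)" using c by algebra
  also have "\<dots> = h \<otimes> h" unfolding hd using c by algebra
  finally have "?t \<otimes> ?t \<ominus> y \<otimes> y = h \<otimes> h" .
  moreover have "ge ((w s0 + 1 + int k) + (w s0 + 1 + int k)) (h \<otimes> h)"
    using geh hF by (intro ge_mult)
  ultimately have "ge (2 * w s0 + 1 + int (Suc k)) (?t \<otimes> ?t \<ominus> y \<otimes> y)" by (auto intro: ge_mono)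
  moreover have "ge (w s0 + 1) (?t \<ominus> s0)"
  proof -
    have eq: "?t \<ominus> s0 = (s \<ominus> s0) \<oplus> h" using c by algebra
    have "ge (w s0 + 1) ((s \<ominus> s0) \<oplus> h)" using assms ge_mono[OF geh, of "w s0 + 1"] hF sF s0
      by (intro ge_add[of _ "s \<ominus> s0" h]) (simp_all add: approx_def)
    then show ?thesis by (simp only: eq)
  qed
  ultimately have "approx (2 * w s0 + 1 + int (Suc k)) ?t"
    unfolding approx_def using F_closed(3)[OF sF hF] by blast
  then show ?thesis by blast
qed

lemma approx_exists: "\<exists>s. approx N s"
proof -
  have *: "\<exists>s. approx (2 * w s0 + 1 + int k) s" for k
  proof (induction k)
    case 0
    have "ge n (s0 \<ominus> s0)" for n using s0 by (auto simp: ge_def)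
    then have "approx (2 * w s0 + 1 + int 0) s0" using s0 by (simp add: approx_def)
    then show ?case by blast
  next
    case (Suc k) then show ?case using approx_step by blast
  qed
  have "N \<le> 2 * w s0 + 1 + int (nat (N - 2 * w s0 - 1))" by simp
  then show ?thesis using *[of "nat (N - 2 * w s0 - 1)"] approx_mono by blast
qed

text \<open>Says that P holds for all sufficiently good approximations, and so stands for a
  statement about the square root in the completion.\<close>

definition close_root where "close_root P \<longleftrightarrow> (\<exists>N. \<forall>s. approx N s \<longrightarrow> P s)"

lemma close_root_mono: "\<lbrakk>close_root P; \<And>s. P s \<Longrightarrow> Q s\<rbrakk> \<Longrightarrow> close_root Q"
  unfolding close_root_def by blast

lemma close_root_conj: assumes "close_root P" "close_root Q" shows "close_root (\<lambda>s. P s \<and> Q s)"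
proof -
  obtain N M where "\<And>s. approx N s \<Longrightarrow> P s" "\<And>s. approx M s \<Longrightarrow> Q s"
    using assms unfolding close_root_def by blast
  then have "\<forall>s. approx (max N M) s \<longrightarrow> P s \<and> Q s" by (meson approx_mono max.cobounded1 max.cobounded2)
  then show ?thesis unfolding close_root_def by blast
qed

lemma close_root_ex: "close_root P \<Longrightarrow> \<exists>s\<in>F. P s"
  unfolding close_root_def using approx_exists approxD by meson

lemma close_root_F: "close_root (\<lambda>s. s \<in> F)"
  unfolding close_root_def using approxD by blast

lemma close_root_small: assumes "b \<in> F" shows "close_root (\<lambda>s. ge n (b \<otimes> (s \<otimes> s \<ominus> y \<otimes> y)))"
  unfolding close_root_def
proof (intro exI allI impI)
  fix s assume s: "approx (n - w b) s"
  then have "ge (w b + (n - w b)) (b \<otimes> (s \<otimes> s \<ominus> y \<otimes> y))" using assms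
    by (intro ge_mult) (auto simp: approx_def)
  then show "ge n (b \<otimes> (s \<otimes> s \<ominus> y \<otimes> y))" by simp
qed

definition at_root where "at_root u l \<longleftrightarrow> close_root (\<lambda>s. re u \<oplus> im u \<otimes> s \<noteq> \<zero> \<and> w (re u \<oplus> im u \<otimes> s) = l)"

lemma at_root_unique: "at_root u l \<Longrightarrow> at_root u m \<Longrightarrow> l = m"
  unfolding at_root_def using close_root_ex[OF close_root_conj] by blast

text \<open>With a = \<open>re u\<close> and b = \<open>im u\<close>, the product (a + b s)(a - b s)
  differs from the norm of u by b^2 times the error of s, up to sign, so for good s it has the value
  of the norm. The second factor is bounded below, hence the first is bounded above, and changes of
  s beyond that bound do not affect its value.\<close>

lemma at_root_exists:
  assumes u: "u \<in> carrier K" "u \<noteq> \<zero>"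
  shows "\<exists>l. at_root u l"
proof (cases "im u = \<zero>")
  case True
  then have "re u \<noteq> \<zero>" using decomp[OF u(1)] u by auto
  then have "close_root (\<lambda>s. re u \<oplus> im u \<otimes> s \<noteq> \<zero> \<and> w (re u \<oplus> im u \<otimes> s) = w (re u))"
    using True u by (intro close_root_mono[OF close_root_F]) simp
  then show ?thesis unfolding at_root_def by blast
next
  case False
  let ?a = "re u" and ?b = "im u"
  have F: "?a \<in> F" "?b \<in> F" using u by auto
  \<comment> \<open>A lower bound for the values of a and of b s. For a = 0 the entry for a repeats
    the other one, because w is arbitrary at zero.\<close>
  define m where "m = min (if ?a = \<zero> then w ?b + w s0 else w ?a) (w ?b + w s0)"
  define M where "M = w (norm u) - m"
  \<comment> \<open>The first entry puts the error term above the value of the norm; the second puts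
    b(s - t) above M for any two approximations s and t of this quality.\<close>
  define N where "N = max (w (norm u) + 1 - 2 * w ?b) (M - w ?b + w s0 + 1)"
  have bound: "?a \<oplus> ?b \<otimes> s \<noteq> \<zero> \<and> w (?a \<oplus> ?b \<otimes> s) \<le> M" if s: "approx N s" for s
  proof -
    note sF = approxD[OF s]
    note c = F_carr[OF F(1)] F_carr[OF F(2)] F_carr[OF sF(1)] F_carr[OF y_sq] y_closed
    have "(?a \<oplus> ?b \<otimes> s) \<otimes> (?a \<ominus> ?b \<otimes> s) = norm u \<oplus> (\<ominus> (?b \<otimes> ?b)) \<otimes> (s \<otimes> s \<ominus> y \<otimes> y)"
      unfolding norm_def using c by algebra
    moreover have "ge (2 * w ?b + N) ((\<ominus> (?b \<otimes> ?b)) \<otimes> (s \<otimes> s \<ominus> y \<otimes> y))"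
      using s F False w_mult[of ?b ?b] w_uminus[of "?b \<otimes> ?b"] integral_iff
      by (intro ge_mult) (auto simp: approx_def ge_def)
    ultimately have *: "(?a \<oplus> ?b \<otimes> s) \<otimes> (?a \<ominus> ?b \<otimes> s) \<noteq> \<zero>"
      "w ((?a \<oplus> ?b \<otimes> s) \<otimes> (?a \<ominus> ?b \<otimes> s)) = w (norm u)"
      using w_dominated[of "norm u" "(\<ominus> (?b \<otimes> ?b)) \<otimes> (s \<otimes> s \<ominus> y \<otimes> y)" "2 * w ?b + N"] F sF u norm_nz[OF u]
      by (auto simp: N_def)
    then have nz: "?a \<oplus> ?b \<otimes> s \<noteq> \<zero>" "?a \<ominus> ?b \<otimes> s \<noteq> \<zero>"
      using c by (auto simp: integral_iff simp del: r_right_minus_eq)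
    have "ge m (?a \<ominus> ?b \<otimes> s)"
    proof (intro ge_minus)
      show "ge m ?a" by (auto simp: ge_def m_def)
      show "ge m (?b \<otimes> s)" using w_mult[of ?b s] F sF False by (auto simp: ge_def m_def)
    qed (use F sF in auto)
    then have "m \<le> w (?a \<ominus> ?b \<otimes> s)" using nz by (simp add: ge_def)
    then show ?thesis using * w_mult[of "?a \<oplus> ?b \<otimes> s" "?a \<ominus> ?b \<otimes> s"] nz F sF by (auto simp: M_def)
  qed
  obtain t where t: "approx N t" using approx_exists by blast
  have "w (?a \<oplus> ?b \<otimes> s) = w (?a \<oplus> ?b \<otimes> t)" if s: "approx N s" for s
  proof -
    note sF = approxD[OF s] and tF = approxD[OF t]
    note c = F_carr[OF F(1)] F_carr[OF F(2)] F_carr[OF sF(1)] F_carr[OF tF(1)]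
    have "?a \<oplus> ?b \<otimes> s = (?a \<oplus> ?b \<otimes> t) \<oplus> ?b \<otimes> (s \<ominus> t)" using c by algebra
    moreover have "ge (w ?b + (N - w s0)) (?b \<otimes> (s \<ominus> t))"
      using approx_close[OF s t] F sF tF by (intro ge_mult) auto
    ultimately show ?thesis
      using w_dominated(2)[of "?a \<oplus> ?b \<otimes> t" "?b \<otimes> (s \<ominus> t)" "w ?b + (N - w s0)"] bound[OF t] F sF tF
      by (auto simp: N_def)
  qed
  then show ?thesis unfolding at_root_def close_root_def using bound by blast
qed

text \<open>Substituting s for y is not multiplicative: up to sign, the product acquires the error
  \<open>im u\<close> \<open>im v\<close> (s^2 - y^2). For good s its value lies above l + m, and
  the error is dominated.\<close>

lemma at_root_mult:
  assumes "u \<in> carrier K" "v \<in> carrier K" "at_root u l" "at_root v m"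
  shows "at_root (u \<otimes> v) (l + m)"
proof -
  let ?b = "im u \<otimes> im v"
  have F: "re u \<in> F" "re v \<in> F" "im u \<in> F" "im v \<in> F" using assms by auto
  have "close_root (\<lambda>s. s \<in> F \<and> ge (l + m + 1) (\<ominus> ?b \<otimes> (s \<otimes> s \<ominus> y \<otimes> y)) \<and>
     (re u \<oplus> im u \<otimes> s \<noteq> \<zero> \<and> w (re u \<oplus> im u \<otimes> s) = l) \<and>
     (re v \<oplus> im v \<otimes> s \<noteq> \<zero> \<and> w (re v \<oplus> im v \<otimes> s) = m))"
    using assms(3,4) F unfolding at_root_def
    by (rule_tac close_root_conj[OF close_root_F close_root_conj[OF close_root_small close_root_conj]]) auto
  then show ?thesis unfolding at_root_def
  proof (rule close_root_mono, elim conjE)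
    fix s assume s: "s \<in> F" "ge (l + m + 1) (\<ominus> ?b \<otimes> (s \<otimes> s \<ominus> y \<otimes> y))"
      and u: "re u \<oplus> im u \<otimes> s \<noteq> \<zero>" "w (re u \<oplus> im u \<otimes> s) = l"
      and v: "re v \<oplus> im v \<otimes> s \<noteq> \<zero>" "w (re v \<oplus> im v \<otimes> s) = m"
    note c = F_carr[OF F(1)] F_carr[OF F(2)] F_carr[OF F(3)] F_carr[OF F(4)] F_carr[OF s(1)] y_closed
    have "re (u \<otimes> v) \<oplus> im (u \<otimes> v) \<otimes> s = (re u \<oplus> im u \<otimes> s) \<otimes> (re v \<oplus> im v \<otimes> s) \<oplus> (\<ominus> ?b \<otimes> (s \<otimes> s \<ominus> y \<otimes> y))"
      unfolding re_im_mult[OF assms(1,2)] using c by algebra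
    moreover have "(re u \<oplus> im u \<otimes> s) \<otimes> (re v \<oplus> im v \<otimes> s) \<noteq> \<zero>"
      "w ((re u \<oplus> im u \<otimes> s) \<otimes> (re v \<oplus> im v \<otimes> s)) = l + m"
      using u v F s w_mult[of "re u \<oplus> im u \<otimes> s" "re v \<oplus> im v \<otimes> s"] by (auto simp: integral_iff)
    ultimately show "re (u \<otimes> v) \<oplus> im (u \<otimes> v) \<otimes> s \<noteq> \<zero> \<and> w (re (u \<otimes> v) \<oplus> im (u \<otimes> v) \<otimes> s) = l + m"
      using w_dominated[of "(re u \<oplus> im u \<otimes> s) \<otimes> (re v \<oplus> im v \<otimes> s)" "\<ominus> ?b \<otimes> (s \<otimes> s \<ominus> y \<otimes> y)" "l + m + 1"] s F
      by auto
  qed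
qed

text \<open>Substituting s for y is additive, so a single s that is good for u, v and u + v at once
  reduces the claim to the ultrametric inequality of w.\<close>

lemma at_root_add:
  assumes "u \<in> carrier K" "v \<in> carrier K" "at_root u l" "at_root v m" "at_root (u \<oplus> v) n"
  shows "min l m \<le> n"
proof -
  have F: "re u \<in> F" "re v \<in> F" "im u \<in> F" "im v \<in> F" using assms by auto
  obtain s where s: "s \<in> F"
     "re u \<oplus> im u \<otimes> s \<noteq> \<zero>" "w (re u \<oplus> im u \<otimes> s) = l"
     "re v \<oplus> im v \<otimes> s \<noteq> \<zero>" "w (re v \<oplus> im v \<otimes> s) = m"
     "re (u \<oplus> v) \<oplus> im (u \<oplus> v) \<otimes> s \<noteq> \<zero>" "w (re (u \<oplus> v) \<oplus> im (u \<oplus> v) \<otimes> s) = n"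
    using close_root_ex[OF close_root_conj[OF assms(3)[unfolded at_root_def]
      close_root_conj[OF assms(4)[unfolded at_root_def] assms(5)[unfolded at_root_def]]]] by blast
  note c = F_carr[OF F(1)] F_carr[OF F(2)] F_carr[OF F(3)] F_carr[OF F(4)] F_carr[OF s(1)]
  have "re (u \<oplus> v) \<oplus> im (u \<oplus> v) \<otimes> s = (re u \<oplus> im u \<otimes> s) \<oplus> (re v \<oplus> im v \<otimes> s)"
    unfolding re_im_add[OF assms(1,2)] using c by algebra
  then show ?thesis using w_add[of "re u \<oplus> im u \<otimes> s" "re v \<oplus> im v \<otimes> s"] s F by auto
qed

lemma split_extension:
  "\<exists>v. subfield_valuation K (carrier K) v \<and> (\<forall>a\<in>F - {\<zero>}. v a = w a)"
proof (intro exI conjI ballI)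
  define v where "v u = (THE l. at_root u l)" for u
  have v: "at_root u (v u)" if "u \<in> carrier K" "u \<noteq> \<zero>" for u
    unfolding v_def using at_root_exists[OF that] at_root_unique by (metis theI')
  have v_eq: "v u = l" if "at_root u l" for u l
    unfolding v_def using that at_root_unique by blast
  show "subfield_valuation K (carrier K) v"
  proof (rule valuation_on_carrier)
    fix a b assume ab: "a \<in> carrier K" "a \<noteq> \<zero>" "b \<in> carrier K" "b \<noteq> \<zero>"
    then show "v (a \<otimes> b) = v a + v b" using at_root_mult v v_eq by blast
    assume "a \<oplus> b \<noteq> \<zero>"
    then show "min (v a) (v b) \<le> v (a \<oplus> b)" using at_root_add[of a b] v ab by simp
  qed
  fix a assume a: "a \<in> F - {\<zero>}"
  then have "at_root a (w a)" unfolding at_root_def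
    by (intro close_root_mono[OF close_root_F]) (simp add: re_im_F)
  then show "v a = w a" by (rule v_eq)
qed

end

end

section \<open>Polynomials over a field\<close>

context field
begin

abbreviation "PR \<equiv> poly_ring R"

lemma PR_domain: "domain PR" by (rule univ_poly_is_domain[OF carrier_is_subring])

lemma PR_closed [simp]:
  "\<lbrakk>p \<in> carrier PR; q \<in> carrier PR\<rbrakk> \<Longrightarrow> p \<otimes>\<^bsub>PR\<^esub> q \<in> carrier PR"
  "\<lbrakk>p \<in> carrier PR; q \<in> carrier PR\<rbrakk> \<Longrightarrow> p \<oplus>\<^bsub>PR\<^esub> q \<in> carrier PR"
  "p \<in> carrier PR \<Longrightarrow> \<ominus>\<^bsub>PR\<^esub> p \<in> carrier PR"
  "\<lbrakk>p \<in> carrier PR; q \<in> carrier PR\<rbrakk> \<Longrightarrow> p \<ominus>\<^bsub>PR\<^esub> q \<in> carrier PR"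
  "[] \<in> carrier PR"
proof -
  interpret P: domain PR by (rule PR_domain)
  show "\<lbrakk>p \<in> carrier PR; q \<in> carrier PR\<rbrakk> \<Longrightarrow> p \<otimes>\<^bsub>PR\<^esub> q \<in> carrier PR"
  "\<lbrakk>p \<in> carrier PR; q \<in> carrier PR\<rbrakk> \<Longrightarrow> p \<oplus>\<^bsub>PR\<^esub> q \<in> carrier PR"
  "p \<in> carrier PR \<Longrightarrow> \<ominus>\<^bsub>PR\<^esub> p \<in> carrier PR"
  "\<lbrakk>p \<in> carrier PR; q \<in> carrier PR\<rbrakk> \<Longrightarrow> p \<ominus>\<^bsub>PR\<^esub> q \<in> carrier PR" by auto
qed (rule univ_poly_zero_closed)

lemma PR_const [simp]: "c \<in> carrier R \<Longrightarrow> c \<noteq> \<zero> \<Longrightarrow> [c] \<in> carrier PR"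
  by (simp add: univ_poly_def polynomial_def)

lemma PR_linear [simp]: "a \<in> carrier R \<Longrightarrow> [\<one>, \<ominus> a] \<in> carrier PR"
  by (simp add: univ_poly_def polynomial_def)

lemma PR_mult_nz: "\<lbrakk>p \<in> carrier PR; q \<in> carrier PR; p \<noteq> []; q \<noteq> []\<rbrakk> \<Longrightarrow> p \<otimes>\<^bsub>PR\<^esub> q \<noteq> []"
proof -
  interpret P: domain PR by (rule PR_domain)
  show "\<lbrakk>p \<in> carrier PR; q \<in> carrier PR; p \<noteq> []; q \<noteq> []\<rbrakk> \<Longrightarrow> p \<otimes>\<^bsub>PR\<^esub> q \<noteq> []"
    using P.integral_iff by (simp add: univ_poly_zero)
qed

lemma alg_mult_mult:
  assumes "p \<in> carrier PR" "q \<in> carrier PR" "p \<noteq> []" "q \<noteq> []"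
  shows "alg_mult (p \<otimes>\<^bsub>PR\<^esub> q) x = alg_mult p x + alg_mult q x"
  using associated_polynomials_imp_same_roots[OF assms(1,3,2,4)] assms
  by (simp add: alg_mult_eq_count_roots)

text \<open>The power of the linear factor that divides both p and q divides their sum.\<close>

lemma alg_mult_add:
  assumes "p \<in> carrier PR" "q \<in> carrier PR" "p \<noteq> []" "q \<noteq> []" "p \<oplus>\<^bsub>PR\<^esub> q \<noteq> []" "x \<in> carrier R"
  shows "min (alg_mult p x) (alg_mult q x) \<le> alg_mult (p \<oplus>\<^bsub>PR\<^esub> q) x"
proof -
  interpret P: domain PR by (rule PR_domain)
  let ?n = "min (alg_mult p x) (alg_mult q x)" and ?l = "[\<one>, \<ominus> x] [^]\<^bsub>PR\<^esub> min (alg_mult p x) (alg_mult q x)"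
  have "?l pdivides p" "?l pdivides q" using assms by (auto intro!: le_alg_mult_imp_pdivides)
  then obtain c d where "c \<in> carrier PR" "d \<in> carrier PR" "p = ?l \<otimes>\<^bsub>PR\<^esub> c" "q = ?l \<otimes>\<^bsub>PR\<^esub> d"
    unfolding pdivides_def factor_def by blast
  moreover have "?l \<in> carrier PR" using assms by simp
  ultimately have "p \<oplus>\<^bsub>PR\<^esub> q = ?l \<otimes>\<^bsub>PR\<^esub> (c \<oplus>\<^bsub>PR\<^esub> d)" "c \<oplus>\<^bsub>PR\<^esub> d \<in> carrier PR"
    by (simp_all add: P.r_distr)
  then have "?l pdivides (p \<oplus>\<^bsub>PR\<^esub> q)" unfolding pdivides_def factor_def by blast
  then show ?thesis using alg_multE(2)[of x "p \<oplus>\<^bsub>PR\<^esub> q" ?n] assms by auto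
qed

text \<open>Compare the multiplicities of x: odd on the left, even on the right. This is why f is
  not a square in k(x).\<close>

lemma not_square_times_simple_root:
  assumes "f \<in> carrier PR" "a \<in> carrier PR" "c \<in> carrier PR" "f \<noteq> []" "c \<noteq> []" "alg_mult f x = 1"
  shows "f \<otimes>\<^bsub>PR\<^esub> (c \<otimes>\<^bsub>PR\<^esub> c) \<noteq> a \<otimes>\<^bsub>PR\<^esub> a"
proof
  assume eq: "f \<otimes>\<^bsub>PR\<^esub> (c \<otimes>\<^bsub>PR\<^esub> c) = a \<otimes>\<^bsub>PR\<^esub> a"
  interpret P: domain PR by (rule PR_domain)
  have "f \<otimes>\<^bsub>PR\<^esub> (c \<otimes>\<^bsub>PR\<^esub> c) \<noteq> []" using assms by (simp add: PR_mult_nz)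
  then have "a \<noteq> []" using eq assms(2) P.r_null[of a] by (auto simp: univ_poly_zero)
  have "alg_mult (f \<otimes>\<^bsub>PR\<^esub> (c \<otimes>\<^bsub>PR\<^esub> c)) x = 1 + 2 * alg_mult c x"
    using assms by (simp add: alg_mult_mult PR_mult_nz)
  moreover have "alg_mult (a \<otimes>\<^bsub>PR\<^esub> a) x = 2 * alg_mult a x" using assms(2) \<open>a \<noteq> []\<close> by (simp add: alg_mult_mult)
  ultimately have "1 + 2 * alg_mult c x = 2 * alg_mult a x" using eq by simp
  then show False by presburger
qed

lemma degree_mult:
  assumes "p \<in> carrier PR" "q \<in> carrier PR" "p \<noteq> []" "q \<noteq> []"
  shows "degree (p \<otimes>\<^bsub>PR\<^esub> q) = degree p + degree q"
  using poly_mult_degree_eq[OF carrier_is_subring, of p q] assms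
  by (simp add: univ_poly_mult univ_poly_carrier)

lemma degree_add:
  assumes "p \<in> carrier PR" "q \<in> carrier PR"
  shows "degree (p \<oplus>\<^bsub>PR\<^esub> q) \<le> max (degree p) (degree q)"
  using poly_add_degree by (simp add: univ_poly_add)

lemma eval_PR:
  assumes "p \<in> carrier PR" "q \<in> carrier PR" "x \<in> carrier R"
  shows "eval (p \<otimes>\<^bsub>PR\<^esub> q) x = eval p x \<otimes> eval q x" "eval (p \<oplus>\<^bsub>PR\<^esub> q) x = eval p x \<oplus> eval q x"
   "eval (p \<ominus>\<^bsub>PR\<^esub> q) x = eval p x \<ominus> eval q x" "eval p x \<in> carrier R"
proof -
  interpret E: ring_hom_ring PR R "\<lambda>p. eval p x" by (rule eval_ring_hom[OF carrier_is_subring assms(3)])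
  show "eval (p \<otimes>\<^bsub>PR\<^esub> q) x = eval p x \<otimes> eval q x" "eval (p \<oplus>\<^bsub>PR\<^esub> q) x = eval p x \<oplus> eval q x"
    "eval p x \<in> carrier R" using assms by auto
  show "eval (p \<ominus>\<^bsub>PR\<^esub> q) x = eval p x \<ominus> eval q x" using assms by (simp add: a_minus_def)
qed

text \<open>The leading terms cancel. At infinity this makes a monomial whose square has the leading
  term of f an approximate square root of f.\<close>

lemma degree_minus_same_lead:
  assumes p: "p \<in> carrier PR" "p \<noteq> []" and q: "q \<in> carrier PR" "q \<noteq> []"
    and "degree p = degree q" "lead_coeff p = lead_coeff q" "p \<ominus>\<^bsub>PR\<^esub> q \<noteq> []"
  shows "degree (p \<ominus>\<^bsub>PR\<^esub> q) < degree p"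
proof -
  interpret P: domain PR by (rule PR_domain)
  let ?q = "\<ominus>\<^bsub>PR\<^esub> q"
  have q': "?q = map (\<lambda>a. \<ominus> a) q" using univ_poly_a_inv_def'[OF carrier_is_subring q(1)] .
  have cl: "p \<in> carrier PR" "?q \<in> carrier PR" "p \<ominus>\<^bsub>PR\<^esub> q \<in> carrier PR" using p q by auto
  have lp: "lead_coeff p \<in> carrier R" using p by (auto simp: univ_poly_def polynomial_def)
  have len: "degree ?q = degree p" using q' assms(5) by simp
  have "degree (p \<ominus>\<^bsub>PR\<^esub> q) \<le> degree p" using degree_add[OF cl(1,2)] len by (simp add: a_minus_def)
  moreover have "degree (p \<ominus>\<^bsub>PR\<^esub> q) \<noteq> degree p"
  proof
    assume d: "degree (p \<ominus>\<^bsub>PR\<^esub> q) = degree p"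
    have "coeff (p \<ominus>\<^bsub>PR\<^esub> q) (degree p) = coeff p (degree p) \<oplus> coeff ?q (degree p)"
      using poly_add_coeff[of p ?q] cl(1,2)[THEN polynomial_incl[OF univ_poly_carrier[THEN iffD2]]]
      by (simp add: a_minus_def univ_poly_add)
    also have "coeff p (degree p) = lead_coeff p" using p lead_coeff_simp by simp
    also have "coeff ?q (degree p) = lead_coeff ?q" using q q' len lead_coeff_simp[of ?q] by simp
    also have "lead_coeff ?q = \<ominus> lead_coeff p" using q' q assms(6) by (simp add: hd_map)
    also have "lead_coeff p \<oplus> \<ominus> lead_coeff p = \<zero>" using lp r_neg by simp
    finally have "lead_coeff (p \<ominus>\<^bsub>PR\<^esub> q) = \<zero>" using d lead_coeff_simp[OF assms(7)] by simp
    then show False using cl(3) assms(7) by (simp add: univ_poly_def polynomial_def)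
  qed
  ultimately show ?thesis by simp
qed

end

section \<open>Polynomials over an algebraically closed field\<close>

context algebraically_closed
begin

lemma exists_root_nonconstant:
  assumes "q \<in> carrier (poly_ring L)" "degree q > 0"
  shows "\<exists>a r. a \<in> carrier L \<and> r \<in> carrier (poly_ring L) \<and> r \<noteq> [] \<and> eval q a = \<zero> \<and> q = [\<one>, \<ominus> a] \<otimes>\<^bsub>poly_ring L\<^esub> r"
proof -
  interpret P: domain "poly_ring L" by (rule PR_domain)
  have "roots q \<noteq> {#}" using roots_over_carrier[OF assms(1)] assms by (auto simp: splitted_def)
  then obtain a where a: "a \<in> carrier L" "a \<in># roots q" "[\<one>, \<ominus> a] pdivides q"
    using not_empty_rootsE[OF assms(1)] by metis
  then obtain r where r: "r \<in> carrier (poly_ring L)" "q = [\<one>, \<ominus> a] \<otimes>\<^bsub>poly_ring L\<^esub> r"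
    unfolding pdivides_def factor_def by blast
  moreover have "r \<noteq> []"
  proof
    assume "r = []"
    then have "q = []" using r a P.r_null[of "[\<one>, \<ominus> a]"] by (simp add: univ_poly_zero)
    then show False using assms by simp
  qed
  moreover have "eval q a = \<zero>" using a roots_mem_iff_is_root[OF assms(1)] by (simp add: is_root_def)
  ultimately show ?thesis using a by blast
qed

lemma linear_factors_induct [consumes 2, case_names const mult]:
  assumes "q \<in> carrier (poly_ring L)" "q \<noteq> []"
    and c: "\<And>c. c \<in> carrier L \<Longrightarrow> c \<noteq> \<zero> \<Longrightarrow> Q [c]"
    and m: "\<And>a q. \<lbrakk>a \<in> carrier L; q \<in> carrier (poly_ring L); q \<noteq> []; Q q\<rbrakk> \<Longrightarrow> Q ([\<one>, \<ominus> a] \<otimes>\<^bsub>poly_ring L\<^esub> q)"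
  shows "Q q"
  using assms(1,2)
proof (induction "degree q" arbitrary: q rule: less_induct)
  case less
  show ?case
  proof (cases "degree q = 0")
    case True
    then obtain c where "q = [c]" using less.prems by (cases q) auto
    then show ?thesis using less.prems c by (auto simp: univ_poly_def polynomial_def)
  next
    case False
    then obtain a r where ar: "a \<in> carrier L" "r \<in> carrier (poly_ring L)" "r \<noteq> []" "q = [\<one>, \<ominus> a] \<otimes>\<^bsub>poly_ring L\<^esub> r"
      using exists_root_nonconstant[OF less.prems(1)] by auto
    then have "degree r < degree q" using degree_mult[of "[\<one>, \<ominus> a]" r] by simp
    then show ?thesis using less.hyps[of r] ar m by blast
  qed
qed

lemma exists_sqrt:
  assumes "c \<in> carrier L" shows "\<exists>b\<in>carrier L. b \<otimes> b = c"
proof -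
  let ?q = "[\<one>, \<zero>, \<ominus> c]"
  have q: "?q \<in> carrier (poly_ring L)" using assms by (simp add: univ_poly_def polynomial_def)
  obtain b where b: "b \<in> carrier L" "eval ?q b = \<zero>" using exists_root_nonconstant[OF q] by auto
  have "b [^] (2::nat) = b \<otimes> b" using b by (simp add: numeral_2_eq_2)
  then have "b \<otimes> b \<oplus> \<ominus> c = \<zero>" using b assms by simp
  then have "b \<otimes> b = c" using b assms by (metis a_minus_def m_closed r_right_minus_eq)
  then show ?thesis using b by blast
qed

end

section \<open>Hyperelliptic function fields\<close>

lemma (in field) root_alg_mult:
  assumes "q \<in> carrier PR" "q \<noteq> []" "x \<in> carrier R" "eval q x = \<zero>" shows "alg_mult q x \<ge> 1"
  using alg_mult_gt_zero_iff_is_root[OF assms(1), of x] assms by (simp add: is_root_def)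

text \<open>The field k(x) is present only through the embedding \<open>\<phi>\<close> of k[x];
  \<open>generated\<close> says, with denominators cleared, that K = k(x) + k(x) y. The even degree
  of f will make y^2 a square at infinity, and the simple roots will make y a uniformizer at the
  points over them.\<close>

locale hyperelliptic = k: algebraically_closed k + field K
  for k :: "('a, 'c) ring_scheme" and K :: "('b, 'd) ring_scheme" (structure) +
  fixes \<phi> :: "'a list \<Rightarrow> 'b" and y :: 'b and f :: "'a list"
  assumes hom: "\<phi> \<in> ring_hom k.PR K"
    and inj: "\<lbrakk>q \<in> carrier k.PR; \<phi> q = \<zero>\<rbrakk> \<Longrightarrow> q = []"
    and y_closed: "y \<in> carrier K"
    and y_sq: "y \<otimes> y = \<phi> f"
    and f_closed: "f \<in> carrier k.PR"
    and f_even: "even (degree f)" and f_pos: "degree f > 0"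
    and f_simple: "a \<in> carrier k \<Longrightarrow> k.alg_mult f a \<le> 1"
    and char_not_2: "\<one>\<^bsub>k\<^esub> \<oplus>\<^bsub>k\<^esub> \<one>\<^bsub>k\<^esub> \<noteq> \<zero>\<^bsub>k\<^esub>"
    and generated: "u \<in> carrier K \<Longrightarrow> \<exists>a\<in>carrier k.PR. \<exists>b\<in>carrier k.PR. \<exists>c\<in>carrier k.PR.
       c \<noteq> [] \<and> \<phi> c \<otimes> u = \<phi> a \<oplus> \<phi> b \<otimes> y"
begin

sublocale P: domain "k.PR" by (rule k.PR_domain)

lemma \<phi>_closed [simp]: "q \<in> carrier k.PR \<Longrightarrow> \<phi> q \<in> carrier K"
  using hom by (rule ring_hom_closed)

lemma \<phi>_hom: "\<lbrakk>p \<in> carrier k.PR; q \<in> carrier k.PR\<rbrakk> \<Longrightarrow> \<phi> (p \<otimes>\<^bsub>k.PR\<^esub> q) = \<phi> p \<otimes> \<phi> q"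
  "\<lbrakk>p \<in> carrier k.PR; q \<in> carrier k.PR\<rbrakk> \<Longrightarrow> \<phi> (p \<oplus>\<^bsub>k.PR\<^esub> q) = \<phi> p \<oplus> \<phi> q"
  "\<phi> [\<one>\<^bsub>k\<^esub>] = \<one>" "\<phi> [] = \<zero>"
  "p \<in> carrier k.PR \<Longrightarrow> \<phi> (\<ominus>\<^bsub>k.PR\<^esub> p) = \<ominus> \<phi> p"
  "\<lbrakk>p \<in> carrier k.PR; q \<in> carrier k.PR\<rbrakk> \<Longrightarrow> \<phi> (p \<ominus>\<^bsub>k.PR\<^esub> q) = \<phi> p \<ominus> \<phi> q"
proof -
  interpret H: ring_hom_ring k.PR K \<phi>
    by (rule ring_hom_ringI2[OF P.ring_axioms ring_axioms hom])
  show "\<lbrakk>p \<in> carrier k.PR; q \<in> carrier k.PR\<rbrakk> \<Longrightarrow> \<phi> (p \<otimes>\<^bsub>k.PR\<^esub> q) = \<phi> p \<otimes> \<phi> q"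
  "\<lbrakk>p \<in> carrier k.PR; q \<in> carrier k.PR\<rbrakk> \<Longrightarrow> \<phi> (p \<oplus>\<^bsub>k.PR\<^esub> q) = \<phi> p \<oplus> \<phi> q"
  "p \<in> carrier k.PR \<Longrightarrow> \<phi> (\<ominus>\<^bsub>k.PR\<^esub> p) = \<ominus> \<phi> p" by auto
  then show "\<lbrakk>p \<in> carrier k.PR; q \<in> carrier k.PR\<rbrakk> \<Longrightarrow> \<phi> (p \<ominus>\<^bsub>k.PR\<^esub> q) = \<phi> p \<ominus> \<phi> q"
    by (simp add: a_minus_def)
  show "\<phi> [\<one>\<^bsub>k\<^esub>] = \<one>" using H.hom_one by (simp add: univ_poly_one)
  show "\<phi> [] = \<zero>" using H.hom_zero by (simp add: univ_poly_zero)
qed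

lemma \<phi>_nz: "\<lbrakk>q \<in> carrier k.PR; q \<noteq> []\<rbrakk> \<Longrightarrow> \<phi> q \<noteq> \<zero>"
  using inj by blast

lemma \<phi>_inj: assumes "p \<in> carrier k.PR" "q \<in> carrier k.PR" "\<phi> p = \<phi> q" shows "p = q"
proof -
  have "\<phi> (p \<ominus>\<^bsub>k.PR\<^esub> q) = \<zero>" using assms by (simp add: \<phi>_hom)
  then have "p \<ominus>\<^bsub>k.PR\<^esub> q = \<zero>\<^bsub>k.PR\<^esub>" using inj[of "p \<ominus>\<^bsub>k.PR\<^esub> q"] assms by (simp add: univ_poly_zero)
  then show ?thesis using assms by simp
qed

lemma f_nz: "f \<noteq> []" using f_pos by auto

text \<open>The copy of k(x) inside K.\<close>

definition F where "F = {u \<in> carrier K. \<exists>a\<in>carrier k.PR. \<exists>c\<in>carrier k.PR. c \<noteq> [] \<and> u \<otimes> \<phi> c = \<phi> a}"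

lemma F_I: "\<lbrakk>u \<in> carrier K; a \<in> carrier k.PR; c \<in> carrier k.PR; c \<noteq> []; u \<otimes> \<phi> c = \<phi> a\<rbrakk> \<Longrightarrow> u \<in> F"
  unfolding F_def by blast

lemma F_E: assumes "u \<in> F"
  obtains a c where "u \<in> carrier K" "a \<in> carrier k.PR" "c \<in> carrier k.PR" "c \<noteq> []" "u \<otimes> \<phi> c = \<phi> a"
  using assms unfolding F_def by blast

lemma \<phi>_F: assumes "q \<in> carrier k.PR" shows "\<phi> q \<in> F"
  using assms by (intro F_I[of "\<phi> q" q "[\<one>\<^bsub>k\<^esub>]"]) (auto simp: \<phi>_hom)

lemma F_subfield: "subfield F K"
proof (intro subfieldI' subringI)
  show "F \<subseteq> carrier K" by (auto simp: F_def)
  show "\<one> \<in> F" using \<phi>_F[of "[\<one>\<^bsub>k\<^esub>]"] by (simp add: \<phi>_hom)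
next
  fix u assume "u \<in> F"
  then show "\<ominus> u \<in> F"
  proof (rule F_E)
    fix a c assume *: "u \<in> carrier K" "a \<in> carrier k.PR" "c \<in> carrier k.PR" "c \<noteq> []" "u \<otimes> \<phi> c = \<phi> a"
    then show ?thesis by (intro F_I[of _ "\<ominus>\<^bsub>k.PR\<^esub> a" c]) (simp_all add: l_minus \<phi>_hom)
  qed
next
  fix u v assume "u \<in> F" "v \<in> F"
  obtain a c where *: "u \<in> carrier K" "a \<in> carrier k.PR" "c \<in> carrier k.PR" "c \<noteq> []" "u \<otimes> \<phi> c = \<phi> a"
    by (rule F_E[OF \<open>u \<in> F\<close>])
  obtain a' c' where **: "v \<in> carrier K" "a' \<in> carrier k.PR" "c' \<in> carrier k.PR" "c' \<noteq> []" "v \<otimes> \<phi> c' = \<phi> a'"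
    by (rule F_E[OF \<open>v \<in> F\<close>])
  note cl = *(1) **(1) \<phi>_closed[OF *(3)] \<phi>_closed[OF **(3)]
  have "(u \<otimes> v) \<otimes> (\<phi> c \<otimes> \<phi> c') = (u \<otimes> \<phi> c) \<otimes> (v \<otimes> \<phi> c')" using cl by algebra
  then show "u \<otimes> v \<in> F" using * **
    by (intro F_I[of _ "a \<otimes>\<^bsub>k.PR\<^esub> a'" "c \<otimes>\<^bsub>k.PR\<^esub> c'"]) (simp_all add: \<phi>_hom k.PR_mult_nz)
  have "(u \<oplus> v) \<otimes> (\<phi> c \<otimes> \<phi> c') = (u \<otimes> \<phi> c) \<otimes> \<phi> c' \<oplus> (v \<otimes> \<phi> c') \<otimes> \<phi> c" using cl by algebra
  then show "u \<oplus> v \<in> F" using * **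
    by (intro F_I[of _ "a \<otimes>\<^bsub>k.PR\<^esub> c' \<oplus>\<^bsub>k.PR\<^esub> a' \<otimes>\<^bsub>k.PR\<^esub> c" "c \<otimes>\<^bsub>k.PR\<^esub> c'"]) (simp_all add: \<phi>_hom k.PR_mult_nz)
next
  fix u assume u: "u \<in> F - {\<zero>}"
  then have "u \<in> F" by simp
  then show "inv u \<in> F"
  proof (rule F_E)
    fix a c assume *: "u \<in> carrier K" "a \<in> carrier k.PR" "c \<in> carrier k.PR" "c \<noteq> []" "u \<otimes> \<phi> c = \<phi> a"
    have "\<phi> a \<noteq> \<zero>" using * u \<phi>_nz integral_iff[of u "\<phi> c"] by auto
    then have "a \<noteq> []" using \<phi>_hom(4) by auto
    moreover have iu: "inv u \<in> carrier K" "inv u \<otimes> u = \<one>" using u * field_Units by auto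
    have "inv u \<otimes> \<phi> a = (inv u \<otimes> u) \<otimes> \<phi> c" using * iu(1) m_assoc[of "inv u" u "\<phi> c"] by simp
    ultimately show ?thesis using * iu by (intro F_I[of _ c a]) simp_all
  qed
qed

lemma f_root: obtains a where "a \<in> carrier k" "k.alg_mult f a = 1"
proof -
  obtain a where "a \<in> carrier k" "k.eval f a = \<zero>\<^bsub>k\<^esub>" using k.exists_root_nonconstant[OF f_closed f_pos] by blast
  then show ?thesis using that[of a] f_simple[of a] k.root_alg_mult[OF f_closed f_nz, of a] by simp
qed

lemma y_notin_F: "y \<notin> F"
proof
  assume "y \<in> F"
  then obtain a c where *: "a \<in> carrier k.PR" "c \<in> carrier k.PR" "c \<noteq> []" "y \<otimes> \<phi> c = \<phi> a"
    by (rule F_E)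
  have "(y \<otimes> y) \<otimes> (\<phi> c \<otimes> \<phi> c) = (y \<otimes> \<phi> c) \<otimes> (y \<otimes> \<phi> c)"
    using y_closed \<phi>_closed[OF *(2)] by algebra
  then have "\<phi> (f \<otimes>\<^bsub>k.PR\<^esub> (c \<otimes>\<^bsub>k.PR\<^esub> c)) = \<phi> (a \<otimes>\<^bsub>k.PR\<^esub> a)"
    using * f_closed y_sq by (simp add: \<phi>_hom)
  then have eq: "f \<otimes>\<^bsub>k.PR\<^esub> (c \<otimes>\<^bsub>k.PR\<^esub> c) = a \<otimes>\<^bsub>k.PR\<^esub> a" using * f_closed by (intro \<phi>_inj) auto
  obtain x where "k.alg_mult f x = 1" by (rule f_root)
  then show False using k.not_square_times_simple_root[OF f_closed *(1,2) f_nz *(3)] eq by blast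
qed

sublocale quadratic_extension K F y
proof (intro quadratic_extension.intro field_pair.intro quadratic_extension_axioms.intro field_axioms F_subfield y_notin_F)
  show "y \<in> carrier K" "y \<otimes> y \<in> F" using y_closed y_sq \<phi>_F f_closed by auto
next
  fix u assume u: "u \<in> carrier K"
  obtain a b c where abc: "a \<in> carrier k.PR" "b \<in> carrier k.PR" "c \<in> carrier k.PR" "c \<noteq> []" "\<phi> c \<otimes> u = \<phi> a \<oplus> \<phi> b \<otimes> y"
    using generated[OF u] by blast
  let ?i = "inv (\<phi> c)"
  have i: "?i \<in> carrier K" "?i \<otimes> \<phi> c = \<one>" using abc \<phi>_nz field_Units by auto
  have "u = (?i \<otimes> \<phi> c) \<otimes> u" using i(2) u by simp
  also have "\<dots> = ?i \<otimes> (\<phi> c \<otimes> u)" using i(1) \<phi>_closed[OF abc(3)] u by (rule m_assoc)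
  also have "\<dots> = (\<phi> a \<otimes> ?i) \<oplus> (\<phi> b \<otimes> ?i) \<otimes> y" unfolding abc(5)
    using i(1) \<phi>_closed[OF abc(1)] \<phi>_closed[OF abc(2)] y_closed by algebra
  finally have "u = (\<phi> a \<otimes> ?i) \<oplus> (\<phi> b \<otimes> ?i) \<otimes> y" .
  moreover have "\<phi> q \<otimes> ?i \<in> F" if q: "q \<in> carrier k.PR" for q
    using i q abc by (intro F_I[of _ q c]) (auto simp: m_assoc)
  ultimately show "\<exists>a\<in>F. \<exists>b\<in>F. u = a \<oplus> b \<otimes> y" using abc by blast
qed

text \<open>The value of the fraction a/c is m(a) - m(c), and cross multiplication shows that it
  does not depend on the representation. It will be applied to the multiplicity of a root and to
  minus the degree.\<close>

lemma polynomial_valuation_extends: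
  assumes m_mult: "\<And>p q. \<lbrakk>p \<in> carrier k.PR; q \<in> carrier k.PR; p \<noteq> []; q \<noteq> []\<rbrakk> \<Longrightarrow> m (p \<otimes>\<^bsub>k.PR\<^esub> q) = m p + m q"
    and m_add: "\<And>p q. \<lbrakk>p \<in> carrier k.PR; q \<in> carrier k.PR; p \<noteq> []; q \<noteq> []; p \<oplus>\<^bsub>k.PR\<^esub> q \<noteq> []\<rbrakk> \<Longrightarrow> min (m p) (m q) \<le> m (p \<oplus>\<^bsub>k.PR\<^esub> q)"
  shows "\<exists>w. subfield_valuation K F w \<and> (\<forall>q\<in>carrier k.PR - {[]}. w (\<phi> q) = (m q :: int))"
proof -
  define w where "w u = (SOME n. \<exists>a\<in>carrier k.PR. \<exists>c\<in>carrier k.PR. c \<noteq> [] \<and> u \<otimes> \<phi> c = \<phi> a \<and> n = m a - m c)" for u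
  have w_eq: "w u = m a - m c"
    if u: "u \<in> F" "u \<noteq> \<zero>" and ac: "a \<in> carrier k.PR" "c \<in> carrier k.PR" "c \<noteq> []" "u \<otimes> \<phi> c = \<phi> a" for u a c
  proof -
    have uK: "u \<in> carrier K" using u(1) by (rule F_carr)
    have nz: "a' \<noteq> []" if "c' \<in> carrier k.PR" "c' \<noteq> []" "u \<otimes> \<phi> c' = \<phi> a'" for a' c'
    proof
      assume "a' = []"
      then have "u \<otimes> \<phi> c' = \<zero>" using that(3) \<phi>_hom(4) by simp
      then show False using integral[of u "\<phi> c'"] uK \<phi>_closed[OF that(1)] \<phi>_nz[OF that(1,2)] u(2) by blast
    qed
    show ?thesis unfolding w_def
    proof (rule some_equality)
      show "\<exists>a'\<in>carrier k.PR. \<exists>c'\<in>carrier k.PR. c' \<noteq> [] \<and> u \<otimes> \<phi> c' = \<phi> a' \<and> m a - m c = m a' - m c'"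
        using ac by blast
    next
      fix n assume "\<exists>a'\<in>carrier k.PR. \<exists>c'\<in>carrier k.PR. c' \<noteq> [] \<and> u \<otimes> \<phi> c' = \<phi> a' \<and> n = m a' - m c'"
      then obtain a' c' where ac': "a' \<in> carrier k.PR" "c' \<in> carrier k.PR" "c' \<noteq> []" "u \<otimes> \<phi> c' = \<phi> a'" "n = m a' - m c'" by blast
      have "(u \<otimes> \<phi> c) \<otimes> \<phi> c' = (u \<otimes> \<phi> c') \<otimes> \<phi> c"
        using uK \<phi>_closed[OF ac(2)] \<phi>_closed[OF ac'(2)] by algebra
      then have "\<phi> a \<otimes> \<phi> c' = \<phi> a' \<otimes> \<phi> c" unfolding ac(4) ac'(4) .
      then have eq: "a \<otimes>\<^bsub>k.PR\<^esub> c' = a' \<otimes>\<^bsub>k.PR\<^esub> c" using ac(1,2) ac'(1,2) by (intro \<phi>_inj) (simp_all add: \<phi>_hom)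
      have "m a + m c' = m a' + m c"
        using m_mult[OF ac(1) ac'(2) nz[OF ac(2-4)] ac'(3)] m_mult[OF ac'(1) ac(2) nz[OF ac'(2-4)] ac(3)]
        unfolding eq by simp
      then show "n = m a - m c" using ac' by simp
    qed
  qed
  have "subfield_valuation K F w"
  proof (intro subfield_valuation.intro subfield_valuation_axioms.intro field_pair.intro F_subfield field_axioms)
    fix u v assume uv: "u \<in> F" "u \<noteq> \<zero>" "v \<in> F" "v \<noteq> \<zero>"
    obtain a c where *: "u \<in> carrier K" "a \<in> carrier k.PR" "c \<in> carrier k.PR" "c \<noteq> []" "u \<otimes> \<phi> c = \<phi> a"
      by (rule F_E[OF \<open>u \<in> F\<close>])
    obtain a' c' where **: "v \<in> carrier K" "a' \<in> carrier k.PR" "c' \<in> carrier k.PR" "c' \<noteq> []" "v \<otimes> \<phi> c' = \<phi> a'"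
      by (rule F_E[OF \<open>v \<in> F\<close>])
    have "u \<otimes> \<phi> c \<noteq> \<zero>" "v \<otimes> \<phi> c' \<noteq> \<zero>"
      using integral[of u "\<phi> c"] integral[of v "\<phi> c'"] * ** uv \<phi>_nz \<phi>_closed by blast+
    then have nz: "a \<noteq> []" "a' \<noteq> []" using *(5) **(5) \<phi>_hom(4) by auto
    note cl = *(1) **(1) \<phi>_closed[OF *(3)] \<phi>_closed[OF **(3)]
    have wu: "w u = m a - m c" "w v = m a' - m c'"
      by (rule w_eq[OF uv(1,2) *(2-5)], rule w_eq[OF uv(3,4) **(2-5)])
    have "(u \<otimes> v) \<otimes> (\<phi> c \<otimes> \<phi> c') = (u \<otimes> \<phi> c) \<otimes> (v \<otimes> \<phi> c')" using cl by algebra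
    then have "(u \<otimes> v) \<otimes> \<phi> (c \<otimes>\<^bsub>k.PR\<^esub> c') = \<phi> (a \<otimes>\<^bsub>k.PR\<^esub> a')" using * ** by (simp add: \<phi>_hom)
    then have "w (u \<otimes> v) = m (a \<otimes>\<^bsub>k.PR\<^esub> a') - m (c \<otimes>\<^bsub>k.PR\<^esub> c')" using uv *(1-4) **(1-4)
      by (intro w_eq) (simp_all add: k.PR_mult_nz integral_iff)
    then show "w (u \<otimes> v) = w u + w v" using wu m_mult *(1-4) **(1-4) nz by simp
    assume uvnz: "u \<oplus> v \<noteq> \<zero>"
    have "(u \<oplus> v) \<otimes> (\<phi> c \<otimes> \<phi> c') = (u \<otimes> \<phi> c) \<otimes> \<phi> c' \<oplus> (v \<otimes> \<phi> c') \<otimes> \<phi> c" using cl by algebra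
    then have eq: "(u \<oplus> v) \<otimes> \<phi> (c \<otimes>\<^bsub>k.PR\<^esub> c') = \<phi> (a \<otimes>\<^bsub>k.PR\<^esub> c' \<oplus>\<^bsub>k.PR\<^esub> a' \<otimes>\<^bsub>k.PR\<^esub> c)" using * ** by (simp add: \<phi>_hom)
    then have s: "w (u \<oplus> v) = m (a \<otimes>\<^bsub>k.PR\<^esub> c' \<oplus>\<^bsub>k.PR\<^esub> a' \<otimes>\<^bsub>k.PR\<^esub> c) - m (c \<otimes>\<^bsub>k.PR\<^esub> c')" using uv *(1-4) **(1-4) uvnz
      by (intro w_eq) (simp_all add: k.PR_mult_nz)
    have "a \<otimes>\<^bsub>k.PR\<^esub> c' \<oplus>\<^bsub>k.PR\<^esub> a' \<otimes>\<^bsub>k.PR\<^esub> c \<noteq> []"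
    proof
      assume "a \<otimes>\<^bsub>k.PR\<^esub> c' \<oplus>\<^bsub>k.PR\<^esub> a' \<otimes>\<^bsub>k.PR\<^esub> c = []"
      then have "(u \<oplus> v) \<otimes> \<phi> (c \<otimes>\<^bsub>k.PR\<^esub> c') = \<zero>" using eq \<phi>_hom(4) by simp
      then show False using uvnz \<phi>_nz[of "c \<otimes>\<^bsub>k.PR\<^esub> c'"] * ** k.PR_mult_nz by (simp add: integral_iff)
    qed
    then have "min (m (a \<otimes>\<^bsub>k.PR\<^esub> c')) (m (a' \<otimes>\<^bsub>k.PR\<^esub> c)) \<le> m (a \<otimes>\<^bsub>k.PR\<^esub> c' \<oplus>\<^bsub>k.PR\<^esub> a' \<otimes>\<^bsub>k.PR\<^esub> c)"
      using *(1-4) **(1-4) nz by (intro m_add) (simp_all add: k.PR_mult_nz)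
    then show "min (w u) (w v) \<le> w (u \<oplus> v)" using s wu m_mult *(1-4) **(1-4) nz by simp
  qed
  moreover have "w (\<phi> q) = m q" if "q \<in> carrier k.PR - {[]}" for q
  proof -
    have "m [\<one>\<^bsub>k\<^esub>] = 0" using m_mult[of "[\<one>\<^bsub>k\<^esub>]" "[\<one>\<^bsub>k\<^esub>]"] P.l_one[of "[\<one>\<^bsub>k\<^esub>]"] by (simp add: univ_poly_one)
    then show ?thesis using w_eq[of "\<phi> q" q "[\<one>\<^bsub>k\<^esub>]"] that \<phi>_nz[of q] by (simp add: \<phi>_F \<phi>_hom)
  qed
  ultimately show ?thesis by blast
qed

end

section \<open>Points of a hyperelliptic curve\<close>

context hyperelliptic
begin

definition constants where "constants = (\<lambda>c. \<phi> (k.poly_of_const c)) ` carrier k"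

abbreviation "pts \<equiv> curve_points K constants"

abbreviation "lin a \<equiv> [\<one>\<^bsub>k\<^esub>, \<ominus>\<^bsub>k\<^esub> a]"

lemma F_nz_E: assumes "u \<in> F" "u \<noteq> \<zero>"
  obtains a c where "a \<in> carrier k.PR" "c \<in> carrier k.PR" "a \<noteq> []" "c \<noteq> []" "u \<otimes> \<phi> c = \<phi> a"
proof (rule F_E[OF assms(1)])
  fix a c assume ac: "u \<in> carrier K" "a \<in> carrier k.PR" "c \<in> carrier k.PR" "c \<noteq> []" "u \<otimes> \<phi> c = \<phi> a"
  have "a \<noteq> []"
  proof
    assume "a = []"
    then have "u \<otimes> \<phi> c = \<zero>" using ac(5) \<phi>_hom(4) by simp
    then show False using integral[of u "\<phi> c"] ac(1,3,4) \<phi>_nz \<phi>_closed assms(2) by blast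
  qed
  then show ?thesis using that ac by blast
qed

lemma poly_of_const_eq: "c \<noteq> \<zero>\<^bsub>k\<^esub> \<Longrightarrow> k.poly_of_const c = [c]"
  by (simp add: k.poly_of_const_def)

lemma pts_valuation: assumes "v \<in> pts" shows "subfield_valuation K (carrier K) v"
  using assms unfolding curve_points_def
  by (intro subfield_valuation.intro field_pair.intro subfield_valuation_axioms.intro field_axioms
      carrier_is_subfield) auto

lemma pts_const: assumes "v \<in> pts" "c \<in> carrier k" "c \<noteq> \<zero>\<^bsub>k\<^esub>" shows "v (\<phi> [c]) = 0"
proof -
  have "\<phi> [c] \<in> constants - {\<zero>}" using assms \<phi>_nz[of "[c]"] poly_of_const_eq[of c]
    unfolding constants_def by (metis Diff_iff image_eqI list.distinct(1) k.PR_const singletonD)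
  then show ?thesis using assms(1) unfolding curve_points_def by blast
qed

lemma pts_surj: assumes "v \<in> pts" obtains z where "z \<in> carrier K" "z \<noteq> \<zero>" "v z = 1"
proof -
  have "v ` (carrier K - {\<zero>}) = UNIV" using assms unfolding curve_points_def by blast
  then obtain z where "z \<in> carrier K - {\<zero>}" "v z = 1" by (metis UNIV_I imageE)
  then show ?thesis using that by blast
qed

lemma pts_eqI: assumes "v \<in> pts" "v' \<in> pts" "\<And>u. \<lbrakk>u \<in> carrier K; u \<noteq> \<zero>\<rbrakk> \<Longrightarrow> v u = v' u" shows "v = v'"
proof (rule extensionalityI)
  show "v \<in> extensional (carrier K - {\<zero>})" "v' \<in> extensional (carrier K - {\<zero>})"
    using assms unfolding curve_points_def by auto
qed (use assms in auto)

text \<open>Surjectivity onto the integers follows from a single element of value 1, by its powers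
  and their inverses. The restriction is there because points are functions that are
  \<open>undefined\<close> away from the nonzero elements of K.\<close>

lemma ptsI:
  assumes "subfield_valuation K (carrier K) v"
    and c: "\<And>c. \<lbrakk>c \<in> carrier k; c \<noteq> \<zero>\<^bsub>k\<^esub>\<rbrakk> \<Longrightarrow> v (\<phi> [c]) = 0"
    and z: "z \<in> carrier K" "z \<noteq> \<zero>" "v z = 1"
  shows "restrict v (carrier K - {\<zero>}) \<in> pts"
proof -
  interpret v: subfield_valuation K "carrier K" v by fact
  have "v ` (carrier K - {\<zero>}) = UNIV"
  proof (intro equalityI subsetI UNIV_I)
    fix n :: int
    have *: "z [^] m \<in> carrier K - {\<zero>} \<and> v (z [^] m) = int m" for m :: nat
      using v.w_pow[OF z(1,2), of m] z(3) by (simp only: Diff_iff singleton_iff mult_1_right not_False_eq_True simp_thms)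
    show "n \<in> v ` (carrier K - {\<zero>})"
    proof (cases "n \<ge> 0")
      case True then show ?thesis using *[of "nat n"] by (intro image_eqI[of _ _ "z [^] nat n"]) auto
    next
      case False
      define m where "m = nat (-n)"
      have "z [^] m \<in> carrier K" "z [^] m \<noteq> \<zero>" "v (z [^] m) = - n" using *[of m] False by (auto simp: m_def)
      then have "v (inv (z [^] m)) = n" "inv (z [^] m) \<in> carrier K - {\<zero>}"
        using v.w_inv[of "z [^] m"] v.F_inv[of "z [^] m"] v.inv_nz[of "z [^] m"] by simp_all
      then show ?thesis by (metis imageI)
    qed
  qed
  moreover have "v x = 0" if x: "x \<in> constants - {\<zero>}" for x
  proof -
    obtain c where "c \<in> carrier k" "x = \<phi> (k.poly_of_const c)" using x unfolding constants_def by blast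
    then show ?thesis using x c[of c] \<phi>_hom(4) by (cases "c = \<zero>\<^bsub>k\<^esub>") (auto simp: k.poly_of_const_def)
  qed
  moreover have "constants \<subseteq> carrier K"
  proof
    fix x assume "x \<in> constants"
    then obtain c where "c \<in> carrier k" "x = \<phi> (k.poly_of_const c)" unfolding constants_def by blast
    then show "x \<in> carrier K" by (cases "c = \<zero>\<^bsub>k\<^esub>") (auto simp: k.poly_of_const_def)
  qed
  ultimately show ?thesis
    unfolding curve_points_def using v.w_mult v.w_add integral_iff
    by (simp add: subset_iff)
qed

section \<open>Zeros and poles of polynomials at a point\<close>

lemma lin_diff:
  assumes "a \<in> carrier k" "b \<in> carrier k" "a \<noteq> b"
  shows "\<phi> (lin a) = \<phi> (lin b) \<oplus> \<phi> [b \<ominus>\<^bsub>k\<^esub> a]" "b \<ominus>\<^bsub>k\<^esub> a \<in> carrier k" "b \<ominus>\<^bsub>k\<^esub> a \<noteq> \<zero>\<^bsub>k\<^esub>"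
proof -
  show ba: "b \<ominus>\<^bsub>k\<^esub> a \<in> carrier k" "b \<ominus>\<^bsub>k\<^esub> a \<noteq> \<zero>\<^bsub>k\<^esub>" using assms by auto
  have "\<ominus>\<^bsub>k\<^esub> b \<oplus>\<^bsub>k\<^esub> (b \<ominus>\<^bsub>k\<^esub> a) = \<ominus>\<^bsub>k\<^esub> a" using assms
    by (simp add: a_minus_def k.a_assoc[symmetric] k.l_neg)
  then have "lin a = lin b \<oplus>\<^bsub>k.PR\<^esub> [b \<ominus>\<^bsub>k\<^esub> a]" by (simp add: univ_poly_add)
  then show "\<phi> (lin a) = \<phi> (lin b) \<oplus> \<phi> [b \<ominus>\<^bsub>k\<^esub> a]" using assms ba by (simp add: \<phi>_hom)
qed

lemma valuation_of_polynomial: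
  assumes v: "v \<in> pts" and q: "q \<in> carrier k.PR" "q \<noteq> []"
  shows "v (\<phi> q) = (\<Sum>a\<in>#k.roots q. v (\<phi> (lin a)))"
proof -
  interpret v: subfield_valuation K "carrier K" v by (rule pts_valuation[OF v])
  show ?thesis using q
  proof (induction q rule: k.linear_factors_induct)
    case (const c)
    then show ?case using pts_const[OF v] k.degree_zero_imp_empty_roots[of "[c]"] by simp
  next
    case (mult a q)
    have "v (\<phi> (lin a \<otimes>\<^bsub>k.PR\<^esub> q)) = v (\<phi> (lin a)) + v (\<phi> q)"
      using mult by (simp add: \<phi>_hom v.w_mult \<phi>_nz)
    then show ?case using mult k.poly_mult_degree_one_monic_imp_same_roots[of a q] by simp
  qed
qed

text \<open>Two linear polynomials differ by a constant, which has value 0 and is dominated by a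
  pole. Such a point lies over infinity.\<close>

lemma lin_neg:
  assumes v: "v \<in> pts" and ab: "a \<in> carrier k" "b \<in> carrier k" "v (\<phi> (lin b)) < 0"
  shows "v (\<phi> (lin a)) = v (\<phi> (lin b))"
proof (cases "a = b")
  case False
  interpret v: subfield_valuation K "carrier K" v by (rule pts_valuation[OF v])
  have "v (\<phi> [b \<ominus>\<^bsub>k\<^esub> a]) = 0" using pts_const[OF v] lin_diff[OF ab(1,2) False] by blast
  then show ?thesis using v.w_dominated(2)[of "\<phi> (lin b)" "\<phi> [b \<ominus>\<^bsub>k\<^esub> a]" 0] lin_diff[OF ab(1,2) False] ab \<phi>_nz
    by (simp add: v.ge_def)
qed simp

text \<open>Here the constant difference dominates, so a zero of x - b is not a zero of any other
  linear polynomial. Such a point lies over b.\<close>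

lemma lin_pos:
  assumes v: "v \<in> pts" and ab: "a \<in> carrier k" "b \<in> carrier k" "v (\<phi> (lin b)) > 0" "a \<noteq> b"
  shows "v (\<phi> (lin a)) = 0"
proof -
  interpret v: subfield_valuation K "carrier K" v by (rule pts_valuation[OF v])
  have "v (\<phi> [b \<ominus>\<^bsub>k\<^esub> a]) = 0" using pts_const[OF v] lin_diff[OF ab(1,2,4)] by blast
  then show ?thesis using v.w_dominated(2)[of "\<phi> [b \<ominus>\<^bsub>k\<^esub> a]" "\<phi> (lin b)" "v (\<phi> (lin b))"] lin_diff[OF ab(1,2,4)] ab \<phi>_nz
    by (simp add: v.ge_def a_comm)
qed

lemma valuation_at_infinity:
  assumes v: "v \<in> pts" and q: "q \<in> carrier k.PR" "q \<noteq> []" and b: "b \<in> carrier k" "v (\<phi> (lin b)) < 0"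
  shows "v (\<phi> q) = int (degree q) * v (\<phi> (lin b))"
proof -
  have "v (\<phi> (lin a)) = v (\<phi> (lin b))" if "a \<in># k.roots q" for a
    using that k.roots_mem_iff_is_root[OF q(1)] lin_neg[OF v _ b] by (simp add: k.is_root_def)
  then have "v (\<phi> q) = (\<Sum>a\<in>#k.roots q. v (\<phi> (lin b)))"
    unfolding valuation_of_polynomial[OF v q] by (intro arg_cong[of _ _ sum_mset] image_mset_cong)
  also have "\<dots> = int (size (k.roots q)) * v (\<phi> (lin b))" by simp
  also have "size (k.roots q) = degree q" using k.roots_over_carrier[OF q(1)] by (simp add: k.splitted_def)
  finally show ?thesis .
qed

lemma valuation_at_finite_point:
  assumes v: "v \<in> pts" and q: "q \<in> carrier k.PR" "q \<noteq> []" and b: "b \<in> carrier k" "v (\<phi> (lin b)) > 0"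
  shows "v (\<phi> q) = int (k.alg_mult q b) * v (\<phi> (lin b))"
proof -
  have "v (\<phi> (lin a)) = (if a = b then v (\<phi> (lin b)) else 0)" if "a \<in># k.roots q" for a
    using that k.roots_mem_iff_is_root[OF q(1)] lin_pos[OF v _ b] by (simp add: k.is_root_def)
  then have "v (\<phi> q) = (\<Sum>a\<in>#k.roots q. if a = b then v (\<phi> (lin b)) else 0)"
    unfolding valuation_of_polynomial[OF v q] by (intro arg_cong[of _ _ sum_mset] image_mset_cong) auto
  also have "\<dots> = int (count (k.roots q) b) * v (\<phi> (lin b))" by (simp add: sum_mset_delta)
  finally show ?thesis using k.alg_mult_eq_count_roots[OF q(1)] by simp
qed

text \<open>A point over the simple root b of f. That x - b vanishes there to order exactly 2 is a
  consequence, proved next.\<close>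

definition ramified where "ramified b v \<longleftrightarrow> b \<in> carrier k \<and> k.alg_mult f b = 1 \<and> v \<in> pts \<and> v (\<phi> (lin b)) > 0"

text \<open>Let h be the value of y. As f has a simple zero at b, the value of x - b equals that of
  f = y^2, namely 2h. So the values on F are even multiples of h, those of elements of F times y are
  odd multiples, no cancellation occurs between the two, and all values on K are multiples of h.
  Since 1 is a value, h = 1.\<close>

lemma ramified_valuation:
  assumes "ramified b v"
  shows "v (\<phi> (lin b)) = 2" "v y = 1"
    "\<lbrakk>a \<in> carrier k.PR; c \<in> carrier k.PR; a \<noteq> []; c \<noteq> []; g \<in> F; g \<otimes> \<phi> c = \<phi> a\<rbrakk> \<Longrightarrow>
       v g = 2 * (int (k.alg_mult a b) - int (k.alg_mult c b))"
    "\<lbrakk>g \<in> F; g \<noteq> \<zero>\<rbrakk> \<Longrightarrow> even (v g)"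
    "\<lbrakk>p \<in> F; q \<in> F; p \<noteq> \<zero>; q \<noteq> \<zero>\<rbrakk> \<Longrightarrow> v (p \<oplus> q \<otimes> y) = min (v p) (v q + 1)"
proof -
  have b: "b \<in> carrier k" "k.alg_mult f b = 1" and v: "v \<in> pts" and pos: "v (\<phi> (lin b)) > 0"
    using assms by (auto simp: ramified_def)
  interpret v: subfield_valuation K "carrier K" v by (rule pts_valuation[OF v])
  let ?h = "v y"
  have yy: "v (y \<otimes> y) = 2 * ?h" using v.w_mult[of y y] y_nz by simp
  have e: "v (\<phi> (lin b)) = 2 * ?h"
    using valuation_at_finite_point[OF v f_closed f_nz b(1) pos] b yy y_sq by simp
  then have hpos: "?h > 0" using pos by simp
  have frac: "v g = 2 * ?h * (int (k.alg_mult a b) - int (k.alg_mult c b))"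
    if "a \<in> carrier k.PR" "c \<in> carrier k.PR" "a \<noteq> []" "c \<noteq> []" "g \<in> F" "g \<otimes> \<phi> c = \<phi> a" for a c g
  proof -
    have "\<phi> a \<noteq> \<zero>" "\<phi> c \<noteq> \<zero>" using that \<phi>_nz by auto
    moreover from this have "g \<noteq> \<zero>" using that(2,5,6) by (metis l_null \<phi>_closed)
    ultimately have "v g + v (\<phi> c) = v (\<phi> a)" using v.w_mult[of g "\<phi> c"] that by simp
    then show ?thesis using valuation_at_finite_point[OF v _ _ b(1) pos, of a]
      valuation_at_finite_point[OF v _ _ b(1) pos, of c] that e by (simp add: algebra_simps)
  qed
  have mult: "2 * ?h dvd v g" if g: "g \<in> F" "g \<noteq> \<zero>" for g
  proof -
    obtain a c where ac: "a \<in> carrier k.PR" "c \<in> carrier k.PR" "a \<noteq> []" "c \<noteq> []" "g \<otimes> \<phi> c = \<phi> a"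
      using F_nz_E[OF g] .
    then show ?thesis using frac[OF ac(1-4) g(1) ac(5)] by simp
  qed
  have mn: "v (p \<oplus> q \<otimes> y) = min (v p) (v q + ?h) \<and> p \<oplus> q \<otimes> y \<noteq> \<zero>"
    if pq: "p \<in> F" "q \<in> F" "p \<noteq> \<zero>" "q \<noteq> \<zero>" for p q
  proof -
    have qy: "q \<otimes> y \<noteq> \<zero>" "v (q \<otimes> y) = v q + ?h" using pq y_nz v.w_mult[of q y] by (auto simp: integral_iff)
    obtain m n where mn: "v p = 2 * ?h * m" "v q = 2 * ?h * n" using mult[OF pq(1,3)] mult[OF pq(2,4)] by (auto elim!: dvdE)
    have "v p \<noteq> v (q \<otimes> y)"
    proof
      assume "v p = v (q \<otimes> y)"
      then have "?h * (2 * m) = ?h * (2 * n + 1)" using mn qy by (simp add: algebra_simps)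
      then have "2 * m = 2 * n + 1" using hpos mult_left_cancel[of ?h] by simp
      then show False by presburger
    qed
    then show ?thesis using v.w_add_neq[of p "q \<otimes> y"] pq qy by simp
  qed
  obtain z where z: "z \<in> carrier K" "z \<noteq> \<zero>" "v z = 1" by (rule pts_surj[OF v])
  have "?h dvd v z"
  proof (cases "re z = \<zero>")
    case True
    then have zy: "im z \<otimes> y = z" using decomp[OF z(1)] im_F[OF z(1)] by simp
    then have imz: "im z \<noteq> \<zero>" using z(2) by auto
    then have "v z = v (im z) + ?h" using v.w_mult[of "im z" y] y_nz im_F[OF z(1)] zy by simp
    moreover have "?h dvd v (im z)" using mult[OF im_F[OF z(1)] imz] dvd_mult_right by blast
    ultimately show ?thesis by simp
  next
    case re: False
    show ?thesis
    proof (cases "im z = \<zero>")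
      case True
      then have "re z = z" using decomp[OF z(1)] z by simp
      then have "z \<in> F" using re_F[OF z(1)] by simp
      then show ?thesis using mult[OF _ z(2)] dvd_mult_right by blast
    next
      case False
      then have "v z = min (v (re z)) (v (im z) + ?h)" using mn[of "re z" "im z"] re decomp[OF z(1)] z by simp
      moreover have "?h dvd v (re z)" "?h dvd v (im z) + ?h" using mult[of "re z"] mult[of "im z"] re False z
        by (auto intro: dvd_mult_right)
      ultimately show ?thesis by (simp add: min_def)
    qed
  qed
  then have h: "?h = 1" using z hpos by (simp add: zdvd1_eq)
  show "v (\<phi> (lin b)) = 2" "v y = 1" using e h by auto
  show "\<lbrakk>a \<in> carrier k.PR; c \<in> carrier k.PR; a \<noteq> []; c \<noteq> []; g \<in> F; g \<otimes> \<phi> c = \<phi> a\<rbrakk> \<Longrightarrow>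
       v g = 2 * (int (k.alg_mult a b) - int (k.alg_mult c b))" using frac h by simp
  show "\<lbrakk>g \<in> F; g \<noteq> \<zero>\<rbrakk> \<Longrightarrow> even (v g)" using mult[of g] h by simp
  show "\<lbrakk>p \<in> F; q \<in> F; p \<noteq> \<zero>; q \<noteq> \<zero>\<rbrakk> \<Longrightarrow> v (p \<oplus> q \<otimes> y) = min (v p) (v q + 1)" using mn h by simp
qed

text \<open>Multiplicities at b determine the values on F. The two coordinates of an element
  contribute values of different parity, so these determine its value as well.\<close>

lemma ramified_unique:
  assumes "ramified b v" "ramified b v'" shows "v = v'"
proof (rule pts_eqI)
  show vp: "v \<in> pts" "v' \<in> pts" using assms by (auto simp: ramified_def)
  interpret v: subfield_valuation K "carrier K" v by (rule pts_valuation[OF vp(1)])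
  interpret v': subfield_valuation K "carrier K" v' by (rule pts_valuation[OF vp(2)])
  have F: "v g = v' g" if g: "g \<in> F" "g \<noteq> \<zero>" for g
  proof -
    obtain a c where ac: "a \<in> carrier k.PR" "c \<in> carrier k.PR" "a \<noteq> []" "c \<noteq> []" "g \<otimes> \<phi> c = \<phi> a"
      using F_nz_E[OF g] .
    then show ?thesis using ramified_valuation(3)[OF assms(1) ac(1-4) g(1) ac(5)]
      ramified_valuation(3)[OF assms(2) ac(1-4) g(1) ac(5)] by simp
  qed
  fix u assume u: "u \<in> carrier K" "u \<noteq> \<zero>"
  consider "re u = \<zero>" "im u \<noteq> \<zero>" | "im u = \<zero>" "re u \<noteq> \<zero>" | "re u \<noteq> \<zero>" "im u \<noteq> \<zero>"
    using decomp[OF u(1)] u(2) by fastforce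
  then show "v u = v' u"
  proof cases
    case 1
    then have "im u \<otimes> y = u" using decomp[OF u(1)] im_F[OF u(1)] by simp
    then show ?thesis using F[OF im_F[OF u(1)] 1(2)] v.w_mult[of "im u" y] v'.w_mult[of "im u" y] 1 y_nz im_F[OF u(1)]
      ramified_valuation(2)[OF assms(1)] ramified_valuation(2)[OF assms(2)] by simp
  next
    case 2
    then have "re u = u" using decomp[OF u(1)] u by simp
    then have "u \<in> F" using re_F[OF u(1)] by simp
    then show ?thesis using F u(2) by blast
  next
    case 3
    then show ?thesis using F[of "re u"] F[of "im u"] ramified_valuation(5)[OF assms(1), of "re u" "im u"]
       ramified_valuation(5)[OF assms(2), of "re u" "im u"] decomp[OF u(1)] u by simp
  qed
qed

end

section \<open>Existence of points, and functions without poles\<close>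

context hyperelliptic
begin

lemma two_const: "\<one> \<oplus> \<one> = \<phi> [\<one>\<^bsub>k\<^esub> \<oplus>\<^bsub>k\<^esub> \<one>\<^bsub>k\<^esub>]"
proof -
  have "[\<one>\<^bsub>k\<^esub>] \<oplus>\<^bsub>k.PR\<^esub> [\<one>\<^bsub>k\<^esub>] = [\<one>\<^bsub>k\<^esub> \<oplus>\<^bsub>k\<^esub> \<one>\<^bsub>k\<^esub>]" using char_not_2 by (simp add: univ_poly_add)
  then show ?thesis using \<phi>_hom(2)[of "[\<one>\<^bsub>k\<^esub>]" "[\<one>\<^bsub>k\<^esub>]"] \<phi>_hom(3) by simp
qed

lemma two_nz: "\<one> \<oplus> \<one> \<noteq> \<zero>"
  unfolding two_const using char_not_2 by (intro \<phi>_nz) auto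

text \<open>Extend the multiplicity at b to K. If f(b) = 0, the root is simple, so y^2 has the odd
  value 1 and y becomes a uniformizer. Otherwise a constant s with s^2 = f(b) is an approximate
  square root of f, and x - b remains a uniformizer.\<close>

lemma exists_point_over:
  assumes b: "b \<in> carrier k"
  shows "\<exists>v\<in>pts. v (\<phi> (lin b)) > 0"
proof -
  have "\<exists>w. subfield_valuation K F w \<and> (\<forall>q\<in>carrier k.PR - {[]}. w (\<phi> q) = int (k.alg_mult q b))"
  proof (rule polynomial_valuation_extends)
    fix p q assume pq: "p \<in> carrier k.PR" "q \<in> carrier k.PR" "p \<noteq> []" "q \<noteq> []"
    show "int (k.alg_mult (p \<otimes>\<^bsub>k.PR\<^esub> q) b) = int (k.alg_mult p b) + int (k.alg_mult q b)"
      using k.alg_mult_mult[OF pq, of b] by linarith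
    assume "p \<oplus>\<^bsub>k.PR\<^esub> q \<noteq> []"
    then show "min (int (k.alg_mult p b)) (int (k.alg_mult q b)) \<le> int (k.alg_mult (p \<oplus>\<^bsub>k.PR\<^esub> q) b)"
      using k.alg_mult_add[OF pq _ b] by linarith
  qed
  then obtain w where w: "subfield_valuation K F w" and wq: "\<And>q. \<lbrakk>q \<in> carrier k.PR; q \<noteq> []\<rbrakk> \<Longrightarrow> w (\<phi> q) = int (k.alg_mult q b)"
    by blast
  interpret w: subfield_valuation K F w by (rule w)
  interpret valued_quadratic_extension K F y w by unfold_locales
  have wc: "w (\<phi> [c]) = 0" if "c \<in> carrier k" "c \<noteq> \<zero>\<^bsub>k\<^esub>" for c
    using wq[of "[c]"] that k.degree_zero_imp_empty_roots[of "[c]"] k.alg_mult_eq_count_roots[of "[c]"] by simp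
  have wl: "w (\<phi> (lin b)) = 1"
    using wq[of "lin b"] b k.monic_degree_one_roots[OF b] k.alg_mult_eq_count_roots[of "lin b"] by simp
  have lb: "\<phi> (lin b) \<in> F" "\<phi> (lin b) \<noteq> \<zero>" using \<phi>_F \<phi>_nz b by auto
  show ?thesis
  proof (cases "k.eval f b = \<zero>\<^bsub>k\<^esub>")
    case True
    then have "k.alg_mult f b = 1"
      using f_simple[OF b] k.root_alg_mult[OF f_closed f_nz b] by simp
    then have wy: "w (y \<otimes> y) = 1" using wq[OF f_closed f_nz] y_sq by simp
    then obtain v where v: "subfield_valuation K (carrier K) v" "\<And>a. \<lbrakk>a \<in> F; a \<noteq> \<zero>\<rbrakk> \<Longrightarrow> v a = 2 * w a" "v y = 1"
      using ramified_extension by auto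
    have "restrict v (carrier K - {\<zero>}) \<in> pts"
      using v wc \<phi>_F \<phi>_nz y_nz by (intro ptsI[of v y]) auto
    moreover have "restrict v (carrier K - {\<zero>}) (\<phi> (lin b)) > 0" using v(2)[OF lb] wl lb by simp
    ultimately show ?thesis by blast
  next
    case False
    obtain s where s: "s \<in> carrier k" "s \<otimes>\<^bsub>k\<^esub> s = k.eval f b"
      using k.exists_sqrt[of "k.eval f b"] k.eval_PR[OF f_closed f_closed b] by blast
    have snz: "s \<noteq> \<zero>\<^bsub>k\<^esub>" using s False by auto
    let ?q = "[s] \<otimes>\<^bsub>k.PR\<^esub> [s] \<ominus>\<^bsub>k.PR\<^esub> f"
    have q: "?q \<in> carrier k.PR" using s snz f_closed by simp
    have "k.eval [s] b = s" using s b by simp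
    then have "k.eval ?q b = \<zero>\<^bsub>k\<^esub>"
      using s snz b f_closed k.eval_PR[of "[s] \<otimes>\<^bsub>k.PR\<^esub> [s]" f b] k.eval_PR[of "[s]" "[s]" b] by simp
    then have "?q = [] \<or> w (\<phi> ?q) \<ge> 1" using k.root_alg_mult[OF q _ b] wq[OF q] by fastforce
    then have "w.ge 1 (\<phi> ?q)" using \<phi>_hom(4) by (auto simp: w.ge_def)
    then have "w.ge (2 * w (\<phi> [s]) + 1) (\<phi> [s] \<otimes> \<phi> [s] \<ominus> y \<otimes> y)"
      using s snz f_closed wc[of s] y_sq by (simp add: \<phi>_hom)
    then obtain v where v: "subfield_valuation K (carrier K) v" "\<And>a. \<lbrakk>a \<in> F; a \<noteq> \<zero>\<rbrakk> \<Longrightarrow> v a = w a"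
      using split_extension[of "\<phi> [s]"] s snz \<phi>_F \<phi>_nz two_nz wc[of "\<one>\<^bsub>k\<^esub> \<oplus>\<^bsub>k\<^esub> \<one>\<^bsub>k\<^esub>"] char_not_2 two_const
      by auto
    have "restrict v (carrier K - {\<zero>}) \<in> pts"
      using v wc \<phi>_F \<phi>_nz lb wl by (intro ptsI[of v "\<phi> (lin b)"]) auto
    moreover have "restrict v (carrier K - {\<zero>}) (\<phi> (lin b)) > 0" using v(2)[OF lb] wl lb by simp
    ultimately show ?thesis by blast
  qed
qed

text \<open>Extend minus the degree. With deg f = 2m, the monomial s x^m, where s^2 is the leading
  coefficient of f, is an approximate square root of f, because its square differs from f by a
  polynomial of lower degree. Here the even degree enters.\<close>

lemma exists_point_at_infinity: "\<exists>v\<in>pts. v (\<phi> (lin \<zero>\<^bsub>k\<^esub>)) < 0"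
proof -
  have "\<exists>w. subfield_valuation K F w \<and> (\<forall>q\<in>carrier k.PR - {[]}. w (\<phi> q) = - int (degree q))"
  proof (rule polynomial_valuation_extends)
    fix p q assume "p \<in> carrier k.PR" "q \<in> carrier k.PR" "p \<noteq> []" "q \<noteq> []"
    then have "degree (p \<otimes>\<^bsub>k.PR\<^esub> q) = degree p + degree q" by (rule k.degree_mult)
    then show "- int (degree (p \<otimes>\<^bsub>k.PR\<^esub> q)) = - int (degree p) + - int (degree q)" by linarith
    show "min (- int (degree p)) (- int (degree q)) \<le> - int (degree (p \<oplus>\<^bsub>k.PR\<^esub> q))"
      using k.degree_add[OF \<open>p \<in> carrier k.PR\<close> \<open>q \<in> carrier k.PR\<close>] by linarith
  qed
  then obtain w where w: "subfield_valuation K F w" and wq: "\<And>q. \<lbrakk>q \<in> carrier k.PR; q \<noteq> []\<rbrakk> \<Longrightarrow> w (\<phi> q) = - int (degree q)"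
    by blast
  interpret w: subfield_valuation K F w by (rule w)
  interpret valued_quadratic_extension K F y w by unfold_locales
  have wc: "w (\<phi> [c]) = 0" if "c \<in> carrier k" "c \<noteq> \<zero>\<^bsub>k\<^esub>" for c
    using wq[of "[c]"] that by simp
  have wl: "w (\<phi> (lin \<zero>\<^bsub>k\<^esub>)) = -1" using wq[OF k.PR_linear[OF k.zero_closed]] by simp
  have lb: "\<phi> (lin \<zero>\<^bsub>k\<^esub>) \<in> F" "\<phi> (lin \<zero>\<^bsub>k\<^esub>) \<noteq> \<zero>"
    by (rule \<phi>_F \<phi>_nz k.PR_linear[OF k.zero_closed] | simp only: list.distinct not_False_eq_True)+
  obtain m where m: "degree f = 2 * m" using f_even by (rule evenE)
  have lc: "lead_coeff f \<in> carrier k" "lead_coeff f \<noteq> \<zero>\<^bsub>k\<^esub>"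
    using f_closed f_nz by (auto simp: univ_poly_def polynomial_def)
  obtain s where s: "s \<in> carrier k" "s \<otimes>\<^bsub>k\<^esub> s = lead_coeff f" using k.exists_sqrt[OF lc(1)] by blast
  have snz: "s \<noteq> \<zero>\<^bsub>k\<^esub>" using s lc by auto
  let ?g = "k.monom s m"
  have g: "?g \<in> carrier k.PR" "?g \<noteq> []" "degree ?g = m" "lead_coeff ?g = s"
    using k.monom_is_polynomial[OF k.carrier_is_subring, of s m] s snz by (auto simp: univ_poly_carrier k.monom_def)
  have gg: "?g \<otimes>\<^bsub>k.PR\<^esub> ?g \<in> carrier k.PR" "?g \<otimes>\<^bsub>k.PR\<^esub> ?g \<noteq> []" "degree (?g \<otimes>\<^bsub>k.PR\<^esub> ?g) = degree f"
    using g m k.degree_mult[of ?g ?g] k.PR_mult_nz by auto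
  have "lead_coeff (?g \<otimes>\<^bsub>k.PR\<^esub> ?g) = lead_coeff f"
    using k.poly_mult_lead_coeff[OF k.carrier_is_subring, of ?g ?g] g s by (simp add: univ_poly_mult univ_poly_carrier)
  then have "?g \<otimes>\<^bsub>k.PR\<^esub> ?g \<ominus>\<^bsub>k.PR\<^esub> f = [] \<or> degree (?g \<otimes>\<^bsub>k.PR\<^esub> ?g \<ominus>\<^bsub>k.PR\<^esub> f) < degree f"
    using k.degree_minus_same_lead[OF gg(1,2) f_closed f_nz gg(3)] gg(3) by auto
  then have "w.ge (2 * w (\<phi> ?g) + 1) (\<phi> (?g \<otimes>\<^bsub>k.PR\<^esub> ?g \<ominus>\<^bsub>k.PR\<^esub> f))"
    using wq[of "?g \<otimes>\<^bsub>k.PR\<^esub> ?g \<ominus>\<^bsub>k.PR\<^esub> f"] wq[of ?g] g gg f_closed m \<phi>_hom(4)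
    by (cases "?g \<otimes>\<^bsub>k.PR\<^esub> ?g \<ominus>\<^bsub>k.PR\<^esub> f = []") (auto simp: w.ge_def)
  then have "w.ge (2 * w (\<phi> ?g) + 1) (\<phi> ?g \<otimes> \<phi> ?g \<ominus> y \<otimes> y)"
    using g(1) gg(1) f_closed y_sq by (simp add: \<phi>_hom)
  then obtain v where v: "subfield_valuation K (carrier K) v" "\<And>a. \<lbrakk>a \<in> F; a \<noteq> \<zero>\<rbrakk> \<Longrightarrow> v a = w a"
    using split_extension[of "\<phi> ?g"] g \<phi>_F \<phi>_nz two_nz wc[of "\<one>\<^bsub>k\<^esub> \<oplus>\<^bsub>k\<^esub> \<one>\<^bsub>k\<^esub>"] char_not_2 two_const
    by auto
  \<comment> \<open>The inverse of x is a uniformizer at infinity, and the extension does not change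
    values on F.\<close>
  have i: "inv (\<phi> (lin \<zero>\<^bsub>k\<^esub>)) \<in> F" "inv (\<phi> (lin \<zero>\<^bsub>k\<^esub>)) \<noteq> \<zero>" "w (inv (\<phi> (lin \<zero>\<^bsub>k\<^esub>))) = 1"
    using F_inv[OF lb] inv_nz[OF lb] w.w_inv[OF lb] wl by auto
  have "restrict v (carrier K - {\<zero>}) \<in> pts"
    using v wc \<phi>_F \<phi>_nz i by (intro ptsI[of v "inv (\<phi> (lin \<zero>\<^bsub>k\<^esub>))"]) auto
  moreover have "restrict v (carrier K - {\<zero>}) (\<phi> (lin \<zero>\<^bsub>k\<^esub>)) < 0" using v(2)[OF lb] wl lb by simp
  ultimately show ?thesis by blast
qed

text \<open>Descent on the degree of the denominator c of r = a/c. At a point over a root b of c,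
  the absence of a pole makes b a root of a as well, and x - b can be cancelled. Once c is constant,
  a point at infinity forces a to be constant too.\<close>

lemma regular_rational_function_is_constant:
  assumes r: "r \<in> F" "r \<noteq> \<zero>" and pos: "\<And>v. v \<in> pts \<Longrightarrow> v r \<ge> 0"
  shows "\<exists>c\<in>carrier k - {\<zero>\<^bsub>k\<^esub>}. r = \<phi> [c]"
proof -
  have "\<exists>c\<in>carrier k - {\<zero>\<^bsub>k\<^esub>}. r = \<phi> [c]"
    if "a \<in> carrier k.PR" "c \<in> carrier k.PR" "a \<noteq> []" "c \<noteq> []" "r \<otimes> \<phi> c = \<phi> a" for a c
    using that
  proof (induction "degree c" arbitrary: a c rule: less_induct)
    case less
    note ac = less.prems
    have vr: "v r + v (\<phi> c) = v (\<phi> a)" if "v \<in> pts" for v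
    proof -
      interpret v: subfield_valuation K "carrier K" v by (rule pts_valuation[OF that])
      show ?thesis using v.w_mult[of r "\<phi> c"] r ac \<phi>_nz by simp
    qed
    show ?case
    proof (cases "degree c = 0")
      case True
      obtain v where v: "v \<in> pts" "v (\<phi> (lin \<zero>\<^bsub>k\<^esub>)) < 0" using exists_point_at_infinity by blast
      have "v (\<phi> c) = 0" "v (\<phi> a) = int (degree a) * v (\<phi> (lin \<zero>\<^bsub>k\<^esub>))"
        using valuation_at_infinity[OF v(1) ac(2,4) _ v(2)] valuation_at_infinity[OF v(1) ac(1,3) _ v(2)] True by auto
      then have "int (degree a) * v (\<phi> (lin \<zero>\<^bsub>k\<^esub>)) \<ge> 0" using vr[OF v(1)] pos[OF v(1)] by simp
      then have "degree a = 0" using v(2) by (simp add: zero_le_mult_iff)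
      then obtain a' c' where a': "a = [a']" "c = [c']" using True ac by (cases a; cases c) auto
      then have c: "a' \<in> carrier k" "a' \<noteq> \<zero>\<^bsub>k\<^esub>" "c' \<in> carrier k" "c' \<noteq> \<zero>\<^bsub>k\<^esub>"
        using ac by (auto simp: univ_poly_def polynomial_def)
      then have i: "inv\<^bsub>k\<^esub> c' \<in> carrier k" "inv\<^bsub>k\<^esub> c' \<otimes>\<^bsub>k\<^esub> c' = \<one>\<^bsub>k\<^esub>" using k.field_Units by auto
      let ?d = "a' \<otimes>\<^bsub>k\<^esub> inv\<^bsub>k\<^esub> c'"
      have "inv\<^bsub>k\<^esub> c' \<noteq> \<zero>\<^bsub>k\<^esub>" using i c by auto
      then have d: "?d \<in> carrier k" "?d \<noteq> \<zero>\<^bsub>k\<^esub>" using c i k.integral_iff by auto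
      have "?d \<otimes>\<^bsub>k\<^esub> c' = a'" using c i by (simp add: k.m_assoc)
      then have "[?d] \<otimes>\<^bsub>k.PR\<^esub> c = a" using a' c by (simp add: univ_poly_mult)
      then have "\<phi> [?d] \<otimes> \<phi> c = \<phi> a" using d ac \<phi>_hom(1)[of "[?d]" c] by simp
      then have "\<phi> [?d] \<otimes> \<phi> c = r \<otimes> \<phi> c" using ac by simp
      then have "\<phi> [?d] = r" using m_rcancel[of "\<phi> c" "\<phi> [?d]" r] ac \<phi>_nz d r by simp
      then show ?thesis using d by blast
    next
      case False
      then obtain b c' where c': "b \<in> carrier k" "c' \<in> carrier k.PR" "c' \<noteq> []" "c = lin b \<otimes>\<^bsub>k.PR\<^esub> c'" "k.eval c b = \<zero>\<^bsub>k\<^esub>"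
        using k.exists_root_nonconstant[OF ac(2)] by auto
      obtain v where v: "v \<in> pts" "v (\<phi> (lin b)) > 0" using exists_point_over[OF c'(1)] by blast
      have "k.alg_mult c b \<ge> 1" by (rule k.root_alg_mult[OF ac(2,4) c'(1,5)])
      moreover have "v (\<phi> c) \<le> v (\<phi> a)" using vr[OF v(1)] pos[OF v(1)] by simp
      ultimately have "k.alg_mult a b \<ge> 1"
        using valuation_at_finite_point[OF v(1) ac(2,4) c'(1) v(2)] valuation_at_finite_point[OF v(1) ac(1,3) c'(1) v(2)] v(2)
        by (simp add: mult_le_cancel_right)
      then have "lin b pdivides\<^bsub>k\<^esub> a" using k.le_alg_mult_imp_pdivides[OF c'(1) ac(1), of 1] c'(1) by simp
      then obtain a' where a': "a' \<in> carrier k.PR" "a = lin b \<otimes>\<^bsub>k.PR\<^esub> a'" unfolding pdivides_def factor_def by blast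
      have "a' \<noteq> []" using a' ac(3) c'(1) P.r_null[of "lin b"] by (auto simp: univ_poly_zero)
      have "\<phi> (lin b) \<otimes> (r \<otimes> \<phi> c') = r \<otimes> (\<phi> (lin b) \<otimes> \<phi> c')"
        using r c' by (intro m_lcomm) simp_all
      also have "\<dots> = \<phi> (lin b) \<otimes> \<phi> a'" using ac(5) a' c'(1-4) by (simp add: \<phi>_hom)
      finally have "r \<otimes> \<phi> c' = \<phi> a'" using m_lcancel[of "\<phi> (lin b)" "r \<otimes> \<phi> c'" "\<phi> a'"] c'(1,2) a'(1) r \<phi>_nz by simp
      moreover have "degree c' < degree c" using c' k.degree_mult[of "lin b" c'] by simp
      ultimately show ?thesis using less.hyps[of c' a'] a' c' \<open>a' \<noteq> []\<close> by blast
    qed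
  qed
  then show ?thesis using F_nz_E[OF r] by metis
qed

lemma conj_pts: assumes v: "v \<in> pts" shows "(\<lambda>u\<in>carrier K - {\<zero>}. v (conj u)) \<in> pts"
proof -
  interpret v: subfield_valuation K "carrier K" v by (rule pts_valuation[OF v])
  obtain z where z: "z \<in> carrier K" "z \<noteq> \<zero>" "v z = 1" by (rule pts_surj[OF v])
  show ?thesis
  proof (rule ptsI[of "\<lambda>u. v (conj u)" "conj z"])
    show "subfield_valuation K (carrier K) (\<lambda>u. v (conj u))"
    proof (intro subfield_valuation.intro field_pair.intro subfield_valuation_axioms.intro field_axioms
      carrier_is_subfield)
      fix a b assume ab: "a \<in> carrier K" "a \<noteq> \<zero>" "b \<in> carrier K" "b \<noteq> \<zero>"
      then show "v (conj (a \<otimes> b)) = v (conj a) + v (conj b)"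
        by (simp add: conj_mult v.w_mult conj_nz)
      assume nz: "a \<oplus> b \<noteq> \<zero>"
      then have "conj (a \<oplus> b) \<noteq> \<zero>" using conj_nz[OF _ nz] ab by simp
      then show "min (v (conj a)) (v (conj b)) \<le> v (conj (a \<oplus> b))"
        using v.w_add[of "conj a" "conj b"] conj_nz ab by (simp add: conj_add)
    qed
    show "conj z \<in> carrier K" "conj z \<noteq> \<zero>" "v (conj (conj z)) = 1" using z by (auto simp: conj_nz conj_conj)
    show "v (conj (\<phi> [c])) = 0" if "c \<in> carrier k" "c \<noteq> \<zero>\<^bsub>k\<^esub>" for c
      using that by (simp add: conj_F \<phi>_F pts_const[OF v])
  qed
qed

lemma ramified_exists: "\<exists>b v. ramified b v"
proof -
  obtain b where "b \<in> carrier k" "k.alg_mult f b = 1" by (rule f_root)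
  then show ?thesis using exists_point_over[of b] unfolding ramified_def by blast
qed

text \<open>Write u = A + B y. The conjugate of u has no poles either, hence neither has 2 B y, nor
  B^2 f, which lies in k(x) and is therefore constant if B is nonzero. Then B y has value 0 at a
  ramified point, although y has value 1 there and B an even value.\<close>

lemma unit_function_in_F:
  assumes u: "u \<in> carrier K" "u \<noteq> \<zero>" and v0: "\<And>v. v \<in> pts \<Longrightarrow> v u = 0"
  shows "u \<in> F"
proof -
  let ?B = "im u"
  have B: "?B = \<zero>"
  proof (rule ccontr)
    assume B0: "?B \<noteq> \<zero>"
    have BF: "?B \<in> F" "?B \<in> carrier K" using u by auto
    have By: "?B \<otimes> y \<in> carrier K" "?B \<otimes> y \<noteq> \<zero>" using BF B0 y_nz integral_iff by auto
    have sq: "?B \<otimes> ?B \<otimes> (y \<otimes> y) = (?B \<otimes> y) \<otimes> (?B \<otimes> y)"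
      using BF(2) y_closed by algebra
    have v: "v (?B \<otimes> ?B \<otimes> (y \<otimes> y)) = 2 * v (?B \<otimes> y)" "v (?B \<otimes> y) \<ge> 0" if v: "v \<in> pts" for v
    proof -
      interpret v: subfield_valuation K "carrier K" v by (rule pts_valuation[OF v])
      show "v (?B \<otimes> ?B \<otimes> (y \<otimes> y)) = 2 * v (?B \<otimes> y)" using v.w_mult[OF By By] by (simp only: sq)
      have "v (conj u) = 0" using v0[OF conj_pts[OF v]] u by simp
      then have "v.ge 0 (u \<ominus> conj u)" using v0[OF v] u by (intro v.ge_minus) (auto simp: v.ge_def)
      moreover have "u \<ominus> conj u = (\<one> \<oplus> \<one>) \<otimes> (?B \<otimes> y)"
        unfolding u_minus_conj[OF u(1)] using BF(2) y_closed by algebra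
      ultimately have ge: "v.ge 0 ((\<one> \<oplus> \<one>) \<otimes> (?B \<otimes> y))" by (simp only:)
      have two: "\<one> \<oplus> \<one> \<in> carrier K" by (rule F_carr) (rule F_closed(3)[OF F_closed(2) F_closed(2)])
      have "v (\<one> \<oplus> \<one>) = 0" unfolding two_const using pts_const[OF v] char_not_2 by simp
      then have "v ((\<one> \<oplus> \<one>) \<otimes> (?B \<otimes> y)) = v (?B \<otimes> y)"
        using v.w_mult[OF two two_nz By] by linarith
      moreover have "(\<one> \<oplus> \<one>) \<otimes> (?B \<otimes> y) \<noteq> \<zero>" using integral[OF _ two By(1)] two_nz By(2) by blast
      ultimately show "v (?B \<otimes> y) \<ge> 0" using ge unfolding v.ge_def by linarith
    qed
    have "?B \<otimes> ?B \<otimes> (y \<otimes> y) \<in> F" "?B \<otimes> ?B \<otimes> (y \<otimes> y) \<noteq> \<zero>" using BF B0 y_nz by (simp_all add: integral_iff)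
    moreover have "v (?B \<otimes> ?B \<otimes> (y \<otimes> y)) \<ge> 0" if "v \<in> pts" for v using v[OF that] by simp
    ultimately obtain c where c: "c \<in> carrier k - {\<zero>\<^bsub>k\<^esub>}" "?B \<otimes> ?B \<otimes> (y \<otimes> y) = \<phi> [c]"
      using regular_rational_function_is_constant by blast
    obtain b v where r: "ramified b v" using ramified_exists by blast
    then have vp: "v \<in> pts" by (simp add: ramified_def)
    interpret v: subfield_valuation K "carrier K" v by (rule pts_valuation[OF vp])
    have "v (?B \<otimes> y) = 0" using v(1)[OF vp] c pts_const[OF vp] by auto
    moreover have "v (?B \<otimes> y) = v ?B + 1" using v.w_mult[of ?B y] BF B0 y_nz ramified_valuation(2)[OF r] by simp
    ultimately have "v ?B = -1" by linarith
    then show False using ramified_valuation(4)[OF r BF(1) B0] by simp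
  qed
  have "re u = u" using decomp[OF u(1)] re_F[OF u(1)] B by simp
  then show "u \<in> F" using re_F[OF u(1)] by simp
qed

text \<open>If twice a principal divisor is the divisor of a rational function of \<open>x\<close>, then a function
  \<open>h\<close> defining it has \<open>h\<^sup>2 \<in> k(x)\<close>, so \<open>h \<in> k(x)\<close> or \<open>h \<in> k(x) y\<close>.\<close>

lemma halved_principal_divisor_parity:
  assumes h: "h \<in> carrier K" "h \<noteq> \<zero>" and g: "g \<in> F" "g \<noteq> \<zero>"
    and eq: "\<And>v. v \<in> pts \<Longrightarrow> 2 * v h = v g"
    and ram: "ramified b v" "ramified b' v'"
  shows "even (v h) \<longleftrightarrow> even (v' h)"
proof -
  have gi: "inv g \<in> F" "inv g \<noteq> \<zero>" "g \<otimes> inv g = \<one>" using g F_inv inv_nz mult_inv by auto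
  \<comment> \<open>The quotient h^2/g has neither zeros nor poles, so it lies in k(x), and with it
    h^2.\<close>
  let ?u = "(h \<otimes> h) \<otimes> inv g"
  have u: "?u \<in> carrier K" "?u \<noteq> \<zero>" using h gi by (auto simp: integral_iff)
  have "\<And>v. v \<in> pts \<Longrightarrow> v ?u = 0"
  proof -
    fix v assume v: "v \<in> pts"
    interpret v: subfield_valuation K "carrier K" v by (rule pts_valuation[OF v])
    have "v ?u = (v h + v h) + - v g"
      using h g gi by (simp add: v.w_mult integral_iff v.w_inv)
    then show "v ?u = 0" using eq[OF v] by simp
  qed
  then have "?u \<in> F" by (rule unit_function_in_F[OF u])
  moreover have "?u \<otimes> g = h \<otimes> h" using h g gi by (simp add: m_assoc m_comm[of "inv g" g])
  ultimately have hh: "h \<otimes> h \<in> F" using F_closed(4)[of ?u g] g by simp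
  have pq: "re h \<in> F" "im h \<in> F" using h by auto
  \<comment> \<open>The y-coordinate of h^2 is twice the product of the coordinates of h. Since 2 is
    nonzero, one of them vanishes.\<close>
  have "im (h \<otimes> h) = \<zero>" using re_im_F(2)[OF hh] .
  then have "re h \<otimes> im h \<oplus> im h \<otimes> re h = \<zero>" using re_im_mult(2)[OF h(1) h(1)] by simp
  moreover have "re h \<otimes> im h \<oplus> im h \<otimes> re h = (\<one> \<oplus> \<one>) \<otimes> (re h \<otimes> im h)"
    using F_carr[OF pq(1)] F_carr[OF pq(2)] by algebra
  ultimately have "re h \<otimes> im h = \<zero>"
    using integral[of "\<one> \<oplus> \<one>" "re h \<otimes> im h"] two_nz pq by simp
  then consider "im h = \<zero>" | "re h = \<zero>" using integral[of "re h" "im h"] pq by auto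
  then show ?thesis
  proof cases
    case 1
    then have "re h = h" using decomp[OF h(1)] pq by simp
    then have "h \<in> F" using pq by simp
    then show ?thesis using ramified_valuation(4)[OF ram(1) _ h(2)] ramified_valuation(4)[OF ram(2) _ h(2)] by simp
  next
    case 2
    then have eq: "im h \<otimes> y = h" using decomp[OF h(1)] pq by simp
    then have nz: "im h \<noteq> \<zero>" using h by auto
    have "odd (v h)" if r: "ramified b v" for b v
    proof -
      have vp: "v \<in> pts" using r by (simp add: ramified_def)
      interpret v: subfield_valuation K "carrier K" v by (rule pts_valuation[OF vp])
      have "v h = v (im h) + 1" using v.w_mult[of "im h" y] eq nz pq y_nz ramified_valuation(2)[OF r] by simp
      then show ?thesis using ramified_valuation(4)[OF r pq(2) nz] by simp
    qed
    then show ?thesis using ram by blast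
  qed
qed

end

section \<open>Divisors supported on ramification points\<close>

lemma even_card_fixpoint_free_involution:
  assumes "finite A" "\<And>x. x \<in> A \<Longrightarrow> t x \<in> A" "\<And>x. x \<in> A \<Longrightarrow> t (t x) = x" "\<And>x. x \<in> A \<Longrightarrow> t x \<noteq> x"
  shows "even (card A)"
  using assms
proof (induction "card A" arbitrary: A rule: less_induct)
  case less
  show ?case
  proof (cases "A = {}")
    case False
    then obtain x where x: "x \<in> A" by blast
    let ?B = "A - {x, t x}"
    have tx: "t x \<in> A" "t x \<noteq> x" using less.prems x by auto
    have c: "card A = card ?B + 2"
      using card_Diff_subset[of "{x, t x}" A] card_mono[of A "{x, t x}"] less.prems(1) x tx by simp
    have "even (card ?B)"
    proof (rule less.hyps)
      show "card ?B < card A" using c by simp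
      fix z assume z: "z \<in> ?B"
      then have zA: "z \<in> A" "z \<noteq> x" "z \<noteq> t x" by auto
      have "t z \<noteq> x" using less.prems(3)[OF zA(1)] zA(3) by auto
      moreover have "t z \<noteq> t x" using less.prems(3)[OF zA(1)] less.prems(3)[OF x] zA(2) by auto
      ultimately show "t z \<in> ?B" using less.prems(2)[OF zA(1)] by simp
      show "t (t z) = z" "t z \<noteq> z" using less.prems zA by auto
    qed (use less.prems in simp)
    then show ?thesis using c by simp
  qed simp
qed

lemma divisor_degree_eq:
  assumes "finite S" "Poly_Mapping.keys D \<subseteq> S"
  shows "divisor_degree D = (\<Sum>v\<in>S. Poly_Mapping.lookup D v)"
  unfolding divisor_degree_def using assms by (intro sum.mono_neutral_left) (auto simp: in_keys_iff)

lemma divisor_degree_add: "divisor_degree (D + E) = divisor_degree D + divisor_degree E"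
proof -
  let ?S = "Poly_Mapping.keys D \<union> Poly_Mapping.keys E"
  have "Poly_Mapping.keys (D + E) \<subseteq> ?S" by (rule Poly_Mapping.keys_add)
  then show ?thesis
    using divisor_degree_eq[of ?S D] divisor_degree_eq[of ?S E] divisor_degree_eq[of ?S "D + E"]
    by (simp add: lookup_add sum.distrib)
qed

section \<open>Factors of f and the points over their roots\<close>

context hyperelliptic
begin

definition points_over where "points_over g = {v \<in> pts. v (\<phi> g) > 0}"

definition branch where "branch g \<longleftrightarrow> g \<in> carrier k.PR \<and> g \<noteq> [] \<and> (\<exists>h\<in>carrier k.PR. f = g \<otimes>\<^bsub>k.PR\<^esub> h)"

lemma branch_root:
  assumes "branch g" "a \<in># k.roots g"
  shows "a \<in> carrier k" "k.alg_mult g a = 1" "k.alg_mult f a = 1"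
proof -
  obtain h where g: "g \<in> carrier k.PR" "g \<noteq> []" and h: "h \<in> carrier k.PR" "f = g \<otimes>\<^bsub>k.PR\<^esub> h"
    using assms unfolding branch_def by blast
  have "h \<noteq> []" using h f_nz g P.r_null[of g] by (auto simp: univ_poly_zero)
  show a: "a \<in> carrier k" using assms(2) k.roots_mem_iff_is_root[OF g(1)] by (simp add: k.is_root_def)
  have "k.alg_mult g a > 0" using assms(2) k.alg_mult_eq_count_roots[OF g(1)] by simp
  moreover have "k.alg_mult f a = k.alg_mult g a + k.alg_mult h a"
    using k.alg_mult_mult[OF g(1) h(1) g(2) \<open>h \<noteq> []\<close>] h by simp
  ultimately show "k.alg_mult g a = 1" "k.alg_mult f a = 1" using f_simple[OF a] by simp_all
qed

lemma points_over_ramified: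
  assumes g: "branch g" and v: "v \<in> points_over g"
  shows "\<exists>a. a \<in># k.roots g \<and> ramified a v" "v (\<phi> g) = 2"
proof -
  have vp: "v \<in> pts" "v (\<phi> g) > 0" using v by (auto simp: points_over_def)
  have gc: "g \<in> carrier k.PR" "g \<noteq> []" using g by (auto simp: branch_def)
  have "\<exists>a\<in>#k.roots g. v (\<phi> (lin a)) > 0"
  proof (rule ccontr)
    assume "\<not> ?thesis"
    then have "(\<Sum>a\<in>#k.roots g. v (\<phi> (lin a))) \<le> (\<Sum>a\<in>#k.roots g. 0)"
      by (intro sum_mset_mono) (auto simp: not_less)
    then show False using valuation_of_polynomial[OF vp(1) gc] vp(2) by simp
  qed
  then obtain a where a: "a \<in># k.roots g" "v (\<phi> (lin a)) > 0" by blast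
  then have r: "ramified a v" using branch_root[OF g a(1)] vp by (simp add: ramified_def)
  then show "\<exists>a. a \<in># k.roots g \<and> ramified a v" using a by blast
  show "v (\<phi> g) = 2" using valuation_at_finite_point[OF vp(1) gc branch_root(1)[OF g a(1)] a(2)]
    branch_root(2)[OF g a(1)] ramified_valuation(1)[OF r] by simp
qed

lemma ramified_points_over:
  assumes g: "branch g" and a: "a \<in># k.roots g" "ramified a v"
  shows "v \<in> points_over g"
proof -
  have gc: "g \<in> carrier k.PR" "g \<noteq> []" using g by (auto simp: branch_def)
  have vp: "v \<in> pts" "v (\<phi> (lin a)) > 0" using a by (auto simp: ramified_def)
  then show ?thesis
    using valuation_at_finite_point[OF vp(1) gc branch_root(1)[OF g a(1)] vp(2)] branch_root(2)[OF g a(1)]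
    by (simp add: points_over_def)
qed

text \<open>Every root of g is a simple root of f and carries exactly one point, and different roots
  carry different points. The roots of g are simple, so there are as many as the degree.\<close>

lemma card_points_over:
  assumes g: "branch g" shows "finite (points_over g)" "card (points_over g) = degree g"
proof -
  have gc: "g \<in> carrier k.PR" "g \<noteq> []" using g by (auto simp: branch_def)
  let ?A = "set_mset (k.roots g)"
  define pt where "pt a = (THE v. ramified a v)" for a
  have ex: "ramified a (pt a)" if a: "a \<in> ?A" for a
  proof -
    obtain v where "ramified a v"
      using exists_point_over[OF branch_root(1)[OF g a]] branch_root[OF g a] unfolding ramified_def by blast
    then show ?thesis unfolding pt_def using theI[of "ramified a" v] ramified_unique by blast
  qed
  have "bij_betw pt ?A (points_over g)"
  proof (rule bij_betw_imageI)
    show "inj_on pt ?A"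
    proof (rule inj_onI, rule ccontr)
      fix a b assume ab: "a \<in> ?A" "b \<in> ?A" "pt a = pt b" "a \<noteq> b"
      then have "ramified a (pt a)" "ramified b (pt a)" using ex by metis+
      then show False using lin_pos[of "pt a" a b] ab(4) by (auto simp: ramified_def)
    qed
    show "pt ` ?A = points_over g"
    proof (intro equalityI subsetI)
      fix v assume "v \<in> points_over g"
      then obtain a where a: "a \<in> ?A" "ramified a v" using points_over_ramified[OF g] by blast
      then have "v = pt a" using ex ramified_unique by blast
      then show "v \<in> pt ` ?A" using a by blast
    next
      fix v assume "v \<in> pt ` ?A"
      then show "v \<in> points_over g" using ex ramified_points_over[OF g] by blast
    qed
  qed
  moreover have "card ?A = degree g"
  proof -
    have "size (k.roots g) = (\<Sum>a\<in>?A. count (k.roots g) a)" by (rule size_multiset_overloaded_eq)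
    also have "\<dots> = (\<Sum>a\<in>?A. 1)" using branch_root(2)[OF g] k.alg_mult_eq_count_roots[OF gc(1)] by simp
    finally show ?thesis using k.roots_over_carrier[OF gc(1)] by (simp add: k.splitted_def)
  qed
  ultimately show "finite (points_over g)" "card (points_over g) = degree g"
    using bij_betw_finite bij_betw_same_card by fastforce+
qed

text \<open>The term with \<open>min\<close> vanishes at finite points and is the order of x at
  points over infinity. The pole of g there is thus proportional to its degree, which lets the poles
  of two such functions cancel by matching degrees.\<close>

lemma valuation_branch:
  assumes g: "branch g" and v: "v \<in> pts"
  shows "v (\<phi> g) = (if v \<in> points_over g then 2 else 0) + int (degree g) * min 0 (v (\<phi> (lin \<zero>\<^bsub>k\<^esub>)))"
proof (cases "v \<in> points_over g")
  case True
  then obtain a where a: "ramified a v" using points_over_ramified(1)[OF g] by blast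
  have "\<not> v (\<phi> (lin \<zero>\<^bsub>k\<^esub>)) < 0"
  proof
    assume "v (\<phi> (lin \<zero>\<^bsub>k\<^esub>)) < 0"
    then have "v (\<phi> (lin a)) < 0" using lin_neg[OF v _ k.zero_closed] a by (simp add: ramified_def)
    then show False using a by (simp add: ramified_def)
  qed
  then show ?thesis using points_over_ramified(2)[OF g True] True by simp
next
  case False
  have gc: "g \<in> carrier k.PR" "g \<noteq> []" using g by (auto simp: branch_def)
  show ?thesis
  proof (cases "v (\<phi> (lin \<zero>\<^bsub>k\<^esub>)) < 0")
    case True
    then show ?thesis using False valuation_at_infinity[OF v gc k.zero_closed True] by simp
  next
    case nn: False
    have "v (\<phi> (lin a)) \<ge> 0" if "a \<in># k.roots g" for a
      using lin_neg[OF v k.zero_closed branch_root(1)[OF g that]] nn by linarith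
    then have "(\<Sum>a\<in>#k.roots g. 0) \<le> (\<Sum>a\<in>#k.roots g. v (\<phi> (lin a)))"
      by (intro sum_mset_mono) auto
    then have "v (\<phi> g) \<ge> 0" using valuation_of_polynomial[OF v gc] by simp
    then show ?thesis using False nn v by (simp add: points_over_def)
  qed
qed

text \<open>A common point would lie over a common root of g and h, whose multiplicity in f would
  then be at least 2.\<close>

lemma points_over_disjoint:
  assumes g: "branch g" "branch h" and le: "\<And>a. k.alg_mult g a + k.alg_mult h a \<le> k.alg_mult f a"
  shows "points_over g \<inter> points_over h = {}"
proof (rule ccontr)
  assume "\<not> ?thesis"
  then obtain v where v: "v \<in> points_over g" "v \<in> points_over h" by blast
  obtain a b where ab: "a \<in># k.roots g" "ramified a v" "b \<in># k.roots h" "ramified b v"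
    using points_over_ramified(1)[OF g(1) v(1)] points_over_ramified(1)[OF g(2) v(2)] by blast
  then have "a = b" using lin_pos[of v a b] by (auto simp: ramified_def)
  then show False using le[of a] branch_root[OF g(1) ab(1)] branch_root[OF g(2) ab(3)] by simp
qed

text \<open>For a factor g of f this is half the divisor of zeros of
  \<open>\<phi> g\<close>.\<close>

definition branch_divisor :: "'a list \<Rightarrow> (('b \<Rightarrow> int) \<Rightarrow>\<^sub>0 int)" where
  "branch_divisor g = (\<Sum>v\<in>points_over g. frag_of v)"

lemma lookup_branch_divisor:
  assumes "branch g"
  shows "Poly_Mapping.lookup (branch_divisor g) v = (if v \<in> points_over g then 1 else 0)"
proof -
  have "Poly_Mapping.lookup (branch_divisor g) v = (\<Sum>u\<in>points_over g. Poly_Mapping.lookup (frag_of u) v)"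
    unfolding branch_divisor_def by (rule lookup_sum)
  also have "\<dots> = (\<Sum>u\<in>points_over g. if u = v then 1 else 0)"
    by (intro sum.cong) (auto simp: lookup_single when_def)
  finally show ?thesis using card_points_over(1)[OF assms] by simp
qed

lemma keys_branch_divisor: assumes "branch g" shows "Poly_Mapping.keys (branch_divisor g) = points_over g"
  using lookup_branch_divisor[OF assms] by (auto simp: in_keys_iff split: if_splits)

lemma divisor_degree_branch: assumes "branch g" shows "divisor_degree (branch_divisor g) = int (degree g)"
  unfolding divisor_degree_def keys_branch_divisor[OF assms]
  using lookup_branch_divisor[OF assms] card_points_over(2)[OF assms] by simp

section \<open>The action of automorphisms on points and divisors\<close>

definition aut where "aut \<tau> \<longleftrightarrow> \<tau> \<in> ring_iso K K \<and> \<tau> ` constants = constants"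

lemma aut_pts:
  assumes s: "aut \<tau>" and v: "v \<in> pts"
  shows "compose (carrier K - {\<zero>}) v \<tau> \<in> pts"
proof -
  have hom: "\<tau> \<in> ring_hom K K" and bij: "bij_betw \<tau> (carrier K) (carrier K)" and im: "\<tau> ` constants = constants"
    using s by (auto simp: aut_def ring_iso_def)
  interpret H: ring_hom_ring K K \<tau> by (rule ring_hom_ringI2[OF ring_axioms ring_axioms hom])
  interpret v: subfield_valuation K "carrier K" v by (rule pts_valuation[OF v])
  let ?C = "carrier K - {\<zero>}"
  have inj: "inj_on \<tau> (carrier K)" using bij by (rule bij_betw_imp_inj_on)
  have nz: "\<tau> u \<noteq> \<zero>" if "u \<in> carrier K" "u \<noteq> \<zero>" for u
    using that inj_onD[OF inj, of u \<zero>] H.hom_zero by auto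
  have "\<tau> ` ?C = ?C"
    using bij_betw_imp_surj_on[OF bij] inj by (subst inj_on_image_set_diff[OF inj]) (auto simp: H.hom_zero)
  moreover have "v ` ?C = UNIV" using v unfolding curve_points_def by blast
  ultimately have "(\<lambda>u. v (\<tau> u)) ` ?C = UNIV" using image_image[of v \<tau> ?C] by simp
  then have "compose ?C v \<tau> ` ?C = UNIV" by (simp add: compose_def)
  moreover have "v (\<tau> x) = 0" if "x \<in> constants - {\<zero>}" "x \<in> carrier K" for x
    using that v im nz unfolding curve_points_def by blast
  moreover have "constants \<subseteq> carrier K"
  proof
    fix x assume "x \<in> constants"
    then obtain c where "c \<in> carrier k" "x = \<phi> (k.poly_of_const c)" unfolding constants_def by blast
    then show "x \<in> carrier K" by (cases "c = \<zero>\<^bsub>k\<^esub>") (auto simp: k.poly_of_const_def)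
  qed
  moreover have "v (\<tau> (a \<otimes> b)) = v (\<tau> a) + v (\<tau> b)"
    "a \<oplus> b \<noteq> \<zero> \<Longrightarrow> min (v (\<tau> a)) (v (\<tau> b)) \<le> v (\<tau> (a \<oplus> b))"
    if "a \<in> ?C" "b \<in> ?C" for a b
    using that nz v.w_mult[of "\<tau> a" "\<tau> b"] v.w_add[of "\<tau> a" "\<tau> b"] nz[of "a \<oplus> b"] by auto
  ultimately show ?thesis
    unfolding curve_points_def by (auto simp: compose_def integral_iff subset_iff)
qed

text \<open>The automorphism may move the individual points. But it fixes \<open>\<phi> g\<close>,
  so it maps the finite set of zeros of this function injectively into itself, hence permutes
  it.\<close>

lemma aut_branch_divisor:
  assumes s: "aut \<tau>" and g: "branch g" and fix_g: "\<tau> (\<phi> g) = \<phi> g"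
  shows "divisor_action K \<tau> (branch_divisor g) = branch_divisor g"
proof -
  let ?C = "carrier K - {\<zero>}" and ?S = "\<lambda>v. compose (carrier K - {\<zero>}) v \<tau>"
  have bij: "bij_betw \<tau> (carrier K) (carrier K)" and hom: "\<tau> \<in> ring_hom K K" using s by (auto simp: aut_def ring_iso_def)
  have surj: "\<exists>u'\<in>?C. u = \<tau> u'" if "u \<in> ?C" for u
  proof -
    interpret H: ring_hom_ring K K \<tau> by (rule ring_hom_ringI2[OF ring_axioms ring_axioms hom])
    have "u \<in> \<tau> ` carrier K" using that bij_betw_imp_surj_on[OF bij] by simp
    then show ?thesis using that H.hom_zero by blast
  qed
  have gc: "\<phi> g \<in> ?C" using g \<phi>_nz by (auto simp: branch_def)
  have maps: "?S ` points_over g \<subseteq> points_over g"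
    using aut_pts[OF s] gc fix_g by (auto simp: points_over_def compose_def)
  have inj: "inj_on ?S (points_over g)"
  proof (rule inj_onI)
    fix v v' assume v: "v \<in> points_over g" "v' \<in> points_over g" "?S v = ?S v'"
    show "v = v'"
    proof (rule pts_eqI)
      fix u assume "u \<in> carrier K" "u \<noteq> \<zero>"
      then obtain u' where u': "u' \<in> ?C" "u = \<tau> u'" using surj by blast
      then show "v u = v' u" using fun_cong[OF v(3), of u'] by (simp add: compose_def)
    qed (use v in \<open>auto simp: points_over_def\<close>)
  qed
  have im: "?S ` points_over g = points_over g"
    by (rule endo_inj_surj[OF card_points_over(1)[OF g] maps inj])
  have "divisor_action K \<tau> (branch_divisor g) = (\<Sum>v\<in>points_over g. frag_of (?S v))"
    unfolding divisor_action_def branch_divisor_def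
    by (simp only: frag_extend_sum[OF card_points_over(1)[OF g]] o_def frag_extend_of)
  also have "\<dots> = sum frag_of (?S ` points_over g)" by (simp add: sum.reindex[OF inj])
  finally show ?thesis by (simp add: im branch_divisor_def)
qed

end

section \<open>Two-torsion classes\<close>

text \<open>Both sides are the least common multiple. This relation makes the degrees of the torsion
  divisors vanish and cancels the poles at infinity.\<close>

lemma div_gcd_mult: "(b::nat) div gcd a b * a = a div gcd a b * b"
  using dvd_div_mult[of "gcd a b" b a] dvd_div_mult[of "gcd a b" a b] by (simp add: mult.commute)

context hyperelliptic
begin

abbreviation "DG \<equiv> divisor_group K constants"
abbreviation "PD \<equiv> principal_divisors K constants"

lemma DG_simps [simp]: "D \<in> carrier DG \<longleftrightarrow> Poly_Mapping.keys D \<subseteq> pts" "D \<otimes>\<^bsub>DG\<^esub> E = D + E" "\<one>\<^bsub>DG\<^esub> = 0"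
  by (simp_all add: divisor_group_def)

lemma PD_D: assumes "D \<in> PD" shows "Poly_Mapping.keys D \<subseteq> pts"
  "\<exists>h\<in>carrier K - {\<zero>}. \<forall>v\<in>pts. Poly_Mapping.lookup D v = v h"
  using assms by (auto simp: principal_divisors_def)

lemma PD_I: assumes "Poly_Mapping.keys D \<subseteq> pts" "h \<in> carrier K" "h \<noteq> \<zero>"
    "\<And>v. v \<in> pts \<Longrightarrow> Poly_Mapping.lookup D v = v h"
  shows "D \<in> PD"
  using assms by (auto simp: principal_divisors_def)

lemma PD_add: assumes "D \<in> PD" "E \<in> PD" shows "D + E \<in> PD"
proof -
  obtain h where h: "h \<in> carrier K" "h \<noteq> \<zero>" "\<And>v. v \<in> pts \<Longrightarrow> Poly_Mapping.lookup D v = v h"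
    using PD_D(2)[OF assms(1)] by blast
  obtain h' where h': "h' \<in> carrier K" "h' \<noteq> \<zero>" "\<And>v. v \<in> pts \<Longrightarrow> Poly_Mapping.lookup E v = v h'"
    using PD_D(2)[OF assms(2)] by blast
  show ?thesis
  proof (rule PD_I)
    show "Poly_Mapping.keys (D + E) \<subseteq> pts"
      using Poly_Mapping.keys_add[of D E] PD_D(1)[OF assms(1)] PD_D(1)[OF assms(2)] by blast
    show "h \<otimes> h' \<in> carrier K" "h \<otimes> h' \<noteq> \<zero>" using h h' by (auto simp: integral_iff)
    fix v assume v: "v \<in> pts"
    interpret v: subfield_valuation K "carrier K" v by (rule pts_valuation[OF v])
    show "Poly_Mapping.lookup (D + E) v = v (h \<otimes> h')" using h h' v v.w_mult[of h h'] by (simp add: lookup_add)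
  qed
qed

lemma PD_uminus: assumes "D \<in> PD" shows "- D \<in> PD"
proof -
  obtain h where h: "h \<in> carrier K" "h \<noteq> \<zero>" "\<And>v. v \<in> pts \<Longrightarrow> Poly_Mapping.lookup D v = v h"
    using PD_D(2)[OF assms(1)] by blast
  show ?thesis
  proof (rule PD_I)
    show "Poly_Mapping.keys (- D) \<subseteq> pts" using PD_D(1)[OF assms] by simp
    show "inv h \<in> carrier K" "inv h \<noteq> \<zero>" using h mult_inv[of h] by auto
    fix v assume v: "v \<in> pts"
    interpret v: subfield_valuation K "carrier K" v by (rule pts_valuation[OF v])
    show "Poly_Mapping.lookup (- D) v = v (inv h)" using h v v.w_inv[of h] by simp
  qed
qed

lemma PD_zero: "0 \<in> PD"
proof (rule PD_I[of _ \<one>])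
  fix v assume v: "v \<in> pts"
  interpret v: subfield_valuation K "carrier K" v by (rule pts_valuation[OF v])
  show "Poly_Mapping.lookup 0 v = v \<one>" using v.w_one by simp
qed auto

text \<open>Translation of a divisor class by the class of D, carried out on the coset
  itself.\<close>

definition shift :: "(('b \<Rightarrow> int) \<Rightarrow>\<^sub>0 int) \<Rightarrow> (('b \<Rightarrow> int) \<Rightarrow>\<^sub>0 int) set \<Rightarrow> (('b \<Rightarrow> int) \<Rightarrow>\<^sub>0 int) set" where
  "shift D c = (\<lambda>d. d + D) ` c"

lemma Pic_carrier: "c \<in> carrier (Pic K constants) \<longleftrightarrow> (\<exists>d. Poly_Mapping.keys d \<subseteq> pts \<and> c = shift d PD)"
proof -
  have "PD #>\<^bsub>DG\<^esub> d = shift d PD" for d by (auto simp: r_coset_def shift_def)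
  then have "carrier (Pic K constants) = (\<Union>d\<in>carrier DG. {shift d PD})"
    by (simp add: Pic_def FactGroup_def RCOSETS_def)
  then show ?thesis by (simp only: UN_iff singleton_iff Bex_def DG_simps)
qed

lemma shift_shift: "shift D (shift E c) = shift (E + D) c"
  by (simp add: shift_def image_image add.assoc)

lemma shift_eq_iff: "shift D PD = shift E PD \<longleftrightarrow> D - E \<in> PD"
proof
  assume "shift D PD = shift E PD"
  moreover have "D \<in> shift D PD" using PD_zero by (auto simp: shift_def intro: image_eqI[of _ _ 0])
  ultimately obtain n where "n \<in> PD" "D = n + E" by (auto simp: shift_def)
  then show "D - E \<in> PD" by simp
next
  have *: "shift D PD \<subseteq> shift E PD" if "D - E \<in> PD" for D E
  proof
    fix x assume "x \<in> shift D PD"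
    then obtain n where n: "n \<in> PD" "x = n + D" by (auto simp: shift_def)
    then have "x = (n + (D - E)) + E" by simp
    then show "x \<in> shift E PD" using PD_add[OF n(1) that] unfolding shift_def by (rule image_eqI)
  qed
  assume "D - E \<in> PD"
  moreover from this have "E - D \<in> PD" using PD_uminus by fastforce
  ultimately show "shift D PD = shift E PD" using * by blast
qed

lemma shift_Pic_eq_iff:
  assumes "c \<in> carrier (Pic K constants)" shows "shift D c = shift E c \<longleftrightarrow> D - E \<in> PD"
proof -
  obtain d where d: "c = shift d PD" using assms Pic_carrier by blast
  have "(d + D) - (d + E) = D - E" by simp
  then show ?thesis unfolding d shift_shift shift_eq_iff by (simp only:)
qed

lemma shift_zero: "shift 0 c = c" by (simp add: shift_def)

definition invariant_classes where
  "invariant_classes S = {c \<in> Pic0 K constants. \<forall>\<tau>\<in>S. divisor_action K \<tau> ` c = c}"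

text \<open>Invariance is asked of the divisor rather than of its class, so that adding D commutes
  with the action already on divisors.\<close>

definition two_torsion_rep where
  "two_torsion_rep S D \<longleftrightarrow> Poly_Mapping.keys D \<subseteq> pts \<and> divisor_degree D = 0 \<and> D + D \<in> PD \<and>
     (\<forall>\<tau>\<in>S. divisor_action K \<tau> D = D)"

lemma shift_invariant_classes:
  assumes c: "c \<in> invariant_classes S" and D: "two_torsion_rep S D"
  shows "shift D c \<in> invariant_classes S"
  unfolding invariant_classes_def Pic0_def
proof (intro CollectI conjI ballI)
  obtain d where d: "Poly_Mapping.keys d \<subseteq> pts" "c = shift d PD"
    using c by (auto simp: invariant_classes_def Pic0_def Pic_carrier)
  then have "shift D c = shift (d + D) PD" by (simp add: shift_shift)
  moreover have "Poly_Mapping.keys (d + D) \<subseteq> pts"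
    using Poly_Mapping.keys_add[of d D] d D by (auto simp: two_torsion_rep_def)
  ultimately show "shift D c \<in> carrier (Pic K constants)" using Pic_carrier by blast
  obtain E where "E \<in> c" "divisor_degree E = 0" using c by (auto simp: invariant_classes_def Pic0_def)
  then show "\<exists>D\<in>shift D c. divisor_degree D = 0"
    using D by (auto simp: shift_def two_torsion_rep_def divisor_degree_add)
next
  fix \<tau> assume s: "\<tau> \<in> S"
  have "divisor_action K \<tau> (d + D) = divisor_action K \<tau> d + D" for d
    using D s by (simp add: divisor_action_def two_torsion_rep_def frag_extend_add)
  then have "divisor_action K \<tau> ` shift D c = shift D (divisor_action K \<tau> ` c)"
    by (simp add: shift_def image_image)
  then show "divisor_action K \<tau> ` shift D c = shift D c" using c s by (simp add: invariant_classes_def)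
qed

lemma not_prime_card_invariant_classes:
  assumes D: "two_torsion_rep S D" "D \<notin> PD" and E: "two_torsion_rep S E" "E \<notin> PD" and DE: "D - E \<notin> PD"
  shows "\<not> Factorial_Ring.prime (card (invariant_classes S))"
proof
  let ?J = "invariant_classes S"
  assume prime: "Factorial_Ring.prime (card ?J)"
  \<comment> \<open>Primality supplies both finiteness and nonemptiness, because an infinite set has
    cardinality 0.\<close>
  then have "card ?J > 0" by (rule prime_gt_0_nat)
  then have fin: "finite ?J" and ne: "?J \<noteq> {}" by (auto simp: card_gt_0_iff)
  have Pic: "c \<in> carrier (Pic K constants)" if "c \<in> ?J" for c
    using that by (simp add: invariant_classes_def Pic0_def)
  have "even (card ?J)"
  proof (rule even_card_fixpoint_free_involution[of ?J "shift D"])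
    fix c assume c: "c \<in> ?J"
    show "shift D c \<in> ?J" by (rule shift_invariant_classes[OF c D(1)])
    show "shift D (shift D c) = c"
      using shift_Pic_eq_iff[OF Pic[OF c], of "D + D" 0] D(1) by (simp add: shift_shift shift_zero two_torsion_rep_def)
    show "shift D c \<noteq> c" using shift_Pic_eq_iff[OF Pic[OF c], of D 0] D(2) by (simp add: shift_zero)
  qed (rule fin)
  then have "card ?J = 2" using prime by (metis prime_odd_nat prime_ge_2_nat le_neq_implies_less)
  obtain c where c: "c \<in> ?J" using ne by blast
  have "{c, shift D c, shift E c} \<subseteq> ?J" using c shift_invariant_classes D E by simp
  then have "card {c, shift D c, shift E c} \<le> card ?J" by (rule card_mono[OF fin])
  moreover have "card {c, shift D c, shift E c} = 3"
    using shift_Pic_eq_iff[OF Pic[OF c], of D 0] shift_Pic_eq_iff[OF Pic[OF c], of E 0]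
      shift_Pic_eq_iff[OF Pic[OF c], of D E] D E DE by (simp add: shift_zero eq_commute[of c])
  ultimately show False using \<open>card ?J = 2\<close> by linarith
qed

definition branch_diff where
  "branch_diff g h = frag_cmul (int (degree h div gcd (degree g) (degree h))) (branch_divisor g)
     - frag_cmul (int (degree g div gcd (degree g) (degree h))) (branch_divisor h)"

text \<open>The function of x whose divisor is twice \<open>branch_diff g h\<close>.\<close>

definition branch_fun where
  "branch_fun g h = \<phi> g [^] (degree h div gcd (degree g) (degree h))
     \<otimes> inv (\<phi> h [^] (degree g div gcd (degree g) (degree h)))"

lemma branch_fun_F: assumes "branch g" "branch h"
  shows "branch_fun g h \<in> F" "branch_fun g h \<noteq> \<zero>"
proof -
  have pw: "\<phi> q [^] (n::nat) \<in> F \<and> \<phi> q [^] n \<noteq> \<zero>" if "branch q" for q n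
  proof -
    have q: "\<phi> q \<in> F" "\<phi> q \<noteq> \<zero>" using that \<phi>_F \<phi>_nz by (auto simp: branch_def)
    show ?thesis
    proof (induction n)
      case (Suc n) then show ?case using q F_closed(4)[of "\<phi> q [^] n" "\<phi> q"] by (simp add: integral_iff)
    qed simp
  qed
  show "branch_fun g h \<in> F" "branch_fun g h \<noteq> \<zero>"
    unfolding branch_fun_def using pw[OF assms(1)] pw[OF assms(2)] F_inv inv_nz F_closed(4)
    by (auto simp: integral_iff)
qed

text \<open>The two powers have equal degree as polynomials in x, so their contributions at infinity
  cancel. What remains are the double zeros and poles at the points over the roots of g and
  h.\<close>

lemma valuation_branch_fun:
  assumes g: "branch g" and h: "branch h" and v: "v \<in> pts"
  shows "v (branch_fun g h) = 2 * Poly_Mapping.lookup (branch_diff g h) v"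
proof -
  interpret v: subfield_valuation K "carrier K" v by (rule pts_valuation[OF v])
  define d where "d = gcd (degree g) (degree h)"
  let ?m = "degree h div d" and ?n = "degree g div d"
  have q: "\<phi> g \<in> carrier K" "\<phi> g \<noteq> \<zero>" "\<phi> h \<in> carrier K" "\<phi> h \<noteq> \<zero>" using g h \<phi>_nz by (auto simp: branch_def)
  have "?m * degree g = ?n * degree h"
    unfolding d_def by (rule div_gcd_mult)
  then have mn: "int ?m * int (degree g) = int ?n * int (degree h)" by (simp only: of_nat_mult[symmetric])
  have A: "v (\<phi> g [^] ?m) = int ?m * v (\<phi> g)" "\<phi> g [^] ?m \<in> carrier K" "\<phi> g [^] ?m \<noteq> \<zero>"
    and B: "v (\<phi> h [^] ?n) = int ?n * v (\<phi> h)" "\<phi> h [^] ?n \<in> carrier K" "\<phi> h [^] ?n \<noteq> \<zero>"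
    using v.w_pow[OF q(1,2), of ?m] v.w_pow[OF q(3,4), of ?n] by blast+
  have "v (branch_fun g h) = int ?m * v (\<phi> g) - int ?n * v (\<phi> h)"
    unfolding branch_fun_def d_def[symmetric] v.w_mult[OF A(2,3) v.F_inv[OF B(2,3)] v.inv_nz[OF B(2,3)]]
      v.w_inv[OF B(2,3)] A(1) B(1) by linarith
  also have "\<dots> = int ?m * (if v \<in> points_over g then 2 else 0) - int ?n * (if v \<in> points_over h then 2 else 0)
     + (int ?m * int (degree g) - int ?n * int (degree h)) * min 0 (v (\<phi> (lin \<zero>\<^bsub>k\<^esub>)))"
    unfolding valuation_branch[OF g v] valuation_branch[OF h v] by (simp add: algebra_simps)
  also have "\<dots> = 2 * Poly_Mapping.lookup (branch_diff g h) v"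
    unfolding mn branch_diff_def d_def[symmetric]
    by (simp add: lookup_minus lookup_branch_divisor[OF g] lookup_branch_divisor[OF h])
  finally show ?thesis .
qed

lemma keys_branch_diff: assumes "branch g" "branch h" shows "Poly_Mapping.keys (branch_diff g h) \<subseteq> pts"
proof -
  have "Poly_Mapping.keys (branch_diff g h) \<subseteq> points_over g \<union> points_over h"
    unfolding branch_diff_def using keys_diff keys_branch_divisor[OF assms(1)] keys_branch_divisor[OF assms(2)]
    by (metis (no_types, lifting) Un_mono keys_cmul order_trans)
  then show ?thesis by (auto simp: points_over_def)
qed

lemma two_torsion_branch_diff:
  assumes g: "branch g" and h: "branch h" and S: "\<And>\<tau>. \<tau> \<in> S \<Longrightarrow> aut \<tau> \<and> \<tau> (\<phi> g) = \<phi> g \<and> \<tau> (\<phi> h) = \<phi> h"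
  shows "two_torsion_rep S (branch_diff g h)"
  unfolding two_torsion_rep_def
proof (intro conjI ballI)
  show keys: "Poly_Mapping.keys (branch_diff g h) \<subseteq> pts" by (rule keys_branch_diff[OF g h])
  define d where "d = gcd (degree g) (degree h)"
  have "degree h div d * degree g = degree g div d * degree h"
    unfolding d_def by (rule div_gcd_mult)
  then have mn: "int (degree h div d) * int (degree g) = int (degree g div d) * int (degree h)" by (simp only: of_nat_mult[symmetric])
  have cmul: "divisor_degree (frag_cmul m D) = m * divisor_degree D" for m and D :: "('b \<Rightarrow> int) \<Rightarrow>\<^sub>0 int"
    using divisor_degree_eq[of "Poly_Mapping.keys D" "frag_cmul m D"] keys_cmul[of m D]
    by (simp add: divisor_degree_def sum_distrib_left)
  have "branch_diff g h = frag_cmul (int (degree h div d)) (branch_divisor g) + frag_cmul (- int (degree g div d)) (branch_divisor h)"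
    unfolding branch_diff_def d_def[symmetric] by simp
  then show "divisor_degree (branch_diff g h) = 0"
    using mn by (simp add: divisor_degree_add cmul divisor_degree_branch[OF g] divisor_degree_branch[OF h] del: minus_frag_cmul)
  show "branch_diff g h + branch_diff g h \<in> PD"
  proof (rule PD_I)
    show "Poly_Mapping.keys (branch_diff g h + branch_diff g h) \<subseteq> pts"      by (rule order_trans[OF Poly_Mapping.keys_add Un_least[OF keys keys]])
    show "branch_fun g h \<in> carrier K" "branch_fun g h \<noteq> \<zero>" using branch_fun_F[OF g h] by auto
    show "\<And>v. v \<in> pts \<Longrightarrow> Poly_Mapping.lookup (branch_diff g h + branch_diff g h) v = v (branch_fun g h)"
      using valuation_branch_fun[OF g h] by (simp add: lookup_add)
  qed
  fix \<tau> assume "\<tau> \<in> S"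
  then show "divisor_action K \<tau> (branch_diff g h) = branch_diff g h"
    using aut_branch_divisor[of \<tau> g] aut_branch_divisor[of \<tau> h] S g h
    by (simp add: branch_diff_def divisor_action_def frag_extend_diff frag_extend_cmul)
qed

text \<open>Used in contrapositive form: an odd coefficient at one ramification point and an even
  one at another show that D is not principal.\<close>

lemma not_principal:
  assumes D: "D \<in> PD" "\<And>v. v \<in> pts \<Longrightarrow> 2 * Poly_Mapping.lookup D v = v G" and G: "G \<in> F" "G \<noteq> \<zero>"
    and g: "branch g" "branch g'" "v \<in> points_over g" "v' \<in> points_over g'"
  shows "even (Poly_Mapping.lookup D v) \<longleftrightarrow> even (Poly_Mapping.lookup D v')"
proof -
  obtain h where h: "h \<in> carrier K" "h \<noteq> \<zero>" "\<And>v. v \<in> pts \<Longrightarrow> Poly_Mapping.lookup D v = v h"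
    using PD_D(2)[OF D(1)] by blast
  obtain a a' where "ramified a v" "ramified a' v'"
    using points_over_ramified(1)[OF g(1,3)] points_over_ramified(1)[OF g(2,4)] by blast
  then have "even (v h) \<longleftrightarrow> even (v' h)"
    using D(2) h(3) by (intro halved_principal_divisor_parity[OF h(1,2) G]) auto
  then show ?thesis using h(3) g(3,4) by (simp add: points_over_def)
qed

text \<open>The two multipliers are coprime, so one of them is odd. By disjointness it is, up to
  sign, the coefficient at every point over the corresponding factor.\<close>

lemma odd_coefficient:
  assumes g: "branch g" "branch h" and pos: "degree g > 0" "degree h > 0" and dis: "points_over g \<inter> points_over h = {}"
  shows "\<exists>v\<in>points_over g \<union> points_over h. odd (Poly_Mapping.lookup (branch_diff g h) v)"
proof -
  define d where "d = gcd (degree g) (degree h)"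
  have "coprime (degree g div d) (degree h div d)" using pos unfolding d_def by (intro div_gcd_coprime) auto
  then have "odd (degree g div d) \<or> odd (degree h div d)" by (meson coprime_def odd_one)
  moreover obtain v w where v: "v \<in> points_over g" "w \<in> points_over h"
    using card_points_over(2)[OF g(1)] card_points_over(2)[OF g(2)] pos by (metis card.empty ex_in_conv less_irrefl)
  moreover have "v \<notin> points_over h" "w \<notin> points_over g" using v dis by auto
  ultimately show ?thesis unfolding branch_diff_def d_def[symmetric]
    using lookup_branch_divisor[OF g(1)] lookup_branch_divisor[OF g(2)] by (auto simp: lookup_minus)
qed

text \<open>A point z over the fifth factor has coefficient 0 in both divisors and is the even
  reference in all three parity comparisons. For the difference of the divisors, a point with odd
  coefficient in the first one is taken; it lies outside the support of the second.\<close>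

lemma five_factors_not_prime:
  fixes g :: "nat \<Rightarrow> 'a list"
  assumes br: "\<And>i. i < 5 \<Longrightarrow> branch (g i)" and pos: "\<And>i. i < 5 \<Longrightarrow> degree (g i) > 0"
    and le: "\<And>i j a. \<lbrakk>i < j; j < 5\<rbrakk> \<Longrightarrow> k.alg_mult (g i) a + k.alg_mult (g j) a \<le> k.alg_mult f a"
    and S: "\<And>\<tau> i. \<lbrakk>\<tau> \<in> S; i < 5\<rbrakk> \<Longrightarrow> aut \<tau> \<and> \<tau> (\<phi> (g i)) = \<phi> (g i)"
  shows "\<not> Factorial_Ring.prime (card (invariant_classes S))"
proof -
  let ?D = "branch_diff (g 0) (g 1)" and ?E = "branch_diff (g 2) (g 3)"
  let ?G = "branch_fun (g 0) (g 1)" and ?H = "branch_fun (g 2) (g (3::nat))"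
  have b: "branch (g 0)" "branch (g 1)" "branch (g 2)" "branch (g 3)" "branch (g 4)" using br by auto
  have p: "degree (g 0) > 0" "degree (g 1) > 0" "degree (g 2) > 0" "degree (g 3) > 0" "degree (g 4) > 0" using pos by auto
  have dis: "points_over (g i) \<inter> points_over (g j) = {}" if "i < j" "j < 5" for i j
    using that by (intro points_over_disjoint br le) auto
  have dis': "v \<notin> points_over (g j)" if "v \<in> points_over (g i)" "i \<noteq> j" "i < 5" "j < 5" for i j v
    using dis[of i j] dis[of j i] that by (metis disjoint_iff linorder_neqE_nat)
  obtain z where z: "z \<in> points_over (g 4)"
    using card_points_over(2)[OF b(5)] p(5) by (metis card.empty ex_in_conv less_irrefl)
  then have z0: "Poly_Mapping.lookup ?D z = 0" "Poly_Mapping.lookup ?E z = 0"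
    using dis'[OF z] by (simp_all add: branch_diff_def lookup_minus lookup_branch_divisor b del: One_nat_def)
  obtain v i where v: "i < 2" "v \<in> points_over (g i)" "odd (Poly_Mapping.lookup ?D v)"
  proof -
    obtain v where "v \<in> points_over (g 0) \<or> v \<in> points_over (g 1)" "odd (Poly_Mapping.lookup ?D v)"
      using odd_coefficient[OF b(1,2) p(1,2) dis[of 0 1]] by auto
    then show thesis using that[of 0 v] that[of 1 v] by auto
  qed
  obtain w j where w: "j < 4" "w \<in> points_over (g j)" "odd (Poly_Mapping.lookup ?E w)"
  proof -
    obtain v where "v \<in> points_over (g 2) \<or> v \<in> points_over (g 3)" "odd (Poly_Mapping.lookup ?E v)"
      using odd_coefficient[OF b(3,4) p(3,4) dis[of 2 3]] by auto
    then show thesis using that[of 2 v] that[of 3 v] by auto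
  qed
  have vE: "Poly_Mapping.lookup ?E v = 0"
    using v dis'[OF v(2), of 2] dis'[OF v(2), of 3] by (simp add: branch_diff_def lookup_minus lookup_branch_divisor b)
  show ?thesis
  proof (rule not_prime_card_invariant_classes)
    have t: "aut \<tau> \<and> \<tau> (\<phi> (g i)) = \<phi> (g i) \<and> \<tau> (\<phi> (g j)) = \<phi> (g j)" if "\<tau> \<in> S" "i < 5" "j < 5" for \<tau> i j
      using S that by blast
    show "two_torsion_rep S ?D" by (rule two_torsion_branch_diff[OF b(1,2)], rule t) auto
    show "two_torsion_rep S ?E" by (rule two_torsion_branch_diff[OF b(3,4)], rule t) auto
    show "?D \<notin> PD"
      using not_principal[of ?D ?G "g i" "g 4" v z] valuation_branch_fun[OF b(1,2)] branch_fun_F[OF b(1,2)] v z z0 br[of i] b by auto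
    show "?E \<notin> PD"
      using not_principal[of ?E ?H "g j" "g 4" w z] valuation_branch_fun[OF b(3,4)] branch_fun_F[OF b(3,4)] w z z0 br[of j] b by auto
    show "?D - ?E \<notin> PD"
    proof
      assume PD: "?D - ?E \<in> PD"
      have GH: "?G \<in> F" "?G \<noteq> \<zero>" "inv ?H \<in> F" "inv ?H \<noteq> \<zero>" "?H \<in> F" "?H \<noteq> \<zero>"
        using branch_fun_F[OF b(1,2)] branch_fun_F[OF b(3,4)] F_inv inv_nz by auto
      have "even (Poly_Mapping.lookup (?D - ?E) v) \<longleftrightarrow> even (Poly_Mapping.lookup (?D - ?E) z)"
      proof (rule not_principal[OF PD _ _ _ _ _ v(2) z])
        fix u assume u: "u \<in> pts"
        interpret u: subfield_valuation K "carrier K" u by (rule pts_valuation[OF u])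
        have "u (?G \<otimes> inv ?H) = u ?G - u ?H"
          using u.w_mult[of ?G "inv ?H"] u.w_inv[of ?H] GH by simp
        then show "2 * Poly_Mapping.lookup (?D - ?E) u = u (?G \<otimes> inv ?H)"
          using valuation_branch_fun[OF b(1,2) u] valuation_branch_fun[OF b(3,4) u] by (simp add: lookup_minus)
      qed (use GH br v b in \<open>auto simp: integral_iff\<close>)
      then show False using v z0 vE by (simp add: lookup_minus)
    qed
  qed
qed

end

section \<open>Fraction fields\<close>

context domain
begin

abbreviation "nz \<equiv> carrier R - {\<zero>}"

lemma fraction_mem:
  assumes "a \<in> carrier R" "b \<in> nz"
  shows "(c, d) \<in> fraction R a b \<longleftrightarrow> c \<in> carrier R \<and> d \<in> nz \<and> a \<otimes> d = c \<otimes> b"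
  using assms by (auto simp: fraction_def frac_rel_def)

text \<open>Transitivity of equality of fractions: multiply by the middle denominator d and cancel
  it, which is where the absence of zero divisors is used.\<close>

lemma cross_trans:
  assumes "a \<in> carrier R" "b \<in> nz" "c \<in> carrier R" "d \<in> nz" "e \<in> carrier R" "h \<in> nz"
    and "a \<otimes> d = c \<otimes> b" "c \<otimes> h = e \<otimes> d"
  shows "a \<otimes> h = e \<otimes> b"
proof -
  have cl: "a \<in> carrier R" "b \<in> carrier R" "c \<in> carrier R" "d \<in> carrier R" "e \<in> carrier R" "h \<in> carrier R"
    using assms by auto
  have "d \<otimes> (a \<otimes> h) = (a \<otimes> d) \<otimes> h" using cl by algebra
  also have "\<dots> = (c \<otimes> h) \<otimes> b" unfolding assms(7) using cl by algebra
  also have "\<dots> = d \<otimes> (e \<otimes> b)" unfolding assms(8) using cl by algebra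
  finally show ?thesis using m_lcancel[of d "a \<otimes> h" "e \<otimes> b"] assms(4) cl by simp
qed

lemma fraction_eq_iff:
  assumes "a \<in> carrier R" "b \<in> nz" "c \<in> carrier R" "d \<in> nz"
  shows "fraction R a b = fraction R c d \<longleftrightarrow> a \<otimes> d = c \<otimes> b"
proof
  assume "fraction R a b = fraction R c d"
  moreover have "(c, d) \<in> fraction R c d" using assms by (simp add: fraction_mem)
  ultimately show "a \<otimes> d = c \<otimes> b" using fraction_mem[OF assms(1,2)] by blast
next
  assume eq: "a \<otimes> d = c \<otimes> b"
  then have eq': "c \<otimes> b = a \<otimes> d" by simp
  show "fraction R a b = fraction R c d"
  proof (intro equalityI subrelI)
    fix x y assume "(x, y) \<in> fraction R a b"
    then have *: "x \<in> carrier R" "y \<in> nz" "a \<otimes> y = x \<otimes> b" using fraction_mem[OF assms(1,2)] by auto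
    then show "(x, y) \<in> fraction R c d"
      using cross_trans[OF assms(3,4,1,2) *(1,2) eq' *(3)] fraction_mem[OF assms(3,4)] by blast
  next
    fix x y assume "(x, y) \<in> fraction R c d"
    then have *: "x \<in> carrier R" "y \<in> nz" "c \<otimes> y = x \<otimes> d" using fraction_mem[OF assms(3,4)] by auto
    then show "(x, y) \<in> fraction R a b"
      using cross_trans[OF assms(1,2,3,4) *(1,2) eq *(3)] fraction_mem[OF assms(1,2)] by blast
  qed
qed

lemma frac_field_carrier: "carrier (frac_field R) = {fraction R a b | a b. a \<in> carrier R \<and> b \<in> nz}"
  unfolding frac_field_def quotient_def fraction_def by auto

lemma frac_field_mem [simp]: "\<lbrakk>a \<in> carrier R; b \<in> nz\<rbrakk> \<Longrightarrow> fraction R a b \<in> carrier (frac_field R)"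
  unfolding frac_field_carrier by blast

lemma frac_field_E: assumes "u \<in> carrier (frac_field R)"
  obtains a b where "a \<in> carrier R" "b \<in> nz" "u = fraction R a b"
  using assms unfolding frac_field_carrier by blast

lemma nz_mult [simp]: "\<lbrakk>a \<in> nz; b \<in> nz\<rbrakk> \<Longrightarrow> a \<otimes> b \<in> nz"
  using integral by auto

lemma one_nz [simp]: "\<one> \<in> nz" by simp

text \<open>The operations of \<open>frac_field\<close> are unions over all representatives. Once
  the result is independent of the choice, such a union is that common result, as soon as one
  representative exists.\<close>

lemma UN_pair_const: assumes "(a, b) \<in> A" "\<And>x y. (x, y) \<in> A \<Longrightarrow> B x y = C"
  shows "(\<Union>(x, y)\<in>A. B x y) = C"
proof -
  have "(\<Union>(x, y)\<in>A. B x y) = (\<Union>z\<in>A. C)" using assms(2) by (intro SUP_cong) auto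
  then show ?thesis using assms(1) by auto
qed

lemma frac_field_mult:
  assumes "a \<in> carrier R" "b \<in> nz" "c \<in> carrier R" "d \<in> nz"
  shows "fraction R a b \<otimes>\<^bsub>frac_field R\<^esub> fraction R c d = fraction R (a \<otimes> c) (b \<otimes> d)"
proof -
  have *: "fraction R (x \<otimes> z) (y \<otimes> w) = fraction R (a \<otimes> c) (b \<otimes> d)"
    if "(x, y) \<in> fraction R a b" "(z, w) \<in> fraction R c d" for x y z w
  proof -
    have m: "x \<in> carrier R" "y \<in> nz" "a \<otimes> y = x \<otimes> b" "z \<in> carrier R" "w \<in> nz" "c \<otimes> w = z \<otimes> d"
      using that assms by (auto simp: fraction_mem)
    have cl: "a \<in> carrier R" "b \<in> carrier R" "c \<in> carrier R" "d \<in> carrier R" "x \<in> carrier R" "y \<in> carrier R"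
      "z \<in> carrier R" "w \<in> carrier R" using m assms by auto
    have "(x \<otimes> z) \<otimes> (b \<otimes> d) = (x \<otimes> b) \<otimes> (z \<otimes> d)" using cl by algebra
    also have "\<dots> = (a \<otimes> c) \<otimes> (y \<otimes> w)" unfolding m(3)[symmetric] m(6)[symmetric] using cl by algebra
    finally show ?thesis using m assms cl nz_mult[of y w] nz_mult[of b d] by (subst fraction_eq_iff) simp_all
  qed
  show ?thesis unfolding frac_field_def monoid.simps
  proof (rule UN_pair_const[of a b])
    show "(a, b) \<in> fraction R a b" using assms by (simp add: fraction_mem)
    fix x y assume xy: "(x, y) \<in> fraction R a b"
    show "(\<Union>(z, w)\<in>fraction R c d. fraction R (x \<otimes> z) (y \<otimes> w)) = fraction R (a \<otimes> c) (b \<otimes> d)"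
      using *[OF xy] assms by (intro UN_pair_const[of c d]) (auto simp: fraction_mem)
  qed
qed

lemma frac_field_add:
  assumes "a \<in> carrier R" "b \<in> nz" "c \<in> carrier R" "d \<in> nz"
  shows "fraction R a b \<oplus>\<^bsub>frac_field R\<^esub> fraction R c d = fraction R (a \<otimes> d \<oplus> c \<otimes> b) (b \<otimes> d)"
proof -
  have *: "fraction R (x \<otimes> w \<oplus> z \<otimes> y) (y \<otimes> w) = fraction R (a \<otimes> d \<oplus> c \<otimes> b) (b \<otimes> d)"
    if "(x, y) \<in> fraction R a b" "(z, w) \<in> fraction R c d" for x y z w
  proof -
    have m: "x \<in> carrier R" "y \<in> nz" "a \<otimes> y = x \<otimes> b" "z \<in> carrier R" "w \<in> nz" "c \<otimes> w = z \<otimes> d"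
      using that assms by (auto simp: fraction_mem)
    have cl: "a \<in> carrier R" "b \<in> carrier R" "c \<in> carrier R" "d \<in> carrier R" "x \<in> carrier R" "y \<in> carrier R"
      "z \<in> carrier R" "w \<in> carrier R" using m assms by auto
    have "(x \<otimes> w \<oplus> z \<otimes> y) \<otimes> (b \<otimes> d) = (x \<otimes> b) \<otimes> (w \<otimes> d) \<oplus> (z \<otimes> d) \<otimes> (y \<otimes> b)" using cl by algebra
    also have "\<dots> = (a \<otimes> d \<oplus> c \<otimes> b) \<otimes> (y \<otimes> w)" unfolding m(3)[symmetric] m(6)[symmetric] using cl by algebra
    finally show ?thesis using m assms cl nz_mult[of y w] nz_mult[of b d] by (subst fraction_eq_iff) simp_all
  qed
  show ?thesis unfolding frac_field_def ring.simps
  proof (rule UN_pair_const[of a b])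
    show "(a, b) \<in> fraction R a b" using assms by (simp add: fraction_mem)
    fix x y assume xy: "(x, y) \<in> fraction R a b"
    show "(\<Union>(z, w)\<in>fraction R c d. fraction R (x \<otimes> w \<oplus> z \<otimes> y) (y \<otimes> w)) = fraction R (a \<otimes> d \<oplus> c \<otimes> b) (b \<otimes> d)"
      using *[OF xy] assms by (intro UN_pair_const[of c d]) (auto simp: fraction_mem)
  qed
qed

lemma frac_field_zero_one: "\<zero>\<^bsub>frac_field R\<^esub> = fraction R \<zero> \<one>" "\<one>\<^bsub>frac_field R\<^esub> = fraction R \<one> \<one>"
  by (simp_all add: frac_field_def)

lemma frac_field_is_field: "field (frac_field R)"
proof -
  let ?Q = "frac_field R"
  have abel: "abelian_group ?Q"
  proof (rule abelian_groupI)
    fix x y assume "x \<in> carrier ?Q" "y \<in> carrier ?Q"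
    then obtain a b c d where *: "a \<in> carrier R" "b \<in> nz" "x = fraction R a b" "c \<in> carrier R" "d \<in> nz" "y = fraction R c d"
      by (elim frac_field_E) blast
    then show "x \<oplus>\<^bsub>?Q\<^esub> y \<in> carrier ?Q" using nz_mult[of b d] by (simp add: frac_field_add)
    show "x \<oplus>\<^bsub>?Q\<^esub> y = y \<oplus>\<^bsub>?Q\<^esub> x" using * by (simp add: frac_field_add m_comm a_comm)
    fix z assume "z \<in> carrier ?Q"
    then obtain e h where **: "e \<in> carrier R" "h \<in> nz" "z = fraction R e h" by (elim frac_field_E)
    have cl: "a \<in> carrier R" "b \<in> carrier R" "c \<in> carrier R" "d \<in> carrier R" "e \<in> carrier R" "h \<in> carrier R"
      using * ** by auto
    have n: "b \<otimes> d \<in> nz" "d \<otimes> h \<in> nz" "b \<otimes> d \<otimes> h \<in> nz" "b \<otimes> (d \<otimes> h) \<in> nz"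
      using * ** nz_mult[of b d] nz_mult[of d h] nz_mult[of "b \<otimes> d" h] nz_mult[of b "d \<otimes> h"] by blast+
    have l: "x \<oplus>\<^bsub>?Q\<^esub> y \<oplus>\<^bsub>?Q\<^esub> z = fraction R ((a \<otimes> d \<oplus> c \<otimes> b) \<otimes> h \<oplus> e \<otimes> (b \<otimes> d)) (b \<otimes> d \<otimes> h)"
      unfolding *(3,6) **(3) frac_field_add[OF *(1,2,4,5)] using cl by (intro frac_field_add n **) auto
    have r: "x \<oplus>\<^bsub>?Q\<^esub> (y \<oplus>\<^bsub>?Q\<^esub> z) = fraction R (a \<otimes> (d \<otimes> h) \<oplus> (c \<otimes> h \<oplus> e \<otimes> d) \<otimes> b) (b \<otimes> (d \<otimes> h))"
      unfolding *(3,6) **(3) frac_field_add[OF *(4,5) **(1,2)] using cl by (intro frac_field_add n *) auto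
    have "(a \<otimes> d \<oplus> c \<otimes> b) \<otimes> h \<oplus> e \<otimes> (b \<otimes> d) = a \<otimes> (d \<otimes> h) \<oplus> (c \<otimes> h \<oplus> e \<otimes> d) \<otimes> b"
      using cl by algebra
    moreover have "b \<otimes> d \<otimes> h = b \<otimes> (d \<otimes> h)" using cl by algebra
    ultimately show "x \<oplus>\<^bsub>?Q\<^esub> y \<oplus>\<^bsub>?Q\<^esub> z = x \<oplus>\<^bsub>?Q\<^esub> (y \<oplus>\<^bsub>?Q\<^esub> z)" unfolding l r by simp
  next
    show "\<zero>\<^bsub>?Q\<^esub> \<in> carrier ?Q" by (simp add: frac_field_zero_one)
  next
    fix x assume "x \<in> carrier ?Q"
    then obtain a b where *: "a \<in> carrier R" "b \<in> nz" "x = fraction R a b" by (elim frac_field_E)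
    then show "\<zero>\<^bsub>?Q\<^esub> \<oplus>\<^bsub>?Q\<^esub> x = x" unfolding frac_field_zero_one by (simp add: frac_field_add)
    have "fraction R (\<ominus> a) b \<oplus>\<^bsub>?Q\<^esub> x = fraction R (\<ominus> a \<otimes> b \<oplus> a \<otimes> b) (b \<otimes> b)" using * by (simp add: frac_field_add)
    also have "\<ominus> a \<otimes> b \<oplus> a \<otimes> b = \<zero>" using * by (simp add: l_minus l_neg)
    also have "fraction R \<zero> (b \<otimes> b) = \<zero>\<^bsub>?Q\<^esub>" unfolding frac_field_zero_one
      using * nz_mult[of b b] by (subst fraction_eq_iff) simp_all
    finally show "\<exists>y\<in>carrier ?Q. y \<oplus>\<^bsub>?Q\<^esub> x = \<zero>\<^bsub>?Q\<^esub>" using * by (intro bexI[of _ "fraction R (\<ominus> a) b"]) simp_all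
  qed
  have mon: "comm_monoid ?Q"
  proof (rule comm_monoidI)
    fix x y assume "x \<in> carrier ?Q" "y \<in> carrier ?Q"
    then obtain a b c d where *: "a \<in> carrier R" "b \<in> nz" "x = fraction R a b" "c \<in> carrier R" "d \<in> nz" "y = fraction R c d"
      by (elim frac_field_E) blast
    then show "x \<otimes>\<^bsub>?Q\<^esub> y \<in> carrier ?Q" using nz_mult[of b d] by (simp add: frac_field_mult)
    show "x \<otimes>\<^bsub>?Q\<^esub> y = y \<otimes>\<^bsub>?Q\<^esub> x" using * by (simp add: frac_field_mult m_comm)
    fix z assume "z \<in> carrier ?Q"
    then obtain e h where **: "e \<in> carrier R" "h \<in> nz" "z = fraction R e h" by (elim frac_field_E)
    have n: "b \<otimes> d \<in> nz" "d \<otimes> h \<in> nz" using * ** nz_mult[of b d] nz_mult[of d h] by blast+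
    have "x \<otimes>\<^bsub>?Q\<^esub> y \<otimes>\<^bsub>?Q\<^esub> z = fraction R (a \<otimes> c \<otimes> e) (b \<otimes> d \<otimes> h)"
      unfolding *(3,6) **(3) frac_field_mult[OF *(1,2,4,5)] using * by (intro frac_field_mult n **) auto
    moreover have "x \<otimes>\<^bsub>?Q\<^esub> (y \<otimes>\<^bsub>?Q\<^esub> z) = fraction R (a \<otimes> (c \<otimes> e)) (b \<otimes> (d \<otimes> h))"
      unfolding *(3,6) **(3) frac_field_mult[OF *(4,5) **(1,2)] using * ** by (intro frac_field_mult n *) auto
    ultimately show "x \<otimes>\<^bsub>?Q\<^esub> y \<otimes>\<^bsub>?Q\<^esub> z = x \<otimes>\<^bsub>?Q\<^esub> (y \<otimes>\<^bsub>?Q\<^esub> z)" using * ** by (simp add: m_assoc)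
  next
    show "\<one>\<^bsub>?Q\<^esub> \<in> carrier ?Q" by (simp add: frac_field_zero_one)
  next
    fix x assume "x \<in> carrier ?Q"
    then obtain a b where *: "a \<in> carrier R" "b \<in> nz" "x = fraction R a b" by (elim frac_field_E)
    then show "\<one>\<^bsub>?Q\<^esub> \<otimes>\<^bsub>?Q\<^esub> x = x" unfolding frac_field_zero_one by (simp add: frac_field_mult)
  qed
  have cring: "cring ?Q"
  proof (rule cringI[OF abel mon])
    fix x y z assume "x \<in> carrier ?Q" "y \<in> carrier ?Q" "z \<in> carrier ?Q"
    then obtain a b c d e h where *: "a \<in> carrier R" "b \<in> nz" "x = fraction R a b" "c \<in> carrier R" "d \<in> nz" "y = fraction R c d"
      and **: "e \<in> carrier R" "h \<in> nz" "z = fraction R e h"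
      by (elim frac_field_E) blast
    have cl: "a \<in> carrier R" "b \<in> carrier R" "c \<in> carrier R" "d \<in> carrier R" "e \<in> carrier R" "h \<in> carrier R"
      using * ** by auto
    have n: "b \<otimes> d \<in> nz" "b \<otimes> h \<in> nz" "d \<otimes> h \<in> nz" "b \<otimes> d \<otimes> h \<in> nz" "(b \<otimes> h) \<otimes> (d \<otimes> h) \<in> nz"
      using * ** nz_mult[of b d] nz_mult[of d h] nz_mult[of b h] nz_mult[of "b \<otimes> d" h] nz_mult[of "b \<otimes> h" "d \<otimes> h"] by blast+
    have l: "(x \<oplus>\<^bsub>?Q\<^esub> y) \<otimes>\<^bsub>?Q\<^esub> z = fraction R ((a \<otimes> d \<oplus> c \<otimes> b) \<otimes> e) (b \<otimes> d \<otimes> h)"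
      unfolding *(3,6) **(3) frac_field_add[OF *(1,2,4,5)] using cl by (intro frac_field_mult n **) auto
    have r: "x \<otimes>\<^bsub>?Q\<^esub> z \<oplus>\<^bsub>?Q\<^esub> y \<otimes>\<^bsub>?Q\<^esub> z = fraction R ((a \<otimes> e) \<otimes> (d \<otimes> h) \<oplus> (c \<otimes> e) \<otimes> (b \<otimes> h)) ((b \<otimes> h) \<otimes> (d \<otimes> h))"
      unfolding *(3,6) **(3) frac_field_mult[OF *(1,2) **(1,2)] frac_field_mult[OF *(4,5) **(1,2)]
      using cl by (intro frac_field_add n) auto
    have "((a \<otimes> d \<oplus> c \<otimes> b) \<otimes> e) \<otimes> ((b \<otimes> h) \<otimes> (d \<otimes> h)) = ((a \<otimes> e) \<otimes> (d \<otimes> h) \<oplus> (c \<otimes> e) \<otimes> (b \<otimes> h)) \<otimes> (b \<otimes> d \<otimes> h)"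
      using cl by algebra
    then show "(x \<oplus>\<^bsub>?Q\<^esub> y) \<otimes>\<^bsub>?Q\<^esub> z = x \<otimes>\<^bsub>?Q\<^esub> z \<oplus>\<^bsub>?Q\<^esub> y \<otimes>\<^bsub>?Q\<^esub> z"
      unfolding l r using cl n by (subst fraction_eq_iff) auto
  qed
  show ?thesis
  proof (rule cring.cring_fieldI2[OF cring])
    show "\<zero>\<^bsub>?Q\<^esub> \<noteq> \<one>\<^bsub>?Q\<^esub>" unfolding frac_field_zero_one by (subst fraction_eq_iff) auto
    fix x assume "x \<in> carrier ?Q" "x \<noteq> \<zero>\<^bsub>?Q\<^esub>"
    then obtain a b where *: "a \<in> carrier R" "b \<in> nz" "x = fraction R a b" by (elim frac_field_E)
    have "a \<noteq> \<zero>"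
    proof
      assume "a = \<zero>"
      then have "x = \<zero>\<^bsub>?Q\<^esub>" unfolding *(3) frac_field_zero_one using *(2) by (subst fraction_eq_iff) auto
      then show False using \<open>x \<noteq> \<zero>\<^bsub>?Q\<^esub>\<close> by simp
    qed
    then have a: "a \<in> nz" using * by simp
    have "x \<otimes>\<^bsub>?Q\<^esub> fraction R b a = fraction R (a \<otimes> b) (b \<otimes> a)" using * a by (simp add: frac_field_mult)
    also have "\<dots> = \<one>\<^bsub>?Q\<^esub>" unfolding frac_field_zero_one using * a nz_mult[of b a]
      by (subst fraction_eq_iff) (auto simp: m_comm)
    finally show "\<exists>y\<in>carrier ?Q. x \<otimes>\<^bsub>?Q\<^esub> y = \<one>\<^bsub>?Q\<^esub>" using * a by (intro bexI[of _ "fraction R b a"]) auto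
  qed
qed

lemma fraction_one_hom: "(\<lambda>a. fraction R a \<one>) \<in> ring_hom R (frac_field R)"
  by (rule ring_hom_memI) (simp_all add: frac_field_mult frac_field_add frac_field_zero_one)

lemma fraction_one_eq_zero: "a \<in> carrier R \<Longrightarrow> fraction R a \<one> = \<zero>\<^bsub>frac_field R\<^esub> \<longleftrightarrow> a = \<zero>"
  unfolding frac_field_zero_one by (subst fraction_eq_iff) auto

lemma frac_field_denominator:
  assumes "u \<in> carrier (frac_field R)"
  shows "\<exists>a\<in>carrier R. \<exists>c\<in>nz. u \<otimes>\<^bsub>frac_field R\<^esub> fraction R c \<one> = fraction R a \<one>"
proof -
  obtain a b where *: "a \<in> carrier R" "b \<in> nz" "u = fraction R a b" using assms by (elim frac_field_E)
  then have "u \<otimes>\<^bsub>frac_field R\<^esub> fraction R b \<one> = fraction R (a \<otimes> b) b" by (simp add: frac_field_mult)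
  also have "\<dots> = fraction R a \<one>" using * by (subst fraction_eq_iff) auto
  finally show ?thesis using * by blast
qed

end

section \<open>The function field of a curve\<close>

text \<open>The function field of Defs, with an arbitrary algebraically closed field in place of \<open>Fpbar p\<close>.\<close>

context algebraically_closed
begin

definition "Fx = frac_field PR"
definition "emb q = fraction PR q \<one>\<^bsub>PR\<^esub>"
definition "cpoly f = [\<one>\<^bsub>Fx\<^esub>, \<zero>\<^bsub>Fx\<^esub>, \<ominus>\<^bsub>Fx\<^esub> emb f]"
definition "FF f = Rupt\<^bsub>Fx\<^esub> (carrier Fx) (cpoly f)"
definition "cls f q = PIdl\<^bsub>poly_ring Fx\<^esub> (cpoly f) +>\<^bsub>poly_ring Fx\<^esub> q"
definition "of_poly f q = cls f (ring.poly_of_const Fx (emb q))"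

text \<open>The quotient by Y^2 - f is a field because this polynomial is irreducible: a proper
  factor would be linear and give a square root of f in k(x), which a simple root of f excludes.
  Remainders modulo Y^2 - f have degree at most 1 in Y, and the denominators of their two
  coefficients can be cleared.\<close>

lemma hyperelliptic_function_field:
  assumes f: "f \<in> carrier PR" "degree f > 0" "even (degree f)"
    and simple: "\<And>a. a \<in> carrier L \<Longrightarrow> alg_mult f a \<le> 1"
    and two: "\<one> \<oplus> \<one> \<noteq> \<zero>"
  shows "hyperelliptic L (FF f) (of_poly f) (cls f X\<^bsub>Fx\<^esub>) f"
proof -
  interpret P: domain PR by (rule PR_domain)
  interpret Fx: field Fx unfolding Fx_def by (rule P.frac_field_is_field)
  let ?K = "FF f" and ?PF = "poly_ring Fx"
  note sr = Fx.carrier_is_subring and sf = Fx.carrier_is_subfield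
  interpret PF: domain ?PF by (rule Fx.univ_poly_is_domain[OF sr])
  have f_nz: "f \<noteq> []" using f by auto
  have emb_hom: "emb \<in> ring_hom PR Fx"
    using P.fraction_one_hom by (simp add: emb_def[abs_def] Fx_def)
  have emb_zero: "emb q = \<zero>\<^bsub>Fx\<^esub> \<longleftrightarrow> q = []" if "q \<in> carrier PR" for q
    using P.fraction_one_eq_zero[OF that] by (simp add: emb_def Fx_def univ_poly_zero)
  have emb_closed [simp]: "emb q \<in> carrier Fx" if "q \<in> carrier PR" for q
    using that emb_hom by (rule ring_hom_closed[rotated])
  have denom: "\<exists>a\<in>carrier PR. \<exists>c\<in>carrier PR. c \<noteq> [] \<and> u \<otimes>\<^bsub>Fx\<^esub> emb c = emb a" if "u \<in> carrier Fx" for u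
    using P.frac_field_denominator[of u] that by (auto simp: emb_def Fx_def univ_poly_zero)
  have emb_inj: "p = q" if "p \<in> carrier PR" "q \<in> carrier PR" "emb p = emb q" for p q
  proof -
    interpret E: ring_hom_ring PR Fx emb by (rule ring_hom_ringI2[OF P.ring_axioms Fx.ring_axioms emb_hom])
    have "emb (p \<ominus>\<^bsub>PR\<^esub> q) = \<zero>\<^bsub>Fx\<^esub>" using that by (simp add: a_minus_def Fx.r_neg)
    then have "p \<ominus>\<^bsub>PR\<^esub> q = \<zero>\<^bsub>PR\<^esub>" using emb_zero[of "p \<ominus>\<^bsub>PR\<^esub> q"] that by (simp add: univ_poly_zero)
    then show ?thesis using that by simp
  qed
  have cp: "cpoly f \<in> carrier ?PF" using f by (simp add: cpoly_def univ_poly_def polynomial_def)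
  have deg: "degree (cpoly f) = 2" "cpoly f \<noteq> []" by (simp_all add: cpoly_def)
  have embf: "emb f \<in> carrier Fx" "emb f \<noteq> \<zero>\<^bsub>Fx\<^esub>" using f f_nz emb_zero by auto
  have no_sqrt: "s \<otimes>\<^bsub>Fx\<^esub> s \<noteq> emb f" if s: "s \<in> carrier Fx" for s
  proof
    assume sq: "s \<otimes>\<^bsub>Fx\<^esub> s = emb f"
    obtain a c where ac: "a \<in> carrier PR" "c \<in> carrier PR" "c \<noteq> []" "s \<otimes>\<^bsub>Fx\<^esub> emb c = emb a" using denom[OF s] by blast
    have "emb (f \<otimes>\<^bsub>PR\<^esub> (c \<otimes>\<^bsub>PR\<^esub> c)) = (s \<otimes>\<^bsub>Fx\<^esub> s) \<otimes>\<^bsub>Fx\<^esub> (emb c \<otimes>\<^bsub>Fx\<^esub> emb c)"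
      using ac f ring_hom_mult[OF emb_hom] by (simp add: sq)
    also have "\<dots> = (s \<otimes>\<^bsub>Fx\<^esub> emb c) \<otimes>\<^bsub>Fx\<^esub> (s \<otimes>\<^bsub>Fx\<^esub> emb c)" using s emb_closed[OF ac(2)] by (simp add: Fx.m_ac)
    also have "\<dots> = emb (a \<otimes>\<^bsub>PR\<^esub> a)" unfolding ac(4) using ring_hom_mult[OF emb_hom] ac by simp
    finally have eq: "f \<otimes>\<^bsub>PR\<^esub> (c \<otimes>\<^bsub>PR\<^esub> c) = a \<otimes>\<^bsub>PR\<^esub> a" using ac f by (intro emb_inj) auto
    obtain x where "x \<in> carrier L" "eval f x = \<zero>" using exists_root_nonconstant[OF f(1,2)] by blast
    then have "alg_mult f x = 1" using simple[of x] root_alg_mult[OF f(1) f_nz, of x] by simp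
    then show False using not_square_times_simple_root[OF f(1) ac(1,2) f_nz ac(3)] eq by blast
  qed
  have irr: "pirreducible\<^bsub>Fx\<^esub> (carrier Fx) (cpoly f)"
  proof (rule Fx.pirreducibleI[OF sr cp deg(2)])
    show "cpoly f \<notin> Units ?PF" using Fx.univ_poly_units'[OF sf, of "cpoly f"] deg(1) by (metis zero_neq_numeral)
    fix q r assume qr: "q \<in> carrier ?PF" "r \<in> carrier ?PF" "cpoly f = q \<otimes>\<^bsub>?PF\<^esub> r"
    have nz: "q \<noteq> []" "r \<noteq> []" using qr deg(2) PF.l_null[of r] PF.r_null[of q] by (auto simp: univ_poly_zero)
    have d: "degree q + degree r = 2" using Fx.degree_mult[OF qr(1,2) nz] qr(3) deg by simp
    show "q \<in> Units ?PF \<or> r \<in> Units ?PF"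
    proof (rule ccontr)
      assume "\<not> ?thesis"
      then have "degree q \<noteq> 0" "degree r \<noteq> 0"
        using Fx.univ_poly_units'[OF sf] qr nz by auto
      then have "degree q = 1" using d by linarith
      then obtain s where s: "s \<in> carrier Fx" "Fx.eval q s = \<zero>\<^bsub>Fx\<^esub>"
        using Fx.degree_one_root[OF sf qr(1)] Fx.a_inv_closed by blast
      have "Fx.eval (cpoly f) s = \<zero>\<^bsub>Fx\<^esub>" using Fx.eval_PR(1)[OF qr(1,2) s(1)] Fx.eval_PR(4)[OF qr(2,1) s(1)] s qr(3) by simp
      moreover have "Fx.eval (cpoly f) s = s \<otimes>\<^bsub>Fx\<^esub> s \<ominus>\<^bsub>Fx\<^esub> emb f"
        using s embf by (simp add: cpoly_def numeral_2_eq_2 a_minus_def)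
      ultimately show False using no_sqrt[OF s(1)] s embf by simp
    qed
  qed
  then interpret K: field ?K using Fx.rupture_is_field_iff_pirreducible[OF sf cp] by (simp add: FF_def)
  have cls_hom: "cls f \<in> ring_hom ?PF ?K"
    using Fx.rupture_surj_hom(1)[OF sr cp] by (simp add: cls_def[abs_def] FF_def)
  interpret C: ring_hom_ring ?PF ?K "cls f" by (rule ring_hom_ringI2[OF PF.ring_axioms K.ring_axioms cls_hom])
  have const_hom: "Fx.poly_of_const \<in> ring_hom Fx ?PF"
    using Fx.canonical_embedding_is_hom[OF sr] by simp
  have inner_hom: "cls f \<circ> Fx.poly_of_const \<in> ring_hom Fx ?K"
    using ring_hom_trans[OF const_hom cls_hom] .
  have hom: "of_poly f \<in> ring_hom PR ?K"
    using ring_hom_trans[OF emb_hom inner_hom] by (simp add: of_poly_def[abs_def] o_def)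
  interpret O: ring_hom_ring PR ?K "of_poly f" by (rule ring_hom_ringI2[OF P.ring_axioms K.ring_axioms hom])
  have pc: "Fx.poly_of_const u \<in> carrier ?PF" if "u \<in> carrier Fx" for u
    using ring_hom_closed[OF const_hom that] .
  have inj: "q = []" if q: "q \<in> carrier PR" "of_poly f q = \<zero>\<^bsub>?K\<^esub>" for q
  proof -
    have "inj_on (cls f \<circ> Fx.poly_of_const) (carrier Fx)"
      by (rule non_trivial_field_hom_is_inj[OF inner_hom Fx.field_axioms K.field_axioms])
    moreover have "(cls f \<circ> Fx.poly_of_const) \<zero>\<^bsub>Fx\<^esub> = \<zero>\<^bsub>?K\<^esub>"
      using ring_hom_zero[OF inner_hom Fx.ring_axioms K.ring_axioms] .
    moreover have "(cls f \<circ> Fx.poly_of_const) (emb q) = \<zero>\<^bsub>?K\<^esub>" using q(2) by (simp add: of_poly_def)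
    ultimately have "emb q = \<zero>\<^bsub>Fx\<^esub>" using inj_onD emb_closed[OF q(1)] Fx.zero_closed by metis
    then show ?thesis using emb_zero q by simp
  qed
  have X: "X\<^bsub>Fx\<^esub> \<in> carrier ?PF" using Fx.var_closed[OF sr] by simp
  \<comment> \<open>The normalization drops leading zeros, so that constants and the zero polynomial
    in Y are covered as well.\<close>
  have linear: "Fx.poly_of_const b1 \<otimes>\<^bsub>?PF\<^esub> X\<^bsub>Fx\<^esub> \<oplus>\<^bsub>?PF\<^esub> Fx.poly_of_const b0 = Fx.normalize [b1, b0]"
    if "b1 \<in> carrier Fx" "b0 \<in> carrier Fx" for b1 b0
    using Fx.poly_mult_var[OF sr, of "Fx.poly_of_const b1"] pc[OF that(1)] that
    by (auto simp: Fx.poly_of_const_def univ_poly_add)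
  have ysq: "cls f X\<^bsub>Fx\<^esub> \<otimes>\<^bsub>?K\<^esub> cls f X\<^bsub>Fx\<^esub> = of_poly f f"
  proof -
    have "X\<^bsub>Fx\<^esub> \<otimes>\<^bsub>?PF\<^esub> X\<^bsub>Fx\<^esub> = [\<one>\<^bsub>Fx\<^esub>, \<zero>\<^bsub>Fx\<^esub>, \<zero>\<^bsub>Fx\<^esub>]" using Fx.poly_mult_var[OF sr X] by (simp add: var_def)
    moreover have "cpoly f \<oplus>\<^bsub>?PF\<^esub> Fx.poly_of_const (emb f) = [\<one>\<^bsub>Fx\<^esub>, \<zero>\<^bsub>Fx\<^esub>, \<zero>\<^bsub>Fx\<^esub>]"
      using embf by (simp add: cpoly_def univ_poly_add Fx.poly_of_const_def Fx.l_neg)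
    ultimately have "cls f (X\<^bsub>Fx\<^esub> \<otimes>\<^bsub>?PF\<^esub> X\<^bsub>Fx\<^esub>) = cls f (cpoly f) \<oplus>\<^bsub>?K\<^esub> of_poly f f"
      using C.hom_add[OF cp pc[OF embf(1)]] by (simp add: of_poly_def)
    moreover have "cls f (cpoly f) = \<zero>\<^bsub>?K\<^esub>"
    proof -
      have "cpoly f \<in> PIdl\<^bsub>?PF\<^esub> (cpoly f)" using PF.cgenideal_self[OF cp] .
      then have "cls f (cpoly f) = PIdl\<^bsub>?PF\<^esub> (cpoly f)" unfolding cls_def
        by (rule PF.a_rcos_zero[OF PF.cgenideal_ideal[OF cp]])
      then show ?thesis by (simp add: FF_def rupture_def FactRing_def)
    qed
    ultimately show ?thesis using X f by simp
  qed
  have gen: "\<exists>a\<in>carrier PR. \<exists>b\<in>carrier PR. \<exists>c\<in>carrier PR. c \<noteq> [] \<and>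
      of_poly f c \<otimes>\<^bsub>?K\<^esub> u = of_poly f a \<oplus>\<^bsub>?K\<^esub> of_poly f b \<otimes>\<^bsub>?K\<^esub> cls f X\<^bsub>Fx\<^esub>" if u: "u \<in> carrier ?K" for u
  proof -
    have "carrier ?K = cls f ` {q \<in> carrier ?PF. length q \<le> degree (cpoly f)}"
      using Fx.rupture_carrier_as_pmod_image[OF sf cp] Fx.pmod_image_characterization[OF sf cp deg(2)]
      by (simp add: FF_def cls_def[abs_def])
    then obtain q where q: "q \<in> carrier ?PF" "length q \<le> 2" "u = cls f q" using u deg by auto
    have "\<exists>b1\<in>carrier Fx. \<exists>b0\<in>carrier Fx. q = Fx.normalize [b1, b0]"
    proof -
      consider "q = []" | b where "q = [b]" | b1 b0 where "q = [b1, b0]"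
        using q(2) by (cases q; cases "tl q") (auto simp: neq_Nil_conv)
      then show ?thesis
      proof cases
        case 1 then show ?thesis by (intro bexI[of _ "\<zero>\<^bsub>Fx\<^esub>"]) auto
      next
        case 2 then show ?thesis using q(1)
          by (intro bexI[of _ "\<zero>\<^bsub>Fx\<^esub>"] bexI[of _ b]) (auto simp: univ_poly_def polynomial_def)
      next
        case 3 then show ?thesis using q(1)
          by (intro bexI[of _ b0] bexI[of _ b1]) (auto simp: univ_poly_def polynomial_def)
      qed
    qed
    then obtain b1 b0 where b: "b1 \<in> carrier Fx" "b0 \<in> carrier Fx" "q = Fx.normalize [b1, b0]" by blast
    let ?c = "\<lambda>b. cls f (Fx.poly_of_const b)"
    have cc: "?c b \<in> carrier ?K" if "b \<in> carrier Fx" for b using that pc by simp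
    have u_eq: "u = ?c b1 \<otimes>\<^bsub>?K\<^esub> cls f X\<^bsub>Fx\<^esub> \<oplus>\<^bsub>?K\<^esub> ?c b0"
      unfolding q(3) b(3) linear[OF b(1,2), symmetric] using pc b X by simp
    obtain a1 c1 where 1: "a1 \<in> carrier PR" "c1 \<in> carrier PR" "c1 \<noteq> []" "b1 \<otimes>\<^bsub>Fx\<^esub> emb c1 = emb a1" using denom[OF b(1)] by blast
    obtain a0 c0 where 0: "a0 \<in> carrier PR" "c0 \<in> carrier PR" "c0 \<noteq> []" "b0 \<otimes>\<^bsub>Fx\<^esub> emb c0 = emb a0" using denom[OF b(2)] by blast
    have r1: "?c b1 \<otimes>\<^bsub>?K\<^esub> of_poly f c1 = of_poly f a1"
      using ring_hom_mult[OF inner_hom b(1) emb_closed[OF 1(2)]] 1(4) by (simp add: of_poly_def)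
    have r0: "?c b0 \<otimes>\<^bsub>?K\<^esub> of_poly f c0 = of_poly f a0"
      using ring_hom_mult[OF inner_hom b(2) emb_closed[OF 0(2)]] 0(4) by (simp add: of_poly_def)
    note cl = cc[OF b(1)] cc[OF b(2)] O.hom_closed[OF 1(2)] O.hom_closed[OF 0(2)] C.hom_closed[OF X]
    have "of_poly f (c0 \<otimes>\<^bsub>PR\<^esub> c1) \<otimes>\<^bsub>?K\<^esub> u = (of_poly f c0 \<otimes>\<^bsub>?K\<^esub> of_poly f c1) \<otimes>\<^bsub>?K\<^esub> u"
      using 0 1 by simp
    also have "\<dots> = (?c b0 \<otimes>\<^bsub>?K\<^esub> of_poly f c0) \<otimes>\<^bsub>?K\<^esub> of_poly f c1 \<oplus>\<^bsub>?K\<^esub>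
       ((?c b1 \<otimes>\<^bsub>?K\<^esub> of_poly f c1) \<otimes>\<^bsub>?K\<^esub> of_poly f c0) \<otimes>\<^bsub>?K\<^esub> cls f X\<^bsub>Fx\<^esub>"
      unfolding u_eq using cl by algebra
    also have "\<dots> = of_poly f (a0 \<otimes>\<^bsub>PR\<^esub> c1) \<oplus>\<^bsub>?K\<^esub> of_poly f (a1 \<otimes>\<^bsub>PR\<^esub> c0) \<otimes>\<^bsub>?K\<^esub> cls f X\<^bsub>Fx\<^esub>"
      unfolding r0 r1 using 0 1 by simp
    finally have eq: "of_poly f (c0 \<otimes>\<^bsub>PR\<^esub> c1) \<otimes>\<^bsub>?K\<^esub> u = of_poly f (a0 \<otimes>\<^bsub>PR\<^esub> c1) \<oplus>\<^bsub>?K\<^esub> of_poly f (a1 \<otimes>\<^bsub>PR\<^esub> c0) \<otimes>\<^bsub>?K\<^esub> cls f X\<^bsub>Fx\<^esub>" .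
    show ?thesis
      by (rule bexI[of _ "a0 \<otimes>\<^bsub>PR\<^esub> c1"], rule bexI[of _ "a1 \<otimes>\<^bsub>PR\<^esub> c0"], rule bexI[of _ "c0 \<otimes>\<^bsub>PR\<^esub> c1"])
        (use eq 0 1 PR_mult_nz in auto)
  qed
  show ?thesis
    by (intro hyperelliptic.intro hyperelliptic_axioms.intro algebraically_closed_axioms K.field_axioms)
      (use hom inj X ysq f simple two gen in auto)
qed

end

section \<open>Polynomials over finite fields\<close>

text \<open>A homomorphism of fields is injective, so mapping the coefficients keeps the leading one
  nonzero and the list normalized.\<close>

lemma map_poly_ring_hom:
  assumes h: "h \<in> ring_hom R S" and R: "field R" and S: "field S"
  shows "map h \<in> ring_hom (poly_ring R) (poly_ring S)"
proof -
  interpret R: field R by fact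
  interpret S: field S by fact
  interpret H: ring_hom_ring R S h by (rule ring_hom_ringI2[OF R.ring_axioms S.ring_axioms h])
  have pol: "map h p \<in> carrier (poly_ring S)" if "p \<in> carrier (poly_ring R)" for p
    by (rule polynomial_hom[OF h R S that])
  have set: "set p \<subseteq> carrier R" if "p \<in> carrier (poly_ring R)" for p
    using that by (auto simp: univ_poly_def polynomial_def)
  have norm: "S.normalize p = p" if "p \<in> carrier (poly_ring S)" for p
    using that S.normalize_polynomial[of "carrier S"] by (simp add: univ_poly_carrier)
  show ?thesis
  proof (rule ring_hom_memI)
    fix p q assume p: "p \<in> carrier (poly_ring R)" and q: "q \<in> carrier (poly_ring R)"
    show "map h (p \<otimes>\<^bsub>poly_ring R\<^esub> q) = map h p \<otimes>\<^bsub>poly_ring S\<^esub> map h q"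
      using H.poly_mult_hom'[OF set[OF p] set[OF q]] norm[OF pol[OF R.PR_closed(1)[OF p q]]] by (simp add: univ_poly_mult)
    show "map h (p \<oplus>\<^bsub>poly_ring R\<^esub> q) = map h p \<oplus>\<^bsub>poly_ring S\<^esub> map h q"
      using H.poly_add_hom'[OF set[OF p] set[OF q]] norm[OF pol[OF R.PR_closed(2)[OF p q]]] by (simp add: univ_poly_add)
  qed (simp_all add: pol univ_poly_one)
qed

text \<open>When x and y both map to a, the quotient of x^(n+1) - y^(n+1) by x - y specializes to
  (n+1) a^n. This takes the place of a formal derivative in the proof that X^N - X has simple
  roots.\<close>

lemma (in ring_hom_ring) power_difference:
  assumes xy: "x \<in> carrier R" "y \<in> carrier R" and R: "cring R" and e: "h x = a" "h y = a" and S: "cring S"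
  shows "\<exists>q\<in>carrier R. x [^]\<^bsub>R\<^esub> Suc n \<ominus>\<^bsub>R\<^esub> y [^]\<^bsub>R\<^esub> Suc n = (x \<ominus>\<^bsub>R\<^esub> y) \<otimes>\<^bsub>R\<^esub> q \<and>
     h q = [Suc n] \<cdot>\<^bsub>S\<^esub> (a [^]\<^bsub>S\<^esub> n)"
proof (induction n)
  interpret R: cring R by fact
  interpret S: cring S by fact
  have a: "a \<in> carrier S" using e xy by auto
  {
    case 0
    show ?case using xy by (intro bexI[of _ "\<one>\<^bsub>R\<^esub>"]) simp_all
  next
    case (Suc n)
    then obtain q where q: "q \<in> carrier R" "x [^]\<^bsub>R\<^esub> Suc n \<ominus>\<^bsub>R\<^esub> y [^]\<^bsub>R\<^esub> Suc n = (x \<ominus>\<^bsub>R\<^esub> y) \<otimes>\<^bsub>R\<^esub> q"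
      "h q = [Suc n] \<cdot>\<^bsub>S\<^esub> (a [^]\<^bsub>S\<^esub> n)" by blast
    let ?u = "x [^]\<^bsub>R\<^esub> Suc n" and ?v = "y [^]\<^bsub>R\<^esub> Suc n"
    have uv: "?u \<in> carrier R" "?v \<in> carrier R" using xy by (rule_tac [!] R.nat_pow_closed)
    have "?u \<otimes>\<^bsub>R\<^esub> x \<ominus>\<^bsub>R\<^esub> ?v \<otimes>\<^bsub>R\<^esub> y = (?u \<ominus>\<^bsub>R\<^esub> ?v) \<otimes>\<^bsub>R\<^esub> x \<oplus>\<^bsub>R\<^esub> (x \<ominus>\<^bsub>R\<^esub> y) \<otimes>\<^bsub>R\<^esub> ?v" using uv xy by algebra
    also have "\<dots> = (x \<ominus>\<^bsub>R\<^esub> y) \<otimes>\<^bsub>R\<^esub> (q \<otimes>\<^bsub>R\<^esub> x \<oplus>\<^bsub>R\<^esub> ?v)" unfolding q(2) using uv xy q(1) by algebra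
    finally have 1: "x [^]\<^bsub>R\<^esub> Suc (Suc n) \<ominus>\<^bsub>R\<^esub> y [^]\<^bsub>R\<^esub> Suc (Suc n) = (x \<ominus>\<^bsub>R\<^esub> y) \<otimes>\<^bsub>R\<^esub> (q \<otimes>\<^bsub>R\<^esub> x \<oplus>\<^bsub>R\<^esub> ?v)"
      by simp
    have "h ?v = a [^]\<^bsub>S\<^esub> Suc n" using hom_nat_pow[OF xy(2), of "Suc n"] e by simp
    then have "h (q \<otimes>\<^bsub>R\<^esub> x \<oplus>\<^bsub>R\<^esub> ?v) = ([Suc n] \<cdot>\<^bsub>S\<^esub> (a [^]\<^bsub>S\<^esub> n)) \<otimes>\<^bsub>S\<^esub> a \<oplus>\<^bsub>S\<^esub> a [^]\<^bsub>S\<^esub> Suc n"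
      using q uv xy e by (simp del: R.nat_pow_Suc S.nat_pow_Suc)
    also have "([Suc n] \<cdot>\<^bsub>S\<^esub> (a [^]\<^bsub>S\<^esub> n)) \<otimes>\<^bsub>S\<^esub> a = [Suc n] \<cdot>\<^bsub>S\<^esub> (a [^]\<^bsub>S\<^esub> Suc n)"
      using S.add_pow_ldistr[of "a [^]\<^bsub>S\<^esub> n" a "Suc n"] a by simp
    also have "[Suc n] \<cdot>\<^bsub>S\<^esub> (a [^]\<^bsub>S\<^esub> Suc n) \<oplus>\<^bsub>S\<^esub> a [^]\<^bsub>S\<^esub> Suc n = [Suc (Suc n)] \<cdot>\<^bsub>S\<^esub> (a [^]\<^bsub>S\<^esub> Suc n)"
      by (rule S.add.nat_pow_Suc[symmetric])
    finally show ?case using 1 q uv xy by (intro bexI[of _ "q \<otimes>\<^bsub>R\<^esub> x \<oplus>\<^bsub>R\<^esub> ?v"]) auto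
  }
qed

section \<open>Counting polynomials over a finite field, and the polynomial X^N - X\<close>

context field
begin

definition polys where "polys n = {f \<in> carrier PR. f \<noteq> [] \<and> degree f = n}"

definition monic_irr where "monic_irr d = {g \<in> polys d. pirreducible (carrier R) g \<and> lead_coeff g = \<one>}"

lemma polys_eq: "polys n = (\<lambda>(a, l). a # l) ` ((carrier R - {\<zero>}) \<times> {l. set l \<subseteq> carrier R \<and> length l = n})"
proof (intro equalityI subsetI)
  fix f assume "f \<in> polys n"
  then show "f \<in> (\<lambda>(a, l). a # l) ` ((carrier R - {\<zero>}) \<times> {l. set l \<subseteq> carrier R \<and> length l = n})"
    by (cases f) (auto simp: polys_def univ_poly_def polynomial_def)
qed (auto simp: polys_def univ_poly_def polynomial_def)

lemma card_polys:
  assumes "finite (carrier R)"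
  shows "finite (polys n)" "card (polys n) = (card (carrier R) - 1) * card (carrier R) ^ n"
proof -
  have "inj_on (\<lambda>(a, l). a # l) ((carrier R - {\<zero>}) \<times> {l. set l \<subseteq> carrier R \<and> length l = n})"
    by (auto simp: inj_on_def)
  then show "card (polys n) = (card (carrier R) - 1) * card (carrier R) ^ n"
    unfolding polys_eq using assms
    by (simp add: card_image card_cartesian_product card_lists_length_eq card_Diff_singleton)
  show "finite (polys n)" unfolding polys_eq using assms by (simp add: finite_lists_length_eq)
qed

lemma card_bounded_polys:
  assumes "finite (carrier R)"
  shows "finite {f \<in> carrier PR. length f \<le> n}" "card {f \<in> carrier PR. length f \<le> n} = card (carrier R) ^ n"
proof -
  have "finite {f \<in> carrier PR. length f \<le> n} \<and> card {f \<in> carrier PR. length f \<le> n} = card (carrier R) ^ n"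
  proof (induction n)
    case 0
    have "{f \<in> carrier PR. length f \<le> 0} = {[]}" by auto
    then show ?case by simp
  next
    case (Suc n)
    have eq: "{f \<in> carrier PR. length f \<le> Suc n} = {f \<in> carrier PR. length f \<le> n} \<union> polys n"
      by (auto simp: polys_def le_Suc_eq)
    have "{f \<in> carrier PR. length f \<le> n} \<inter> polys n = {}" by (fastforce simp: polys_def neq_Nil_conv)
    then have "card {f \<in> carrier PR. length f \<le> Suc n} = card (carrier R) ^ n + (card (carrier R) - 1) * card (carrier R) ^ n"
      unfolding eq using Suc card_polys[OF assms] by (simp add: card_Un_disjoint)
    also have "\<dots> = card (carrier R) ^ Suc n"
      using assms zero_closed by (cases "card (carrier R)") auto
    finally show ?case unfolding eq using Suc card_polys[OF assms] by simp
  qed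
  then show "finite {f \<in> carrier PR. length f \<le> n}" "card {f \<in> carrier PR. length f \<le> n} = card (carrier R) ^ n" by auto
qed

lemma finite_field_pow_order:
  assumes "finite (carrier R)" "x \<in> carrier R"
  shows "x [^] card (carrier R) = x"
proof (cases "x = \<zero>")
  case True
  have "card (carrier R) \<noteq> 0" using assms zero_closed by auto
  then show ?thesis using True nat_pow_zero by simp
next
  case False
  interpret M: group "Multiplicative_Group.mult_of R" by (rule field_mult_group)
  have "x [^]\<^bsub>Multiplicative_Group.mult_of R\<^esub> (Coset.order (Multiplicative_Group.mult_of R)) = \<one>\<^bsub>Multiplicative_Group.mult_of R\<^esub>"
    using M.pow_order_eq_1[of x] assms False by simp
  then have *: "x [^] (card (carrier R) - 1) = \<one>"
    by (simp add: Multiplicative_Group.nat_pow_mult_of Coset.order_def card_Diff_singleton)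
  have "card (carrier R) > 0" using assms by (auto simp: card_gt_0_iff)
  then have "x [^] card (carrier R) = x [^] (card (carrier R) - 1) \<otimes> x"
    using nat_pow_Suc[of x "card (carrier R) - 1"] by simp
  then show ?thesis using * assms by simp
qed

definition frob_poly where "frob_poly N = X [^]\<^bsub>PR\<^esub> (N::nat) \<ominus>\<^bsub>PR\<^esub> X"

lemma X_PR [simp]: "X \<in> carrier PR"
  using var_closed[OF carrier_is_subring] by simp

lemma degree_frob_poly:
  assumes "N \<ge> 2" shows "frob_poly N \<in> carrier PR" "degree (frob_poly N) = N" "frob_poly N \<noteq> []"
proof -
  interpret P: domain PR by (rule PR_domain)
  have XN: "X [^]\<^bsub>PR\<^esub> N \<in> carrier PR" by simp
  then show "frob_poly N \<in> carrier PR" by (simp add: frob_poly_def)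
  have d: "degree (X [^]\<^bsub>PR\<^esub> N) = N" using polynomial_pow_degree[OF X_PR, of N] by (simp add: var_def)
  have d1: "degree (\<ominus>\<^bsub>PR\<^esub> X) = 1" using univ_poly_a_inv_degree[OF carrier_is_subring X_PR] by (simp add: var_def)
  have "degree (frob_poly N) = max (degree (X [^]\<^bsub>PR\<^esub> N)) (degree (\<ominus>\<^bsub>PR\<^esub> X))"
    using poly_add_degree_eq[OF carrier_is_subring, of "X [^]\<^bsub>PR\<^esub> N" "\<ominus>\<^bsub>PR\<^esub> X"] d d1 assms XN
    by (simp add: frob_poly_def a_minus_def univ_poly_add univ_poly_carrier)
  then show dN: "degree (frob_poly N) = N" using d d1 assms by simp
  then show "frob_poly N \<noteq> []" using assms by auto
qed

lemma linear_eq: assumes "a \<in> carrier R" shows "X \<ominus>\<^bsub>PR\<^esub> poly_of_const a = [\<one>, \<ominus> a]"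
proof (cases "a = \<zero>")
  case True
  interpret P: domain PR by (rule PR_domain)
  have "X \<ominus>\<^bsub>PR\<^esub> \<zero>\<^bsub>PR\<^esub> = X" using X_PR by (simp add: a_minus_def)
  then show ?thesis using True by (simp add: poly_of_const_def univ_poly_zero var_def)
next
  case False
  have "\<ominus>\<^bsub>PR\<^esub> [a] = [\<ominus> a]" using univ_poly_a_inv_def'[OF carrier_is_subring, of "[a]"] assms False by simp
  then show ?thesis using assms False by (simp add: a_minus_def univ_poly_add var_def poly_of_const_def)
qed

text \<open>If a^N = a, then X^N - X = (X - a)(h - 1), where h is the quotient of X^N - a^N by X -
  a. At a the polynomial h takes the value N a^(N-1) = 0, so the second factor is -1 there.\<close>

lemma frob_poly_simple_root:
  assumes N: "N \<ge> 2" "[N] \<cdot> \<one> = \<zero>" and a: "a \<in> carrier R"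
  shows "alg_mult (frob_poly N) a \<le> 1"
proof (cases "eval (frob_poly N) a = \<zero>")
  case False
  then show ?thesis using alg_mult_gt_zero_iff_is_root[OF degree_frob_poly(1)[OF N(1)], of a] by (simp add: is_root_def)
next
  case True
  interpret P: domain PR by (rule PR_domain)
  let ?e = "\<lambda>p. eval p a"
  interpret E: ring_hom_ring PR R ?e by (rule eval_ring_hom[OF carrier_is_subring a])
  have const_hom: "poly_of_const \<in> ring_hom R PR" using canonical_embedding_is_hom[OF carrier_is_subring] by simp
  interpret C: ring_hom_ring R PR poly_of_const by (rule ring_hom_ringI2[OF ring_axioms P.ring_axioms const_hom])
  let ?A = "poly_of_const a"
  have A: "?A \<in> carrier PR" "eval ?A a = a" using a by (auto simp: poly_of_const_def)
  have eX: "eval X a = a" by (rule eval_var[OF a])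
  have "?e (X [^]\<^bsub>PR\<^esub> N) = a [^] N" using E.hom_nat_pow[OF X_PR, of N] eX by simp
  then have aN: "a [^] N = a" using True a eX eval_PR(3)[of "X [^]\<^bsub>PR\<^esub> N" X a] by (simp add: frob_poly_def)
  then have AN: "?A [^]\<^bsub>PR\<^esub> N = ?A" using C.hom_nat_pow[OF a, of N] by simp
  obtain n where n: "N = Suc n" using N by (cases N) auto
  obtain h where h: "h \<in> carrier PR" "X [^]\<^bsub>PR\<^esub> N \<ominus>\<^bsub>PR\<^esub> ?A [^]\<^bsub>PR\<^esub> N = (X \<ominus>\<^bsub>PR\<^esub> ?A) \<otimes>\<^bsub>PR\<^esub> h"
    and eh: "?e h = [N] \<cdot> (a [^] n)"
    using E.power_difference[OF X_PR A(1) P.is_cring eX A(2) is_cring, of n] n by auto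
  have "[N] \<cdot> (a [^] n) = ([N] \<cdot> \<one>) \<otimes> (a [^] n)" using a by (simp add: add_pow_ldistr)
  then have eh0: "?e h = \<zero>" using eh N(2) a by simp
  let ?g = "h \<ominus>\<^bsub>PR\<^esub> \<one>\<^bsub>PR\<^esub>"
  have g: "?g \<in> carrier PR" using h by simp
  have eg: "?e ?g = \<ominus> \<one>" using h eh0 by (simp add: a_minus_def)
  have XN: "X [^]\<^bsub>PR\<^esub> N \<in> carrier PR" by simp
  have "frob_poly N = (X [^]\<^bsub>PR\<^esub> N \<ominus>\<^bsub>PR\<^esub> ?A) \<ominus>\<^bsub>PR\<^esub> (X \<ominus>\<^bsub>PR\<^esub> ?A)"
    unfolding frob_poly_def using XN X_PR A(1) by algebra
  also have "\<dots> = (X \<ominus>\<^bsub>PR\<^esub> ?A) \<otimes>\<^bsub>PR\<^esub> h \<ominus>\<^bsub>PR\<^esub> (X \<ominus>\<^bsub>PR\<^esub> ?A)" using h(2) AN by simp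
  also have "\<dots> = (X \<ominus>\<^bsub>PR\<^esub> ?A) \<otimes>\<^bsub>PR\<^esub> ?g" using X_PR A(1) h(1) by algebra
  finally have fp: "frob_poly N = [\<one>, \<ominus> a] \<otimes>\<^bsub>PR\<^esub> ?g" unfolding linear_eq[OF a] .
  have "?e ?g \<noteq> \<zero>" unfolding eg by simp
  then have "?g \<noteq> []" "alg_mult ?g a = 0" using alg_mult_gt_zero_iff_is_root[OF g, of a] by (auto simp: is_root_def)
  moreover have "alg_mult [\<one>, \<ominus> a] a = 1"
    using monic_degree_one_roots[OF a] alg_mult_eq_count_roots[of "[\<one>, \<ominus> a]"] a by simp
  ultimately show ?thesis unfolding fp using alg_mult_mult[of "[\<one>, \<ominus> a]" ?g a] a g by simp
qed

text \<open>The residue field modulo g has N elements, where N is the order of R raised to the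
  degree of g, so all its elements satisfy x^N = x. For the class of X this is the claimed
  divisibility.\<close>

lemma irreducible_divides_frob_poly:
  assumes fin: "finite (carrier R)" and g: "g \<in> carrier PR" "pirreducible (carrier R) g"
  shows "g pdivides frob_poly (card (carrier R) ^ degree g)"
proof -
  note sf = carrier_is_subfield and sr = carrier_is_subring
  let ?K = "Rupt (carrier R) g" and ?N = "card (carrier R) ^ degree g"
  interpret P: domain PR by (rule PR_domain)
  interpret K: field ?K using rupture_is_field_iff_pirreducible[OF sf g(1)] g(2) by simp
  let ?s = "rupture_surj (carrier R) g"
  interpret S: ring_hom_ring PR ?K ?s by (rule rupture_surj_hom(2)[OF sr g(1)])
  have g_nz: "g \<noteq> []" using pirreducibleE(1)[OF sr g] .
  have im: "(\<lambda>q. q pmod g) ` carrier PR = {q \<in> carrier PR. length q \<le> degree g}"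
    by (rule pmod_image_characterization[OF sf g(1) g_nz])
  have bij: "bij_betw ?s {q \<in> carrier PR. length q \<le> degree g} (carrier ?K)"
    using rupture_carrier_as_pmod_image[OF sf g(1)] rupture_surj_inj_on[OF sf g(1)]
    unfolding im by (simp add: bij_betw_def)
  then have card: "card (carrier ?K) = ?N" and finK: "finite (carrier ?K)"
    using bij_betw_same_card[OF bij] bij_betw_finite[OF bij] card_bounded_polys[OF fin] by auto
  have "?s X [^]\<^bsub>?K\<^esub> ?N = ?s X" using K.finite_field_pow_order[OF finK, of "?s X"] card by simp
  then have "?s (X [^]\<^bsub>PR\<^esub> ?N) = ?s X" using S.hom_nat_pow[OF X_PR, of ?N] by simp
  moreover have XN: "X [^]\<^bsub>PR\<^esub> ?N \<in> carrier PR" by (rule P.nat_pow_closed[OF X_PR])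
  ultimately have "?s (X [^]\<^bsub>PR\<^esub> ?N \<oplus>\<^bsub>PR\<^esub> \<ominus>\<^bsub>PR\<^esub> X) = ?s X \<oplus>\<^bsub>?K\<^esub> \<ominus>\<^bsub>?K\<^esub> ?s X"
    using S.hom_add[OF XN P.a_inv_closed[OF X_PR]] S.hom_a_inv[OF X_PR] by (simp only:)
  also have "\<dots> = \<zero>\<^bsub>?K\<^esub>" by (rule K.r_neg[OF S.hom_closed[OF X_PR]])
  finally have "PIdl\<^bsub>PR\<^esub> g +>\<^bsub>PR\<^esub> frob_poly ?N = PIdl\<^bsub>PR\<^esub> g"
    by (simp only: frob_poly_def a_minus_def rupture_def FactRing_def ring.simps)
  moreover have "frob_poly ?N \<in> carrier PR" unfolding frob_poly_def using XN X_PR by (rule PR_closed(4))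
  ultimately have "frob_poly ?N \<in> PIdl\<^bsub>PR\<^esub> g"
    using ideal.rcos_const_imp_mem[OF P.cgenideal_ideal[OF g(1)], of "frob_poly ?N"] by blast
  then obtain h where "h \<in> carrier PR" "frob_poly ?N = h \<otimes>\<^bsub>PR\<^esub> g" unfolding cgenideal_def by blast
  then have "\<exists>h\<in>carrier PR. frob_poly ?N = g \<otimes>\<^bsub>PR\<^esub> h" using P.m_comm[OF _ g(1)] by metis
  then show ?thesis unfolding pdivides_def factor_def .
qed

end

context field
begin

lemma monic_part:
  assumes f: "f \<in> carrier PR" "f \<noteq> []"
  shows "\<exists>c\<in>carrier R - {\<zero>}. \<exists>g\<in>carrier PR. f = [c] \<otimes>\<^bsub>PR\<^esub> g \<and> lead_coeff g = \<one> \<and> degree g = degree f \<and> g \<noteq> []"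
proof -
  interpret P: domain PR by (rule PR_domain)
  let ?c = "lead_coeff f"
  have c: "?c \<in> carrier R" "?c \<noteq> \<zero>" using f by (auto simp: univ_poly_def polynomial_def)
  have ic: "inv ?c \<in> carrier R" "inv ?c \<noteq> \<zero>" "?c \<otimes> inv ?c = \<one>" "inv ?c \<otimes> ?c = \<one>"
    using c field_Units by (auto simp: nonzero_imp_inverse_nonzero)
  let ?g = "[inv ?c] \<otimes>\<^bsub>PR\<^esub> f"
  have g: "?g \<in> carrier PR" "?g \<noteq> []" "degree ?g = degree f"
    using f ic degree_mult[of "[inv ?c]" f] PR_mult_nz[of "[inv ?c]" f] by auto
  have "lead_coeff ?g = \<one>"
    using poly_mult_lead_coeff[OF carrier_is_subring, of "[inv ?c]" f] f ic by (simp add: univ_poly_mult univ_poly_carrier)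
  moreover have "[?c] \<otimes>\<^bsub>PR\<^esub> ?g = ([?c] \<otimes>\<^bsub>PR\<^esub> [inv ?c]) \<otimes>\<^bsub>PR\<^esub> f"
    using f c ic by (intro P.m_assoc[symmetric]) auto
  moreover have "[?c] \<otimes>\<^bsub>PR\<^esub> [inv ?c] = \<one>\<^bsub>PR\<^esub>" using c ic by (simp add: univ_poly_mult univ_poly_one)
  ultimately show ?thesis using g c f by (intro bexI[of _ ?c] bexI[of _ ?g]) auto
qed

text \<open>An irreducible divisor exists because the polynomials form a principal ideal domain; its
  leading coefficient is moved into the cofactor.\<close>

lemma monic_irr_factor:
  assumes f: "f \<in> carrier PR" "degree f > 0"
  shows "\<exists>d\<ge>1. \<exists>g\<in>monic_irr d. \<exists>h\<in>carrier PR. h \<noteq> [] \<and> f = g \<otimes>\<^bsub>PR\<^esub> h"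
proof -
  interpret P: principal_domain PR by (rule univ_poly_is_principal[OF carrier_is_subfield])
  note sr = carrier_is_subring and sf = carrier_is_subfield
  have f_nz: "f \<noteq> []" using f by auto
  have nu: "f \<notin> Units PR" using univ_poly_units'[OF sf, of f] f by simp
  have "f \<in> carrier PR - {\<zero>\<^bsub>PR\<^esub>}" using f(1) f_nz by (simp add: univ_poly_zero)
  then obtain q where q: "q \<in> carrier PR" "pirreducible (carrier R) q" "q divides\<^bsub>PR\<^esub> f"
    using P.exists_irreducible_divisor[OF _ nu] by metis
  have q_nz: "q \<noteq> []" using pirreducibleE(1)[OF sr q(1,2)] .
  obtain c g where g: "c \<in> carrier R" "c \<noteq> \<zero>" "g \<in> carrier PR" "q = [c] \<otimes>\<^bsub>PR\<^esub> g" "lead_coeff g = \<one>" "degree g = degree q" "g \<noteq> []"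
    using monic_part[OF q(1) q_nz] by blast
  have irr: "pirreducible (carrier R) g"
  proof (rule pirreducibleI[OF sr g(3,7)])
    show "g \<notin> Units PR" using univ_poly_units'[OF sf] pirreducible_degree[OF sf q(1,2)] g by auto
    fix a b assume ab: "a \<in> carrier PR" "b \<in> carrier PR" "g = a \<otimes>\<^bsub>PR\<^esub> b"
    have nz: "a \<noteq> []" "b \<noteq> []" using ab g(7) P.l_null[of b] P.r_null[of a] by (auto simp: univ_poly_zero)
    have "q = ([c] \<otimes>\<^bsub>PR\<^esub> a) \<otimes>\<^bsub>PR\<^esub> b" unfolding g(4) ab(3) using g ab by (intro P.m_assoc[symmetric]) auto
    moreover have ca: "[c] \<otimes>\<^bsub>PR\<^esub> a \<in> carrier PR" using g(1,2) ab(1) by simp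
    ultimately have "[c] \<otimes>\<^bsub>PR\<^esub> a \<in> Units PR \<or> b \<in> Units PR" using pirreducibleE(3)[OF sr q(1,2) ca ab(2)] by blast
    moreover have "degree ([c] \<otimes>\<^bsub>PR\<^esub> a) = degree a" using degree_mult[of "[c]" a] g(1,2) ab(1) nz by simp
    ultimately show "a \<in> Units PR \<or> b \<in> Units PR"
      using univ_poly_units'[OF sf, of a] univ_poly_units'[OF sf, of "[c] \<otimes>\<^bsub>PR\<^esub> a"] ab(1) nz(1) by metis
  qed
  obtain h where h: "h \<in> carrier PR" "f = q \<otimes>\<^bsub>PR\<^esub> h" using q(3) unfolding factor_def by blast
  have "h \<noteq> []" using h f_nz q P.r_null[of q] by (auto simp: univ_poly_zero)
  have "f = ([c] \<otimes>\<^bsub>PR\<^esub> g) \<otimes>\<^bsub>PR\<^esub> h" using h g by simp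
  also have "\<dots> = g \<otimes>\<^bsub>PR\<^esub> ([c] \<otimes>\<^bsub>PR\<^esub> h)" using g h P.m_lcomm[of g "[c]" h] by (simp add: P.m_assoc)
  finally have "f = g \<otimes>\<^bsub>PR\<^esub> ([c] \<otimes>\<^bsub>PR\<^esub> h)" .
  moreover have "[c] \<otimes>\<^bsub>PR\<^esub> h \<in> carrier PR" "[c] \<otimes>\<^bsub>PR\<^esub> h \<noteq> []" using g h \<open>h \<noteq> []\<close> PR_mult_nz by auto
  moreover have "g \<in> monic_irr (degree q)" using g irr by (simp add: monic_irr_def polys_def)
  moreover have "degree q \<ge> 1" using pirreducible_degree[OF sf q(1,2)] .
  ultimately show ?thesis by blast
qed

end

section \<open>Irreducible polynomials over a finite field and their roots\<close>

locale finite_field_closure = field R + k: algebraically_closed k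
  for R :: "('a, 'c) ring_scheme" (structure) and k :: "('b, 'd) ring_scheme" +
  fixes h :: "'a \<Rightarrow> 'b"
  assumes fin: "finite (carrier R)" and h_hom: "h \<in> ring_hom R k"
begin

abbreviation "q \<equiv> card (carrier R)"

sublocale P: principal_domain PR by (rule univ_poly_is_principal[OF carrier_is_subfield])

sublocale M: ring_hom_ring PR k.PR "map h"
proof -
  interpret kP: domain k.PR by (rule k.PR_domain)
  show "ring_hom_ring PR k.PR (map h)"
    by (rule ring_hom_ringI2[OF P.ring_axioms kP.ring_axioms map_poly_ring_hom[OF h_hom field_axioms k.field_axioms]])
qed

lemma q_ge_2: "q \<ge> 2"
proof -
  have "card {\<zero>, \<one>} \<le> q" by (intro card_mono fin) auto
  then show ?thesis by simp
qed

text \<open>The order of the additive group of R annihilates 1, and this passes to k. It is the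
  condition under which X^N - X has simple roots for N = q^d.\<close>

lemma char_zero: assumes "d > 0" shows "[(q ^ d)] \<cdot>\<^bsub>k\<^esub> \<one>\<^bsub>k\<^esub> = \<zero>\<^bsub>k\<^esub>"
proof -
  interpret H: ring_hom_ring R k h by (rule ring_hom_ringI2[OF ring_axioms k.ring_axioms h_hom])
  have 0: "[q] \<cdot> \<one> = \<zero>" using add.pow_order_eq_1[of \<one>] by (simp add: Coset.order_def)
  have "[n] \<cdot>\<^bsub>k\<^esub> \<one>\<^bsub>k\<^esub> = h ([n] \<cdot> \<one>)" for n :: nat
    by (induction n) simp_all
  then have 1: "[q] \<cdot>\<^bsub>k\<^esub> \<one>\<^bsub>k\<^esub> = \<zero>\<^bsub>k\<^esub>" using 0 by simp
  have "q ^ d = q * q ^ (d - 1)" using assms by (cases d) auto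
  then have "[(q ^ d)] \<cdot>\<^bsub>k\<^esub> \<one>\<^bsub>k\<^esub> = [(q ^ (d - 1))] \<cdot>\<^bsub>k\<^esub> ([q] \<cdot>\<^bsub>k\<^esub> \<one>\<^bsub>k\<^esub>)"
    using k.add.nat_pow_pow[of "\<one>\<^bsub>k\<^esub>" "q ^ (d - 1)" q] by (simp add: add_pow_def)
  then show ?thesis using 1 by simp
qed

lemma map_frob_poly: "map h (frob_poly N) = k.frob_poly N"
proof -
  have "map h X = X\<^bsub>k\<^esub>" using ring_hom_one[OF h_hom] ring_hom_zero[OF h_hom ring_axioms k.ring_axioms]
    by (simp add: var_def)
  then show ?thesis using M.hom_nat_pow[OF X_PR, of N] X_PR
    by (simp add: frob_poly_def k.frob_poly_def a_minus_def)
qed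

text \<open>The polynomials over R that vanish at a form a principal ideal. Its generator m, the
  minimal polynomial of a up to a constant, is not a unit, so every irreducible element of the ideal
  is associated to m.\<close>

lemma common_root_associated:
  assumes g: "g \<in> carrier PR" "pirreducible (carrier R) g" and g': "g' \<in> carrier PR" "pirreducible (carrier R) g'"
    and a: "a \<in> carrier k" "k.eval (map h g) a = \<zero>\<^bsub>k\<^esub>" "k.eval (map h g') a = \<zero>\<^bsub>k\<^esub>"
  shows "g \<sim>\<^bsub>PR\<^esub> g'"
proof -
  let ?e = "\<lambda>p. k.eval (map h p) a"
  have "(\<lambda>p. k.eval p a) \<in> ring_hom k.PR k" by (rule k.eval_is_hom[OF k.carrier_is_subring a(1)])
  from ring_hom_trans[OF M.homh this] have hom: "?e \<in> ring_hom PR k" by (simp add: o_def)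
  interpret E: ring_hom_ring PR k ?e by (rule ring_hom_ringI2[OF P.ring_axioms k.ring_axioms hom])
  have "ideal (a_kernel PR k ?e) PR" by (rule E.kernel_is_ideal)
  then obtain m where m: "m \<in> carrier PR" "a_kernel PR k ?e = PIdl\<^bsub>PR\<^esub> m" using P.exists_gen by blast
  have "m \<in> a_kernel PR k ?e" unfolding m(2) by (rule P.cgenideal_self[OF m(1)])
  then have em: "?e m = \<zero>\<^bsub>k\<^esub>" unfolding a_kernel_def' by blast
  have mnu: "m \<notin> Units PR"
  proof
    assume "m \<in> Units PR"
    then obtain n where n: "n \<in> carrier PR" "n \<otimes>\<^bsub>PR\<^esub> m = \<one>\<^bsub>PR\<^esub>" unfolding Units_def by blast
    then have "?e n \<otimes>\<^bsub>k\<^esub> ?e m = \<one>\<^bsub>k\<^esub>" using E.hom_mult[OF n(1) m(1)] E.hom_one by simp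
    then show False using em E.hom_closed[OF n(1)] by simp
  qed
  have "m \<sim>\<^bsub>PR\<^esub> p" if p: "p \<in> carrier PR" "pirreducible (carrier R) p" "?e p = \<zero>\<^bsub>k\<^esub>" for p
  proof -
    have "p \<in> a_kernel PR k ?e" using p(1,3) unfolding a_kernel_def' by blast
    then obtain n where "n \<in> carrier PR" "p = n \<otimes>\<^bsub>PR\<^esub> m" unfolding m(2) cgenideal_def by blast
    then have "m divides\<^bsub>PR\<^esub> p" unfolding factor_def using m(1) P.m_comm by blast
    then show ?thesis using divides_pirreducible_condition[OF p(2) m(1)] mnu by blast
  qed
  then have "m \<sim>\<^bsub>PR\<^esub> g" "m \<sim>\<^bsub>PR\<^esub> g'" using g g' a by auto
  then show ?thesis using P.associated_sym P.associated_trans g(1) g'(1) m(1) by meson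
qed

text \<open>The image of g divides X^N - X with N = q^(deg g), and all roots of the latter are
  simple.\<close>

lemma irreducible_simple_roots:
  assumes g: "g \<in> carrier PR" "pirreducible (carrier R) g"
  shows "k.roots (map h g) \<subseteq># k.roots (k.frob_poly (q ^ degree g))"
    "a \<in> carrier k \<Longrightarrow> k.alg_mult (map h g) a \<le> 1"
proof -
  have d: "degree g \<ge> 1" by (rule pirreducible_degree[OF carrier_is_subfield g])
  let ?N = "q ^ degree g"
  have "2 \<le> q ^ 1" using q_ge_2 by simp
  also have "\<dots> \<le> ?N" using d q_ge_2 by (intro power_increasing) auto
  finally have N: "?N \<ge> 2" .
  have gc: "map h g \<in> carrier k.PR" using g by simp
  note fk = k.degree_frob_poly[OF N]
  obtain c where c: "c \<in> carrier PR" "frob_poly ?N = g \<otimes>\<^bsub>PR\<^esub> c"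
    using irreducible_divides_frob_poly[OF fin g] unfolding pdivides_def factor_def by blast
  then have "k.frob_poly ?N = map h g \<otimes>\<^bsub>k.PR\<^esub> map h c" using M.hom_mult[OF g(1) c(1)] map_frob_poly by metis
  then have "map h g pdivides\<^bsub>k\<^esub> k.frob_poly ?N" unfolding pdivides_def factor_def using c by auto
  then show sub: "k.roots (map h g) \<subseteq># k.roots (k.frob_poly ?N)"
    by (rule k.pdivides_imp_roots_incl[OF gc fk(1,3)])
  show "k.alg_mult (map h g) a \<le> 1" if a: "a \<in> carrier k"
  proof -
    have "k.alg_mult (map h g) a \<le> k.alg_mult (k.frob_poly ?N) a"
      using mset_subset_eq_count[OF sub, of a] k.alg_mult_eq_count_roots[OF gc] k.alg_mult_eq_count_roots[OF fk(1)] by simp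
    also have "\<dots> \<le> 1" using k.frob_poly_simple_root[OF N _ a] char_zero d by simp
    finally show ?thesis .
  qed
qed

text \<open>The root sets of the monic irreducible polynomials of degree d have d elements each, are
  pairwise disjoint, and lie among the at most q^d roots of X^(q^d) - X.\<close>

lemma card_monic_irr:
  assumes d: "d \<ge> 1"
  shows "finite (monic_irr d)" "d * card (monic_irr d) \<le> q ^ d"
proof -
  show finI: "finite (monic_irr d)" using card_polys(1)[OF fin, of d] by (auto simp: monic_irr_def)
  have "2 \<le> q ^ 1" using q_ge_2 by simp
  also have "\<dots> \<le> q ^ d" using d q_ge_2 by (intro power_increasing) auto
  finally have N: "q ^ d \<ge> 2" .
  note fk = k.degree_frob_poly[OF N]
  let ?A = "\<lambda>g. set_mset (k.roots (map h g))" and ?B = "set_mset (k.roots (k.frob_poly (q ^ d)))"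
  have I: "g \<in> carrier PR" "pirreducible (carrier R) g" "degree g = d" "lead_coeff g = \<one>" "g \<noteq> []"
    if "g \<in> monic_irr d" for g using that by (auto simp: monic_irr_def polys_def)
  have cardA: "card (?A g) = d" if g: "g \<in> monic_irr d" for g
  proof -
    have gc: "map h g \<in> carrier k.PR" using I[OF g] by simp
    have "count (k.roots (map h g)) a = 1" if "a \<in> ?A g" for a
    proof -
      have "a \<in> carrier k" using that k.roots_mem_iff_is_root[OF gc] by (simp add: k.is_root_def)
      then have "count (k.roots (map h g)) a \<le> 1"
        using irreducible_simple_roots(2)[OF I(1,2)[OF g]] k.alg_mult_eq_count_roots[OF gc] by simp
      then show ?thesis using count_greater_zero_iff[of "k.roots (map h g)" a] that by linarith
    qed
    then have "size (k.roots (map h g)) = card (?A g)" by (simp add: size_multiset_overloaded_eq)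
    then show ?thesis using k.roots_over_carrier[OF gc] I(3)[OF g] by (simp add: k.splitted_def)
  qed
  \<comment> \<open>A common root makes the two polynomials proportional, and their leading
    coefficients then make them equal.\<close>
  have disj: "?A g \<inter> ?A g' = {}" if g: "g \<in> monic_irr d" "g' \<in> monic_irr d" "g \<noteq> g'" for g g'
  proof (rule ccontr)
    assume "?A g \<inter> ?A g' \<noteq> {}"
    then obtain a where "a \<in> ?A g" "a \<in> ?A g'" by blast
    then have "a \<in> carrier k" "k.eval (map h g) a = \<zero>\<^bsub>k\<^esub>" "k.eval (map h g') a = \<zero>\<^bsub>k\<^esub>"
      using k.roots_mem_iff_is_root[of "map h g"] k.roots_mem_iff_is_root[of "map h g'"] I[OF g(1)] I[OF g(2)]
      by (auto simp: k.is_root_def)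
    then have "g \<sim>\<^bsub>PR\<^esub> g'" using common_root_associated I[OF g(1)] I[OF g(2)] by blast
    then obtain c where c: "c \<in> carrier R - {\<zero>}" "g = [c] \<otimes>\<^bsub>PR\<^esub> g'"
      using associated_polynomials_iff[OF carrier_is_subfield I(1)[OF g(1)] I(1)[OF g(2)]] by blast
    have "lead_coeff g = c \<otimes> lead_coeff g'"
      using poly_mult_lead_coeff[OF carrier_is_subring, of "[c]" g'] c I[OF g(2)] by (simp add: univ_poly_mult univ_poly_carrier)
    then have "c = \<one>" using I[OF g(1)] I[OF g(2)] c by simp
    then have "g = g'" using c I[OF g(2)] P.l_one[of g'] by (simp add: univ_poly_one)
    then show False using g by simp
  qed
  have "(\<Union>g\<in>monic_irr d. ?A g) \<subseteq> ?B"
    using irreducible_simple_roots(1)[OF I(1,2)] I(3) by (fastforce dest: mset_subset_eqD)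
  then have "card (\<Union>g\<in>monic_irr d. ?A g) \<le> card ?B" by (intro card_mono) auto
  also have "card (\<Union>g\<in>monic_irr d. ?A g) = (\<Sum>g\<in>monic_irr d. card (?A g))"
    using disj finI by (intro card_UN_disjoint) auto
  also have "\<dots> = d * card (monic_irr d)" using cardA by simp
  also have "card ?B \<le> size (k.roots (k.frob_poly (q ^ d)))"
    by (metis mset_set_set_mset_msubset size_mset_mono size_mset_set)
  also have "\<dots> \<le> q ^ d" using k.size_roots_le_degree[OF fk(1)] fk(2) by simp
  finally show "d * card (monic_irr d) \<le> q ^ d" by simp
qed

lemma exists_irreducible_factor_root:
  assumes f: "f \<in> carrier PR" "f \<noteq> []" and a: "a \<in> carrier k" "k.eval (map h f) a = \<zero>\<^bsub>k\<^esub>"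
  shows "\<exists>g\<in>carrier PR. \<exists>r\<in>carrier PR. pirreducible (carrier R) g \<and> f = g \<otimes>\<^bsub>PR\<^esub> r \<and> r \<noteq> [] \<and> k.eval (map h g) a = \<zero>\<^bsub>k\<^esub>"
  using f a(2)
proof (induction "degree f" arbitrary: f rule: less_induct)
  case less
  have fc: "map h f \<in> carrier k.PR" using less.prems by simp
  have "degree f > 0"
  proof (rule ccontr)
    assume "\<not> degree f > 0"
    then obtain c where c: "f = [c]" using less.prems by (cases f) auto
    then have "c \<in> carrier R" "c \<noteq> \<zero>" using less.prems by (auto simp: univ_poly_def polynomial_def)
    moreover have "h c = \<zero>\<^bsub>k\<^esub>" using less.prems(3) c ring_hom_closed[OF h_hom \<open>c \<in> carrier R\<close>] a by simp
    moreover have "inj_on h (carrier R)" by (rule non_trivial_field_hom_is_inj[OF h_hom field_axioms k.field_axioms])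
    ultimately show False using ring_hom_zero[OF h_hom ring_axioms k.ring_axioms] zero_closed by (metis inj_onD)
  qed
  then obtain d g r where g: "d \<ge> 1" "g \<in> monic_irr d" "r \<in> carrier PR" "r \<noteq> []" "f = g \<otimes>\<^bsub>PR\<^esub> r"
    using monic_irr_factor[OF less.prems(1)] by blast
  then have gc: "g \<in> carrier PR" "pirreducible (carrier R) g" "degree g = d" "g \<noteq> []" by (auto simp: monic_irr_def polys_def)
  have ev: "k.eval (map h f) a = k.eval (map h g) a \<otimes>\<^bsub>k\<^esub> k.eval (map h r) a"
    using g(5) M.hom_mult[OF gc(1) g(3)] k.eval_PR(1)[of "map h g" "map h r" a] gc g a by simp
  have cl: "k.eval (map h g) a \<in> carrier k" "k.eval (map h r) a \<in> carrier k"
    using k.eval_PR(4)[OF _ fc a(1)] gc g by auto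
  then consider "k.eval (map h g) a = \<zero>\<^bsub>k\<^esub>" | "k.eval (map h r) a = \<zero>\<^bsub>k\<^esub>"
    using ev less.prems(3) k.integral by metis
  then show ?case
  proof cases
    case 1 then show ?thesis using gc g by blast
  next
    case 2
    have "degree r < degree f" using degree_mult[OF gc(1) g(3) gc(4) g(4)] g gc by simp
    then obtain g' r' where g': "g' \<in> carrier PR" "r' \<in> carrier PR" "pirreducible (carrier R) g'" "r = g' \<otimes>\<^bsub>PR\<^esub> r'" "r' \<noteq> []"
      "k.eval (map h g') a = \<zero>\<^bsub>k\<^esub>" using less.hyps[of r] g 2 by blast
    have "f = g' \<otimes>\<^bsub>PR\<^esub> (g \<otimes>\<^bsub>PR\<^esub> r')" unfolding g(5) g'(4) using gc g' by (intro P.m_lcomm) auto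
    moreover have "g \<otimes>\<^bsub>PR\<^esub> r' \<in> carrier PR" "g \<otimes>\<^bsub>PR\<^esub> r' \<noteq> []" using PR_mult_nz gc g' by auto
    ultimately show ?thesis using g' by blast
  qed
qed

text \<open>A multiple root would come either from one irreducible factor, whose roots are simple,
  or from two irreducible factors with a common root. The latter are associated, so the square of
  one of them divides f.\<close>

lemma squarefree_simple_roots:
  assumes f: "f \<in> carrier PR" "f \<noteq> []" and sqf: "squarefree_poly R f" and a: "a \<in> carrier k"
  shows "k.alg_mult (map h f) a \<le> 1"
proof (cases "k.eval (map h f) a = \<zero>\<^bsub>k\<^esub>")
  case False
  then show ?thesis using k.alg_mult_gt_zero_iff_is_root[of "map h f" a] f by (simp add: k.is_root_def)
next
  case True
  obtain g r where g: "g \<in> carrier PR" "r \<in> carrier PR" "pirreducible (carrier R) g" "f = g \<otimes>\<^bsub>PR\<^esub> r" "r \<noteq> []" "k.eval (map h g) a = \<zero>\<^bsub>k\<^esub>"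
    using exists_irreducible_factor_root[OF f a True] by blast
  have g_nz: "g \<noteq> []" using pirreducibleE(1)[OF carrier_is_subring g(1,3)] .
  have "k.eval (map h r) a \<noteq> \<zero>\<^bsub>k\<^esub>"
  proof
    assume "k.eval (map h r) a = \<zero>\<^bsub>k\<^esub>"
    then obtain g' r' where g': "g' \<in> carrier PR" "r' \<in> carrier PR" "pirreducible (carrier R) g'" "r = g' \<otimes>\<^bsub>PR\<^esub> r'"
      "k.eval (map h g') a = \<zero>\<^bsub>k\<^esub>"
      using exists_irreducible_factor_root[OF g(2,5) a] by blast
    have "g' \<sim>\<^bsub>PR\<^esub> g" by (rule common_root_associated[OF g'(1,3) g(1,3) a g'(5) g(6)])
    then obtain c where c: "c \<in> carrier R" "c \<noteq> \<zero>" "g' = [c] \<otimes>\<^bsub>PR\<^esub> g"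
      using associated_polynomials_iff[OF carrier_is_subfield g'(1) g(1)] by blast
    have "[c] \<in> carrier PR" using c by simp
    then have "f = (g \<otimes>\<^bsub>PR\<^esub> g) \<otimes>\<^bsub>PR\<^esub> ([c] \<otimes>\<^bsub>PR\<^esub> r')"
      unfolding g(4) g'(4) c(3) using g(1) g'(2) by (simp add: P.m_ac)
    then have "(g \<otimes>\<^bsub>PR\<^esub> g) divides\<^bsub>PR\<^esub> f" unfolding factor_def using c g' by auto
    then have "g \<in> Units PR" using sqf g(1) by (simp add: squarefree_poly_def)
    then show False using pirreducibleE(2)[OF carrier_is_subring g(1,3)] by simp
  qed
  then have "k.alg_mult (map h r) a = 0"
    using k.alg_mult_gt_zero_iff_is_root[of "map h r" a] g by (simp add: k.is_root_def)
  moreover have "k.alg_mult (map h f) a = k.alg_mult (map h g) a + k.alg_mult (map h r) a"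
    using M.hom_mult[OF g(1,2)] g g_nz by (simp add: k.alg_mult_mult)
  ultimately show ?thesis using irreducible_simple_roots(2)[OF g(1,3) a] by simp
qed

end

section \<open>Polynomials with few irreducible factors\<close>

text \<open>The upper bounds obtained by iterating the recursive estimate for the proportions. At n
  = 0 the positive case has the value 0, which is right: a product with at least one irreducible
  factor is not constant.\<close>

primrec few_factors_bound :: "nat \<Rightarrow> nat \<Rightarrow> real" where
  "few_factors_bound 0 n = (if n = 0 then 1 else 0)"
| "few_factors_bound (Suc j) n = real (Suc j) / real n * (\<Sum>i<n. few_factors_bound j i)"

lemma few_factors_bound_nonneg: "0 \<le> few_factors_bound j n"
proof (induction j arbitrary: n)
  case (Suc j)
  have "0 \<le> (\<Sum>i<n. few_factors_bound j i)" by (intro sum_nonneg Suc)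
  then show ?case by simp
qed simp

lemma cesaro_mean_null:
  fixes x :: "nat \<Rightarrow> real"
  assumes "x \<longlonglongrightarrow> 0" "\<And>i. 0 \<le> x i"
  shows "(\<lambda>n. (\<Sum>i<n. x i) / real n) \<longlonglongrightarrow> 0"
proof (rule LIMSEQ_I)
  fix e :: real assume e: "0 < e"
  obtain N where N: "\<And>i. i \<ge> N \<Longrightarrow> x i < e / 2"
  proof -
    obtain N where "\<forall>i\<ge>N. norm (x i - 0) < e / 2" using LIMSEQ_D[OF assms(1), of "e / 2"] e by auto
    then have "x i < e / 2" if "i \<ge> N" for i using that assms(2)[of i] by auto
    then show thesis by (rule that)
  qed
  define C where "C = (\<Sum>i<N. x i)"
  have C: "0 \<le> C" unfolding C_def by (intro sum_nonneg assms)
  have le: "(\<Sum>i<n. x i) \<le> C + real n * (e / 2)" for n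
  proof -
    have "(\<Sum>i<n. x i) \<le> (\<Sum>i<n. (if i < N then x i else 0) + e / 2)"
      using N e by (intro sum_mono) (force simp: not_less intro: less_imp_le)
    also have "\<dots> = (\<Sum>i\<in>{..<n} \<inter> {..<N}. x i) + real n * (e / 2)"
      by (simp add: sum.distrib sum.If_cases lessThan_def)
    also have "(\<Sum>i\<in>{..<n} \<inter> {..<N}. x i) \<le> C" unfolding C_def by (intro sum_mono2) (use assms in auto)
    finally show ?thesis by simp
  qed
  obtain M where M: "2 * C / e < real M" using reals_Archimedean2 by blast
  show "\<exists>no. \<forall>n\<ge>no. norm ((\<Sum>i<n. x i) / real n - 0) < e"
  proof (intro exI[of _ "Suc M"] allI impI)
    fix n assume n: "Suc M \<le> n"
    then have npos: "real n > 0" and "2 * C / e < real n" using M by auto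
    then have "C < real n * (e / 2)" using e by (simp add: field_simps)
    then have "(\<Sum>i<n. x i) < real n * e" using le[of n] by (simp add: field_simps)
    moreover have "0 \<le> (\<Sum>i<n. x i)" by (intro sum_nonneg assms)
    ultimately show "norm ((\<Sum>i<n. x i) / real n - 0) < e" using npos by (simp add: field_simps)
  qed
qed

lemma few_factors_bound_tendsto_0: "few_factors_bound j \<longlonglongrightarrow> 0"
proof (induction j)
  case 0
  have "eventually (\<lambda>n. few_factors_bound 0 n = 0) sequentially"
    using eventually_gt_at_top[of 0] by eventually_elim simp
  then show ?case by (rule tendsto_eventually)
next
  case (Suc j)
  have "(\<lambda>n. real (Suc j) * ((\<Sum>i<n. few_factors_bound j i) / real n)) \<longlonglongrightarrow> real (Suc j) * 0"
    by (intro tendsto_intros cesaro_mean_null Suc few_factors_bound_nonneg)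
  then show ?case by (simp add: field_simps)
qed

section \<open>Counting polynomials by their number of irreducible factors\<close>

context finite_field_closure
begin

text \<open>The index is the number of irreducible factors, counted with multiplicity; the base case
  supplies the leading coefficient.\<close>

primrec factor_count :: "nat \<Rightarrow> 'a list set" where
  "factor_count 0 = polys 0"
| "factor_count (Suc j) = {g \<otimes>\<^bsub>PR\<^esub> r | g r. (\<exists>d\<ge>1. g \<in> monic_irr d) \<and> r \<in> factor_count j}"

lemma monic_irrD: assumes "g \<in> monic_irr d" shows "g \<in> carrier PR" "g \<noteq> []" "degree g = d"
  using assms by (auto simp: monic_irr_def polys_def)

lemma factor_countD: "f \<in> factor_count j \<Longrightarrow> f \<in> carrier PR \<and> f \<noteq> []"
proof (induction j arbitrary: f)
  case 0 then show ?case by (auto simp: polys_def)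
next
  case (Suc j)
  then obtain g r d where "g \<in> monic_irr d" "r \<in> factor_count j" "f = g \<otimes>\<^bsub>PR\<^esub> r" by auto
  then show ?case using Suc.IH[of r] monic_irrD[of g d] PR_mult_nz by simp
qed

lemma factor_count_SucE:
  assumes "f \<in> factor_count (Suc j)"
  obtains g r where "g \<in> carrier PR" "degree g > 0" "r \<in> factor_count j" "f = g \<otimes>\<^bsub>PR\<^esub> r"
proof -
  obtain d g r where *: "d \<ge> 1" "g \<in> monic_irr d" "r \<in> factor_count j" "f = g \<otimes>\<^bsub>PR\<^esub> r" using assms by auto
  then have "degree g > 0" "g \<in> carrier PR" using monic_irrD[OF *(2)] by auto
  then show ?thesis using that * by blast
qed

lemma factor_count_exists:
  assumes "f \<in> carrier PR" "f \<noteq> []" shows "\<exists>j. f \<in> factor_count j"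
  using assms
proof (induction "degree f" arbitrary: f rule: less_induct)
  case less
  show ?case
  proof (cases "degree f = 0")
    case True
    then have "f \<in> factor_count 0" using less.prems by (simp add: polys_def)
    then show ?thesis ..
  next
    case False
    then obtain d g r where g: "d \<ge> 1" "g \<in> monic_irr d" "r \<in> carrier PR" "r \<noteq> []" "f = g \<otimes>\<^bsub>PR\<^esub> r"
      using monic_irr_factor[OF less.prems(1)] by blast
    then have "degree r < degree f" using degree_mult[of g r] monic_irrD[OF g(2)] by simp
    then obtain j where "r \<in> factor_count j" using less.hyps g by blast
    then have "f \<in> factor_count (Suc j)" using g by auto
    then show ?thesis ..
  qed
qed

text \<open>Of j + 1 factors one has at least the average degree. If the factor g that is split off
  first is too small, the large factor g' of its cofactor takes its place, and g moves into the new
  cofactor.\<close>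

lemma factor_count_large_factor:
  assumes "f \<in> factor_count (Suc j)"
  shows "\<exists>d\<ge>1. \<exists>g\<in>monic_irr d. \<exists>r\<in>factor_count j. f = g \<otimes>\<^bsub>PR\<^esub> r \<and> degree f = d + degree r \<and> degree f \<le> Suc j * d"
  using assms
proof (induction j arbitrary: f)
  case 0
  then obtain d g r where *: "d \<ge> 1" "g \<in> monic_irr d" "r \<in> factor_count 0" "f = g \<otimes>\<^bsub>PR\<^esub> r" by auto
  have "degree f = d + degree r"
    using *(4) degree_mult[of g r] monic_irrD[OF *(2)] factor_countD[OF *(3)] by simp
  moreover have "degree r = 0" using *(3) by (simp add: polys_def)
  ultimately show ?case using * by (intro exI[of _ d]) auto
next
  case (Suc j)
  then obtain d g r where *: "d \<ge> 1" "g \<in> monic_irr d" "r \<in> factor_count (Suc j)" "f = g \<otimes>\<^bsub>PR\<^esub> r"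
    using factor_count.simps(2)[of "Suc j"] by blast
  have df: "degree f = d + degree r"
    using *(4) degree_mult[of g r] monic_irrD[OF *(2)] factor_countD[OF *(3)] by simp
  obtain d' g' r' where **: "d' \<ge> 1" "g' \<in> monic_irr d'" "r' \<in> factor_count j" "r = g' \<otimes>\<^bsub>PR\<^esub> r'"
    "degree r = d' + degree r'" "degree r \<le> Suc j * d'"
    using Suc.IH[OF *(3)] by blast
  show ?case
  proof (cases "degree f \<le> Suc (Suc j) * d")
    case True
    then show ?thesis using * df by blast
  next
    case False
    \<comment> \<open>The degree of f is at most d + (j + 1) d', so if it exceeds (j + 2) d, then d
      < d'.\<close>
    then have "Suc j * d < Suc j * d'" using df **(6) by simp
    then have "d < d'" using mult_less_cancel1 by blast
    then have le: "degree f \<le> Suc (Suc j) * d'" using df **(6) by simp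
    have c: "g \<in> carrier PR" "g \<noteq> []" "g' \<in> carrier PR" "r' \<in> carrier PR" "r' \<noteq> []"
      using monic_irrD[OF *(2)] monic_irrD[OF **(2)] factor_countD[OF **(3)] by auto
    have eq: "f = g' \<otimes>\<^bsub>PR\<^esub> (g \<otimes>\<^bsub>PR\<^esub> r')" unfolding *(4) **(4) using c by (intro P.m_lcomm) auto
    have mem: "g \<otimes>\<^bsub>PR\<^esub> r' \<in> factor_count (Suc j)" using * **(3) by auto
    have "degree (g \<otimes>\<^bsub>PR\<^esub> r') = d + degree r'" using degree_mult[of g r'] c monic_irrD[OF *(2)] by simp
    then have "degree f = d' + degree (g \<otimes>\<^bsub>PR\<^esub> r')" using df **(5) by simp
    then show ?thesis using **(1,2) eq mem le by blast
  qed
qed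

text \<open>The number of all polynomials of degree n is (q - 1) q^n. There are at most q^d/d
  choices for a split-off factor of degree d, and d can be taken with n \<le> (j + 1) d. Then 1/d
  \<le> (j + 1)/n turns the sum over d into the recursion of the bound.\<close>

lemma card_factor_count:
  "real (card (factor_count j \<inter> polys n)) \<le> few_factors_bound j n * (real (q - 1) * real q ^ n)"
proof (induction j arbitrary: n)
  case 0
  show ?case
  proof (cases "n = 0")
    case True then show ?thesis using card_polys(2)[OF fin, of 0] by simp
  next
    case False
    then have "polys 0 \<inter> polys n = {}" by (auto simp: polys_def)
    then show ?thesis using False by simp
  qed
next
  case (Suc j)
  let ?S = "\<lambda>j n. factor_count j \<inter> polys n"
  define D where "D = {d \<in> {1..n}. n \<le> Suc j * d}"
  have finS: "finite (?S i m)" for i m using card_polys(1)[OF fin] by blast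
  have sub: "?S (Suc j) n \<subseteq> (\<Union>d\<in>D. (\<lambda>(g, r). g \<otimes>\<^bsub>PR\<^esub> r) ` (monic_irr d \<times> ?S j (n - d)))"
  proof
    fix f assume f: "f \<in> ?S (Suc j) n"
    obtain d g r where *: "d \<ge> 1" "g \<in> monic_irr d" "r \<in> factor_count j" "f = g \<otimes>\<^bsub>PR\<^esub> r"
      "degree f = d + degree r" "degree f \<le> Suc j * d"
      using factor_count_large_factor[of f j] f by blast
    have "degree f = n" using f by (simp add: polys_def)
    then have "d \<in> D" "r \<in> ?S j (n - d)" using * factor_countD[OF *(3)] by (auto simp: D_def polys_def)
    then show "f \<in> (\<Union>d\<in>D. (\<lambda>(g, r). g \<otimes>\<^bsub>PR\<^esub> r) ` (monic_irr d \<times> ?S j (n - d)))" using * by force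
  qed
  have finD: "finite D" by (simp add: D_def)
  have "card (?S (Suc j) n) \<le> card (\<Union>d\<in>D. (\<lambda>(g, r). g \<otimes>\<^bsub>PR\<^esub> r) ` (monic_irr d \<times> ?S j (n - d)))"
    using finD finS card_monic_irr(1) by (intro card_mono[OF _ sub]) (auto simp: D_def)
  also have "\<dots> \<le> (\<Sum>d\<in>D. card ((\<lambda>(g, r). g \<otimes>\<^bsub>PR\<^esub> r) ` (monic_irr d \<times> ?S j (n - d))))"
    by (rule card_UN_le[OF finD])
  also have "\<dots> \<le> (\<Sum>d\<in>D. card (monic_irr d) * card (?S j (n - d)))"
  proof (rule sum_mono)
    fix d assume "d \<in> D"
    then have "finite (monic_irr d \<times> ?S j (n - d))" using card_monic_irr(1)[of d] finS by (simp add: D_def)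
    then show "card ((\<lambda>(g, r). g \<otimes>\<^bsub>PR\<^esub> r) ` (monic_irr d \<times> ?S j (n - d))) \<le> card (monic_irr d) * card (?S j (n - d))"
      using card_image_le[of "monic_irr d \<times> ?S j (n - d)" "\<lambda>(g, r). g \<otimes>\<^bsub>PR\<^esub> r"] by (simp add: card_cartesian_product)
  qed
  finally have "real (card (?S (Suc j) n)) \<le> (\<Sum>d\<in>D. real (card (monic_irr d)) * real (card (?S j (n - d))))"
    by (simp only: of_nat_le_iff[where 'a = real, symmetric] of_nat_sum of_nat_mult)
  also have "\<dots> \<le> (\<Sum>d\<in>D. real (Suc j) / real n * few_factors_bound j (n - d) * (real (q - 1) * real q ^ n))"
  proof (rule sum_mono)
    fix d assume "d \<in> D"
    then have d: "1 \<le> d" "d \<le> n" "n \<le> Suc j * d" by (auto simp: D_def)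
    have "real (d * card (monic_irr d)) \<le> real (q ^ d)" using card_monic_irr(2)[OF d(1)] by (rule of_nat_mono)
    then have 1: "real (card (monic_irr d)) \<le> real q ^ d / real d" using d by (simp add: field_simps)
    have "real n \<le> real (Suc j) * real d" using of_nat_mono[OF d(3), where 'a = real] by (simp only: of_nat_mult)
    then have 2: "1 / real d \<le> real (Suc j) / real n" using d by (simp add: field_simps)
    have "real (card (monic_irr d)) * real (card (?S j (n - d)))
       \<le> (real q ^ d / real d) * (few_factors_bound j (n - d) * (real (q - 1) * real q ^ (n - d)))"
      using 1 Suc.IH[of "n - d"] by (intro mult_mono) auto
    also have "\<dots> = 1 / real d * (few_factors_bound j (n - d) * (real (q - 1) * (real q ^ d * real q ^ (n - d))))" by simp
    also have "real q ^ d * real q ^ (n - d) = real q ^ n" using d by (simp add: power_add[symmetric])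
    also have "1 / real d * (few_factors_bound j (n - d) * (real (q - 1) * real q ^ n))
       \<le> real (Suc j) / real n * (few_factors_bound j (n - d) * (real (q - 1) * real q ^ n))"
      using 2 few_factors_bound_nonneg[of j "n - d"] by (intro mult_right_mono) auto
    finally show "real (card (monic_irr d)) * real (card (?S j (n - d)))
       \<le> real (Suc j) / real n * few_factors_bound j (n - d) * (real (q - 1) * real q ^ n)" by (simp only: mult.assoc)
  qed
  also have "\<dots> \<le> (\<Sum>d\<in>{1..n}. real (Suc j) / real n * few_factors_bound j (n - d) * (real (q - 1) * real q ^ n))"
    by (intro sum_mono2) (auto simp: D_def intro!: divide_nonneg_nonneg mult_nonneg_nonneg few_factors_bound_nonneg)
  also have "\<dots> = real (Suc j) / real n * (\<Sum>d\<in>{1..n}. few_factors_bound j (n - d)) * (real (q - 1) * real q ^ n)"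
    by (simp only: sum_distrib_left sum_distrib_right)
  also have "(\<Sum>d\<in>{1..n}. few_factors_bound j (n - d)) = (\<Sum>i<n. few_factors_bound j i)"
    by (rule sum.reindex_bij_witness[of _ "\<lambda>i. n - i" "\<lambda>d. n - d"]) auto
  finally show ?case by (simp only: few_factors_bound.simps)
qed

section \<open>The proportion of square-free polynomials\<close>

definition squarefrees where "squarefrees n = {f \<in> polys n. squarefree_poly R f}"

lemma geometric_sum_identity:
  "m \<le> n \<Longrightarrow> (q - 1) * (\<Sum>d\<in>{1..m}. q ^ (n - d)) + q ^ (n - m) = q ^ n"
proof (induction m)
  case (Suc m)
  then have "q ^ (n - m) = q * q ^ (n - Suc m)" using power_Suc[of q "n - Suc m"] by (simp add: Suc_diff_Suc)
  moreover have "q = (q - 1) + 1" using q_ge_2 by simp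
  ultimately have "(q - 1) * q ^ (n - Suc m) + q ^ (n - Suc m) = q ^ (n - m)"
    by (metis distrib_right mult_1)
  then show ?case using Suc by (simp add: distrib_left)
qed simp

text \<open>A polynomial that is not square-free has the form g^2 r with g monic of some degree d
  \<ge> 1, which leaves at most q^d (q - 1) q^(n - 2d) possibilities for each d. The sum over d is
  at most q^n, and for q \<ge> 3 this is at most half of (q - 1) q^n.\<close>

lemma card_squarefrees:
  assumes q3: "q \<ge> 3"
  shows "(q - 1) * q ^ n \<le> 2 * card (squarefrees n)"
proof -
  let ?M = "\<lambda>d. (\<lambda>l. \<one> # l) ` {l. set l \<subseteq> carrier R \<and> length l = d}"
  let ?B = "\<lambda>d. (\<lambda>(g, r). (g \<otimes>\<^bsub>PR\<^esub> g) \<otimes>\<^bsub>PR\<^esub> r) ` (?M d \<times> polys (n - 2 * d))"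
  have finM: "finite (?M d)" "card (?M d) = q ^ d" for d
    using card_lists_length_eq[OF fin, of d] finite_lists_length_eq[OF fin, of d]
    by (auto simp: card_image inj_on_def)
  have sub: "polys n - squarefrees n \<subseteq> (\<Union>d\<in>{1..n div 2}. ?B d)"
  proof
    fix f assume f: "f \<in> polys n - squarefrees n"
    then have fc: "f \<in> carrier PR" "f \<noteq> []" "degree f = n" by (auto simp: polys_def)
    obtain a where a: "a \<in> carrier PR" "(a \<otimes>\<^bsub>PR\<^esub> a) divides\<^bsub>PR\<^esub> f" "a \<notin> Units PR"
      using f by (auto simp: squarefrees_def squarefree_poly_def)
    obtain r where r: "r \<in> carrier PR" "f = (a \<otimes>\<^bsub>PR\<^esub> a) \<otimes>\<^bsub>PR\<^esub> r" using a(2) unfolding factor_def by blast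
    have "a \<otimes>\<^bsub>PR\<^esub> a \<noteq> []" "r \<noteq> []"
      using r fc(2) a(1) P.l_null[of r] P.r_null[of "a \<otimes>\<^bsub>PR\<^esub> a"] by (auto simp: univ_poly_zero)
    then have a_nz: "a \<noteq> []" using a(1) P.l_null[of a] by (auto simp: univ_poly_zero)
    obtain c g where g: "c \<in> carrier R" "c \<noteq> \<zero>" "g \<in> carrier PR" "a = [c] \<otimes>\<^bsub>PR\<^esub> g" "lead_coeff g = \<one>" "degree g = degree a" "g \<noteq> []"
      using monic_part[OF a(1) a_nz] by blast
    \<comment> \<open>The square of the leading coefficient of a goes into the cofactor, so that
      only monic g have to be counted.\<close>
    let ?r = "([c] \<otimes>\<^bsub>PR\<^esub> [c]) \<otimes>\<^bsub>PR\<^esub> r"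
    have cc: "[c] \<in> carrier PR" using g by simp
    have eq: "f = (g \<otimes>\<^bsub>PR\<^esub> g) \<otimes>\<^bsub>PR\<^esub> ?r" unfolding r(2) g(4) using cc g(3) r(1) by (simp add: P.m_ac)
    have rr: "?r \<in> carrier PR" "?r \<noteq> []" using cc r(1) \<open>r \<noteq> []\<close> PR_mult_nz by simp_all
    have dg: "degree g \<ge> 1" using univ_poly_units'[OF carrier_is_subfield, of a] a(1,3) a_nz g(6) by simp
    have "degree ((g \<otimes>\<^bsub>PR\<^esub> g) \<otimes>\<^bsub>PR\<^esub> ?r) = 2 * degree g + degree ?r"
      using degree_mult[of "g \<otimes>\<^bsub>PR\<^esub> g" ?r] degree_mult[of g g] g(3,7) rr PR_mult_nz[of g g] by simp
    then have deg: "n = 2 * degree g + degree ?r" using eq fc(3) by simp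
    have "g \<in> ?M (degree g)" using g(3,5,7) by (cases g) (auto simp: univ_poly_def polynomial_def)
    moreover have "?r \<in> polys (n - 2 * degree g)" using rr deg by (simp add: polys_def)
    ultimately have "f \<in> ?B (degree g)" using eq by (intro image_eqI[of _ _ "(g, ?r)"]) auto
    moreover have "degree g \<in> {1..n div 2}" using dg deg by auto
    ultimately show "f \<in> (\<Union>d\<in>{1..n div 2}. ?B d)" by blast
  qed
  have finB: "finite (?M d \<times> polys m)" for d m using finM card_polys(1)[OF fin] by simp
  have "card (polys n - squarefrees n) \<le> card (\<Union>d\<in>{1..n div 2}. ?B d)"
    using finB by (intro card_mono[OF _ sub]) auto
  also have "\<dots> \<le> (\<Sum>d\<in>{1..n div 2}. card (?B d))" by (rule card_UN_le) simp
  also have "\<dots> \<le> (\<Sum>d\<in>{1..n div 2}. (q - 1) * q ^ (n - d))"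
  proof (rule sum_mono)
    fix d assume d: "d \<in> {1..n div 2}"
    have "card (?B d) \<le> card (?M d \<times> polys (n - 2 * d))" by (rule card_image_le[OF finB])
    also have "\<dots> = (q - 1) * (q ^ d * q ^ (n - 2 * d))"
      using finM(2)[of d] card_polys(2)[OF fin, of "n - 2 * d"] by (simp add: card_cartesian_product)
    also have "q ^ d * q ^ (n - 2 * d) = q ^ (n - d)"
    proof -
      have "d + (n - 2 * d) = n - d" using d by auto
      then show ?thesis by (simp only: power_add[symmetric])
    qed
    finally show "card (?B d) \<le> (q - 1) * q ^ (n - d)" .
  qed
  also have "\<dots> = (q - 1) * (\<Sum>d\<in>{1..n div 2}. q ^ (n - d))" by (simp only: sum_distrib_left)
  also have "\<dots> \<le> q ^ n" using geometric_sum_identity[of "n div 2" n] by simp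
  finally have C: "card (polys n - squarefrees n) \<le> q ^ n" .
  have "squarefrees n \<subseteq> polys n" by (auto simp: squarefrees_def)
  then have "card (polys n) = card (polys n - squarefrees n) + card (squarefrees n)"
    using card_polys(1)[OF fin, of n] card_Diff_subset[of "squarefrees n" "polys n"] card_mono[of "polys n" "squarefrees n"] finite_subset
    by fastforce
  then have "(q - 1) * q ^ n \<le> q ^ n + card (squarefrees n)" using C card_polys(2)[OF fin, of n] by simp
  moreover have "2 * q ^ n \<le> (q - 1) * q ^ n" using q3 by (intro mult_right_mono) auto
  ultimately show ?thesis by linarith
qed

text \<open>The factor 2 is the price of passing from all polynomials of degree n to the square-free
  ones.\<close>

lemma few_factors_proportion:
  assumes q3: "q \<ge> 3"
  shows "card (squarefrees n) > 0"
    "real (card {f \<in> squarefrees n. \<exists>j<J. f \<in> factor_count j}) / real (card (squarefrees n))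
       \<le> 2 * (\<Sum>j<J. few_factors_bound j n)"
proof -
  let ?T = "(q - 1) * q ^ n"
  have T: "?T > 0" using q_ge_2 by simp
  have sf: "?T \<le> 2 * card (squarefrees n)" by (rule card_squarefrees[OF q3])
  then show pos: "card (squarefrees n) > 0" using T by linarith
  have "{f \<in> squarefrees n. \<exists>j<J. f \<in> factor_count j} \<subseteq> (\<Union>j<J. factor_count j \<inter> polys n)"
    by (auto simp: squarefrees_def)
  then have "card {f \<in> squarefrees n. \<exists>j<J. f \<in> factor_count j} \<le> card (\<Union>j<J. factor_count j \<inter> polys n)"
    using card_polys(1)[OF fin, of n] by (intro card_mono) auto
  also have "\<dots> \<le> (\<Sum>j<J. card (factor_count j \<inter> polys n))" by (rule card_UN_le) simp
  finally have "real (card {f \<in> squarefrees n. \<exists>j<J. f \<in> factor_count j}) \<le> (\<Sum>j<J. real (card (factor_count j \<inter> polys n)))"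
    by (simp only: of_nat_le_iff[where 'a = real, symmetric] of_nat_sum)
  also have "\<dots> \<le> (\<Sum>j<J. few_factors_bound j n * real ?T)"
    using card_factor_count[of _ n] by (intro sum_mono) simp
  also have "\<dots> = (\<Sum>j<J. few_factors_bound j n) * real ?T" by (simp only: sum_distrib_right)
  also have "\<dots> \<le> (\<Sum>j<J. few_factors_bound j n) * real (2 * card (squarefrees n))"
    using sf by (intro mult_left_mono of_nat_mono sum_nonneg few_factors_bound_nonneg)
  finally show "real (card {f \<in> squarefrees n. \<exists>j<J. f \<in> factor_count j}) / real (card (squarefrees n))
       \<le> 2 * (\<Sum>j<J. few_factors_bound j n)" using pos by (simp add: field_simps)
qed

end

section \<open>Rational points of the Jacobian\<close>

lemma (in finite_field_closure) h_nz: "a \<in> carrier R \<Longrightarrow> h a = \<zero>\<^bsub>k\<^esub> \<longleftrightarrow> a = \<zero>"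
  using non_trivial_field_hom_is_inj[OF h_hom field_axioms k.field_axioms]
    ring_hom_zero[OF h_hom ring_axioms k.ring_axioms] zero_closed by (metis inj_onD)

text \<open>Every polynomial is a sum of constants times powers of X. This will show that a Galois
  element, which fixes the constants from F_p and x, fixes all polynomials over F_p.\<close>

lemma (in field) hom_eq_on_generators:
  assumes h: "ring_hom_ring PR A h" and g: "ring_hom_ring PR A g"
    and c: "\<And>c. \<lbrakk>c \<in> carrier R; c \<noteq> \<zero>\<rbrakk> \<Longrightarrow> h [c] = g [c]" and X: "h X = g X" and p: "p \<in> carrier PR"
  shows "h p = g p"
proof -
  interpret H: ring_hom_ring PR A h by (rule h)
  interpret G: ring_hom_ring PR A g by (rule g)
  have "set p \<subseteq> carrier R" using p by (auto simp: univ_poly_def polynomial_def)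
  then have t: "fst t \<in> carrier R \<and> fst t \<noteq> \<zero>" if "t \<in> set (dense_repr p)" for t
    using dense_repr_set_fst[of p "carrier R"] that by blast
  show ?thesis
    unfolding hom_var_pow_finsum[OF carrier_is_subring p h] hom_var_pow_finsum[OF carrier_is_subring p g]
  proof (rule H.S.finsum_cong'[OF refl])
    show "(\<lambda>t. g [fst t] \<otimes>\<^bsub>A\<^esub> g X [^]\<^bsub>A\<^esub> snd t) \<in> set (dense_repr p) \<rightarrow> carrier A"
      using t by auto
    show "h [fst t] \<otimes>\<^bsub>A\<^esub> h X [^]\<^bsub>A\<^esub> snd t = g [fst t] \<otimes>\<^bsub>A\<^esub> g X [^]\<^bsub>A\<^esub> snd t" if "t \<in> set (dense_repr p)" for t
      using t[OF that] c X by simp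
  qed
qed

text \<open>Four irreducible factors are split off, and the fifth entry collects everything that
  remains.\<close>

lemma five_factors:
  assumes ff: "finite_field_closure R L h"
    and f: "f \<in> finite_field_closure.factor_count R j" "j \<ge> 5"
  shows "\<exists>G. (\<forall>i<5. G i \<in> carrier (poly_ring R) \<and> degree (G i) > 0) \<and>
    f = G 0 \<otimes>\<^bsub>poly_ring R\<^esub> (G 1 \<otimes>\<^bsub>poly_ring R\<^esub> (G 2 \<otimes>\<^bsub>poly_ring R\<^esub> (G 3 \<otimes>\<^bsub>poly_ring R\<^esub> G (4::nat))))"
proof -
  interpret finite_field_closure R L h by fact
  obtain i where "j = 5 + i" using f(2) by (auto simp: le_iff_add)
  then have i: "j = Suc (Suc (Suc (Suc (Suc i))))" by simp
  obtain g0 r0 where 0: "g0 \<in> carrier PR" "degree g0 > 0" "r0 \<in> factor_count (Suc (Suc (Suc (Suc i))))" "f = g0 \<otimes>\<^bsub>PR\<^esub> r0"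
    using factor_count_SucE f(1) unfolding i by blast
  obtain g1 r1 where 1: "g1 \<in> carrier PR" "degree g1 > 0" "r1 \<in> factor_count (Suc (Suc (Suc i)))" "r0 = g1 \<otimes>\<^bsub>PR\<^esub> r1"
    using factor_count_SucE[OF 0(3)] by blast
  obtain g2 r2 where 2: "g2 \<in> carrier PR" "degree g2 > 0" "r2 \<in> factor_count (Suc (Suc i))" "r1 = g2 \<otimes>\<^bsub>PR\<^esub> r2"
    using factor_count_SucE[OF 1(3)] by blast
  obtain g3 r3 where 3: "g3 \<in> carrier PR" "degree g3 > 0" "r3 \<in> factor_count (Suc i)" "r2 = g3 \<otimes>\<^bsub>PR\<^esub> r3"
    using factor_count_SucE[OF 2(3)] by blast
  obtain g4 r4 where 4: "g4 \<in> carrier PR" "degree g4 > 0" "r4 \<in> factor_count i" "r3 = g4 \<otimes>\<^bsub>PR\<^esub> r4"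
    using factor_count_SucE[OF 3(3)] by blast
  have r3: "r3 \<in> carrier PR" using factor_countD[OF 3(3)] by blast
  have "degree r3 > 0"
    using degree_mult[of g4 r4] 4 factor_countD[OF 4(3)] by fastforce
  then show ?thesis using 0 1 2 3 r3
    by (intro exI[of _ "\<lambda>i. [g0, g1, g2, g3, r3] ! i"]) (auto simp: less_Suc_eq numeral_eq_Suc)
qed

text \<open>The curve becomes an instance of the abstract setting once f is read over the algebraic
  closure, where square-freeness turns into simplicity of the roots. The five factors keep
  coefficients in F_p, and this makes their divisors Galois-invariant.\<close>

lemma not_prime_card_jacobian:
  fixes G :: "nat \<Rightarrow> int list"
  assumes p: "Factorial_Ring.prime p" "2 < p"
    and G: "\<And>i. i < 5 \<Longrightarrow> G i \<in> carrier (poly_ring (Fp p))" "\<And>i. i < 5 \<Longrightarrow> degree (G i) > 0"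
    and f_def: "f = G 0 \<otimes>\<^bsub>poly_ring (Fp p)\<^esub> (G 1 \<otimes>\<^bsub>poly_ring (Fp p)\<^esub> (G 2 \<otimes>\<^bsub>poly_ring (Fp p)\<^esub> (G 3 \<otimes>\<^bsub>poly_ring (Fp p)\<^esub> G 4)))"
    and sqf: "squarefree_poly (Fp p) f" and even: "even (degree f)"
    and ff: "finite_field_closure (Fp p) (Fpbar p) (Fp_emb p)"
  shows "\<not> Factorial_Ring.prime (card (jacobian_rational_points p f))"
proof -
  interpret C: finite_field_closure "Fp p" "Fpbar p" "Fp_emb p" by (rule ff)
  let ?P = "poly_ring (Fp p)" and ?h = "Fp_emb p"
  have Gnz: "G i \<noteq> []" if "i < 5" for i using G(2)[OF that] by auto
  have Gc: "G 0 \<in> carrier ?P" "G 1 \<in> carrier ?P" "G 2 \<in> carrier ?P" "G 3 \<in> carrier ?P" "G 4 \<in> carrier ?P"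
    and Gn: "G 0 \<noteq> []" "G 1 \<noteq> []" "G 2 \<noteq> []" "G 3 \<noteq> []" "G 4 \<noteq> []" using G Gnz by auto
  have f: "f \<in> carrier ?P" "f \<noteq> []" unfolding f_def using Gc Gn C.PR_mult_nz by simp_all
  have "degree f = degree (G 0) + (degree (G 1) + (degree (G 2) + (degree (G 3) + degree (G 4))))"
    unfolding f_def using Gc Gn by (simp add: C.degree_mult C.PR_mult_nz del: One_nat_def)
  then have f_pos: "degree f > 0" using G(2)[of 0] by simp
  let ?f = "map ?h f" and ?g = "\<lambda>i. map ?h (G i)"
  have fh: "?f \<in> carrier C.k.PR" using f by simp
  have two: "\<one>\<^bsub>Fpbar p\<^esub> \<oplus>\<^bsub>Fpbar p\<^esub> \<one>\<^bsub>Fpbar p\<^esub> \<noteq> \<zero>\<^bsub>Fpbar p\<^esub>"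
  proof -
    have "\<one>\<^bsub>Fp p\<^esub> \<oplus>\<^bsub>Fp p\<^esub> \<one>\<^bsub>Fp p\<^esub> \<noteq> \<zero>\<^bsub>Fp p\<^esub>" using p(2) by (simp add: residue_ring_def)
    then have "?h (\<one>\<^bsub>Fp p\<^esub> \<oplus>\<^bsub>Fp p\<^esub> \<one>\<^bsub>Fp p\<^esub>) \<noteq> \<zero>\<^bsub>Fpbar p\<^esub>" using C.h_nz by simp
    then show ?thesis using ring_hom_add[OF C.h_hom C.one_closed C.one_closed] ring_hom_one[OF C.h_hom] by simp
  qed
  have simple: "C.k.alg_mult ?f a \<le> 1" if "a \<in> carrier (Fpbar p)" for a
    by (rule C.squarefree_simple_roots[OF f sqf that])
  \<comment> \<open>The abstract constructions over \<open>Fpbar p\<close> agree with the concrete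
    ones, layer by layer.\<close>
  have Fx: "C.k.Fx = Fpbar_x p" by (simp add: C.k.Fx_def Fpbar_x_def)
  have emb: "C.k.emb q = Fpbar_x_of_poly p q" for q by (simp add: C.k.emb_def Fpbar_x_of_poly_def)
  have cpoly: "C.k.cpoly ?f = curve_poly p f" by (simp add: C.k.cpoly_def curve_poly_def Fx emb)
  have FF: "C.k.FF ?f = function_field p f" by (simp add: C.k.FF_def function_field_def Fx cpoly)
  have cls: "C.k.cls ?f q = ff_class p f q" for q by (simp add: C.k.cls_def ff_class_def Fx cpoly)
  have ofp: "C.k.of_poly ?f = ff_of_poly p f" by (rule ext) (simp add: C.k.of_poly_def ff_of_poly_def Fx cls emb)
  have "hyperelliptic (Fpbar p) (C.k.FF ?f) (C.k.of_poly ?f) (C.k.cls ?f X\<^bsub>C.k.Fx\<^esub>) ?f"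
    using f_pos even simple two fh by (intro C.k.hyperelliptic_function_field) auto
  then have hyp: "hyperelliptic (Fpbar p) (function_field p f) (ff_of_poly p f) (ff_y p f) ?f"
    by (simp only: FF ofp cls Fx ff_y_def)
  interpret H: hyperelliptic "Fpbar p" "function_field p f" "ff_of_poly p f" "ff_y p f" ?f by (rule hyp)
  have constants: "H.constants = ff_consts p f"
    by (simp add: H.constants_def ff_const_def[abs_def])
  have J: "jacobian_rational_points p f = H.invariant_classes (galois_group p f)"
    unfolding jacobian_rational_points_def H.invariant_classes_def constants ..
  have gal: "H.aut \<tau>" if "\<tau> \<in> galois_group p f" for \<tau>
    using that by (simp add: H.aut_def galois_group_def constants)
  \<comment> \<open>Both maps are homomorphisms on the polynomials over F_p, and they agree on
    constants and on X.\<close>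
  have fixed: "\<tau> (ff_of_poly p f (map ?h q)) = ff_of_poly p f (map ?h q)" if t: "\<tau> \<in> galois_group p f" and q: "q \<in> carrier ?P" for \<tau> q
  proof -
    have h1: "ff_of_poly p f \<circ> map ?h \<in> ring_hom ?P (function_field p f)"
      using ring_hom_trans[OF C.M.homh H.hom] .
    have th: "\<tau> \<in> ring_hom (function_field p f) (function_field p f)" using t by (simp add: galois_group_def ring_iso_def)
    have h2: "\<tau> \<circ> (ff_of_poly p f \<circ> map ?h) \<in> ring_hom ?P (function_field p f)"
      using ring_hom_trans[OF h1 th] .
    have "(\<tau> \<circ> (ff_of_poly p f \<circ> map ?h)) q = (ff_of_poly p f \<circ> map ?h) q"
    proof (rule C.hom_eq_on_generators[OF _ _ _ _ q])
      show "ring_hom_ring ?P (function_field p f) (\<tau> \<circ> (ff_of_poly p f \<circ> map ?h))"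
        by (rule ring_hom_ringI2[OF C.P.ring_axioms H.ring_axioms h2])
      show "ring_hom_ring ?P (function_field p f) (ff_of_poly p f \<circ> map ?h)"
        by (rule ring_hom_ringI2[OF C.P.ring_axioms H.ring_axioms h1])
      have "map ?h X\<^bsub>Fp p\<^esub> = X\<^bsub>Fpbar p\<^esub>"
        using ring_hom_one[OF C.h_hom] ring_hom_zero[OF C.h_hom C.ring_axioms C.k.ring_axioms] by (simp add: var_def)
      then show "(\<tau> \<circ> (ff_of_poly p f \<circ> map ?h)) X\<^bsub>Fp p\<^esub> = (ff_of_poly p f \<circ> map ?h) X\<^bsub>Fp p\<^esub>"
        using t by (simp add: galois_group_def ff_x_def)
      fix c assume c: "c \<in> carrier (Fp p)" "c \<noteq> \<zero>\<^bsub>Fp p\<^esub>"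
      then have "C.k.poly_of_const (?h c) = [?h c]" using C.h_nz[OF c(1)] by (simp add: C.k.poly_of_const_def)
      moreover have "\<tau> (ff_const p f (?h c)) = ff_const p f (?h c)" using t c(1) by (simp add: galois_group_def)
      ultimately show "(\<tau> \<circ> (ff_of_poly p f \<circ> map ?h)) [c] = (ff_of_poly p f \<circ> map ?h) [c]"
        by (simp add: ff_const_def)
    qed
    then show ?thesis by simp
  qed
  have gc: "?g 0 \<in> carrier C.k.PR" "?g 1 \<in> carrier C.k.PR" "?g 2 \<in> carrier C.k.PR" "?g 3 \<in> carrier C.k.PR" "?g 4 \<in> carrier C.k.PR"
    and gn: "?g 0 \<noteq> []" "?g 1 \<noteq> []" "?g 2 \<noteq> []" "?g 3 \<noteq> []" "?g 4 \<noteq> []" using Gc Gn by (auto simp del: One_nat_def)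
  have fg: "?f = ?g 0 \<otimes>\<^bsub>C.k.PR\<^esub> (?g 1 \<otimes>\<^bsub>C.k.PR\<^esub> (?g 2 \<otimes>\<^bsub>C.k.PR\<^esub> (?g 3 \<otimes>\<^bsub>C.k.PR\<^esub> ?g 4)))"
    unfolding f_def using Gc by (simp del: One_nat_def)
  have mult: "C.k.alg_mult ?f a = (\<Sum>i<5. C.k.alg_mult (?g i) a)" for a
  proof -
    have "C.k.alg_mult ?f a = C.k.alg_mult (?g 0) a + (C.k.alg_mult (?g 1) a + (C.k.alg_mult (?g 2) a
        + (C.k.alg_mult (?g 3) a + C.k.alg_mult (?g 4) a)))"
      unfolding fg using gc gn by (simp add: C.k.alg_mult_mult C.k.PR_mult_nz del: One_nat_def)
    also have "\<dots> = (\<Sum>i<5. C.k.alg_mult (?g i) a)" by (simp add: eval_nat_numeral)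
    finally show ?thesis .
  qed
  have branch: "H.branch (?g i)" if i: "i < 5" for i
  proof -
    have b: "H.branch u" if "u \<in> carrier C.k.PR" "u \<noteq> []" "w \<in> carrier C.k.PR" "?f = u \<otimes>\<^bsub>C.k.PR\<^esub> w" for u w
      using that unfolding H.branch_def by blast
    have "?f = ?g 1 \<otimes>\<^bsub>C.k.PR\<^esub> (?g 0 \<otimes>\<^bsub>C.k.PR\<^esub> (?g 2 \<otimes>\<^bsub>C.k.PR\<^esub> (?g 3 \<otimes>\<^bsub>C.k.PR\<^esub> ?g 4)))"
      unfolding fg using gc by (intro H.P.m_lcomm C.k.PR_closed)
    moreover have "?f = ?g 2 \<otimes>\<^bsub>C.k.PR\<^esub> (?g 0 \<otimes>\<^bsub>C.k.PR\<^esub> (?g 1 \<otimes>\<^bsub>C.k.PR\<^esub> (?g 3 \<otimes>\<^bsub>C.k.PR\<^esub> ?g 4)))"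
      "?f = ?g 3 \<otimes>\<^bsub>C.k.PR\<^esub> (?g 0 \<otimes>\<^bsub>C.k.PR\<^esub> (?g 1 \<otimes>\<^bsub>C.k.PR\<^esub> (?g 2 \<otimes>\<^bsub>C.k.PR\<^esub> ?g 4)))"
      "?f = ?g 4 \<otimes>\<^bsub>C.k.PR\<^esub> (?g 0 \<otimes>\<^bsub>C.k.PR\<^esub> (?g 1 \<otimes>\<^bsub>C.k.PR\<^esub> (?g 2 \<otimes>\<^bsub>C.k.PR\<^esub> ?g 3)))"
      unfolding fg using gc by algebra+
    moreover have "i = 0 \<or> i = 1 \<or> i = 2 \<or> i = 3 \<or> i = 4" using i by linarith
    ultimately show ?thesis
      using b[OF gc(1) gn(1) _ fg] b[OF gc(2) gn(2)] b[OF gc(3) gn(3)] b[OF gc(4) gn(4)] b[OF gc(5) gn(5)] gc C.k.PR_closed(1)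
      by metis
  qed
  show ?thesis unfolding J
  proof (rule H.five_factors_not_prime[of ?g])
    show "H.branch (?g i)" if "i < 5" for i by (rule branch[OF that])
    show "degree (?g i) > 0" if "i < 5" for i using G(2)[OF that] by simp
    show "C.k.alg_mult (?g i) a + C.k.alg_mult (?g j) a \<le> C.k.alg_mult ?f a" if "i < j" "j < 5" for i j a
    proof -
      have "(\<Sum>m\<in>{i, j}. C.k.alg_mult (?g m) a) \<le> (\<Sum>m<5. C.k.alg_mult (?g m) a)"
        by (rule sum_mono2) (use that in auto)
      then show ?thesis using that mult[of a] by simp
    qed
    show "H.aut \<tau> \<and> \<tau> (ff_of_poly p f (?g i)) = ff_of_poly p f (?g i)" if "\<tau> \<in> galois_group p f" "i < 5" for \<tau> i
      using gal[OF that(1)] fixed[OF that(1) G(1)[OF that(2)]] by blast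
  qed
qed

lemma finite_field_closure_Fp:
  assumes "Factorial_Ring.prime p"
  shows "finite_field_closure (Fp p) (Fpbar p) (Fp_emb p)" "card (carrier (Fp p)) = p"
proof -
  have rp: "residues_prime p" using assms by unfold_locales
  interpret F: field "Fp p" by (rule residues_prime.is_field[OF rp])
  interpret A: algebraic_closure "Fpbar p" "Fp_emb p ` carrier (Fp p)" by (rule F.alg_closureE(1))
  have fin: "finite (carrier (Fp p))" by (simp add: residue_ring_def)
  show "finite_field_closure (Fp p) (Fpbar p) (Fp_emb p)"
    by (intro finite_field_closure.intro finite_field_closure_axioms.intro F.field_axioms
        A.algebraically_closed_axioms fin F.alg_closureE(2))
  show "card (carrier (Fp p)) = p" by (simp add: residue_ring_def)
qed

lemma P2_bound:
  assumes p: "Factorial_Ring.prime p" "2 < p"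
  shows "0 \<le> P2 p g" "P2 p g \<le> 2 * (\<Sum>j<5. few_factors_bound j (2 * g + 2))"
proof -
  show "0 \<le> P2 p g" by (simp add: P2_def)
  let ?n = "2 * g + 2"
  note ff = finite_field_closure_Fp(1)[OF p(1)] and cp = finite_field_closure_Fp(2)[OF p(1)]
  interpret C: finite_field_closure "Fp p" "Fpbar p" "Fp_emb p" by (rule ff)
  have q3: "card (carrier (Fp p)) \<ge> 3" using cp p by simp
  have S: "squarefree_polys p ?n = C.squarefrees ?n"
    by (auto simp: squarefree_polys_def C.squarefrees_def C.polys_def)
  note pos = C.few_factors_proportion(1)[OF q3, of ?n] and bound = C.few_factors_proportion(2)[OF q3, of ?n 5]
  have fin: "finite (C.squarefrees ?n)" and ne: "C.squarefrees ?n \<noteq> {}" using pos by (auto simp: card_gt_0_iff)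
  let ?E = "{f. Factorial_Ring.prime (card (jacobian_rational_points p f))}"
  \<comment> \<open>With five or more irreducible factors the number of rational points is not
    prime.\<close>
  have sub: "C.squarefrees ?n \<inter> ?E \<subseteq> {f \<in> C.squarefrees ?n. \<exists>j<5. f \<in> C.factor_count j}"
  proof
    fix f assume f: "f \<in> C.squarefrees ?n \<inter> ?E"
    then have fs: "f \<in> carrier C.PR" "f \<noteq> []" "degree f = ?n" "squarefree_poly (Fp p) f"
      by (auto simp: C.squarefrees_def C.polys_def)
    obtain j where j: "f \<in> C.factor_count j" using C.factor_count_exists[OF fs(1,2)] by blast
    have "j < 5"
    proof (rule ccontr)
      assume "\<not> j < 5"
      then obtain G where "\<forall>i<5. G i \<in> carrier C.PR \<and> degree (G i) > 0"
        "f = G 0 \<otimes>\<^bsub>C.PR\<^esub> (G 1 \<otimes>\<^bsub>C.PR\<^esub> (G 2 \<otimes>\<^bsub>C.PR\<^esub> (G 3 \<otimes>\<^bsub>C.PR\<^esub> G (4::nat))))"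
        using five_factors[OF ff j] by (auto simp: not_less)
      then have "\<not> Factorial_Ring.prime (card (jacobian_rational_points p f))"
        using fs by (intro not_prime_card_jacobian[OF p _ _ _ _ _ ff]) auto
      then show False using f by simp
    qed
    then show "f \<in> {f \<in> C.squarefrees ?n. \<exists>j<5. f \<in> C.factor_count j}" using f j by blast
  qed
  have "P2 p g = real (card (C.squarefrees ?n \<inter> ?E)) / real (card (C.squarefrees ?n))"
    unfolding P2_def S by (rule measure_pmf_of_set[OF ne fin])
  also have "\<dots> \<le> real (card {f \<in> C.squarefrees ?n. \<exists>j<5. f \<in> C.factor_count j}) / real (card (C.squarefrees ?n))"
    using fin by (intro divide_right_mono of_nat_mono card_mono sub) auto
  also note bound
  finally show "P2 p g \<le> 2 * (\<Sum>j<5. few_factors_bound j ?n)" .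
qed

theorem theorem1p11:
  shows "((\<lambda>(p, g). P2 p g) \<longlongrightarrow> 0)
     (inf (at_top \<times>\<^sub>F at_top) (principal {(p, g). Factorial_Ring.prime p \<and> 2 < p \<and> 1 \<le> g}))"
proof -
  let ?F = "inf (at_top \<times>\<^sub>F at_top) (principal {(p::nat, g::nat). Factorial_Ring.prime p \<and> 2 < p \<and> 1 \<le> g})"
  let ?B = "\<lambda>g. 2 * (\<Sum>j<5. few_factors_bound j (2 * g + 2))"
  have "filterlim (\<lambda>g::nat. 2 * g + 2) at_top at_top"
    by (rule filterlim_subseq) (simp add: strict_mono_def)
  then have "(\<lambda>g. few_factors_bound j (2 * g + 2)) \<longlonglongrightarrow> 0" for j
    using few_factors_bound_tendsto_0 by (rule filterlim_compose[rotated])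
  then have "?B \<longlonglongrightarrow> 2 * (\<Sum>j<(5::nat). 0)" by (intro tendsto_intros)
  then have "?B \<longlonglongrightarrow> 0" by simp
  \<comment> \<open>The bound does not involve p, so the limit over pairs reduces to the limit in
    g.\<close>
  moreover have "filterlim snd at_top ?F"
    by (rule filterlim_mono[OF filterlim_snd order_refl inf_le1])
  ultimately have lim: "((\<lambda>z. ?B (snd z)) \<longlongrightarrow> 0) ?F" by (rule filterlim_compose)
  \<comment> \<open>The principal part of the filter restricts to odd primes, where the bound on
    \<open>P2\<close> is available.\<close>
  have ev: "\<forall>\<^sub>F z in ?F. Factorial_Ring.prime (fst z) \<and> 2 < fst z"
    unfolding eventually_inf_principal by (rule always_eventually) auto
  show ?thesis
  proof (rule tendsto_sandwich[OF _ _ tendsto_const lim])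
    show "\<forall>\<^sub>F z in ?F. 0 \<le> (case z of (p, g) \<Rightarrow> P2 p g)"
      using ev by eventually_elim (auto simp: P2_bound(1) split: prod.split)
    show "\<forall>\<^sub>F z in ?F. (case z of (p, g) \<Rightarrow> P2 p g) \<le> ?B (snd z)"
      using ev by eventually_elim (use P2_bound(2) in \<open>auto split: prod.split\<close>)
  qed
qed

end
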